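(* Let $G$ be a locally compact second countable amenable group and $\mathbf X=(X,\mathscr X,\mu,G)$ a nontrivial standard Borel $G$-space. Then there exist an ordinal $\eta$ and a system of factors $\{\pi_\xi\colon\mathbf X\to\mathbf X_\xi\}_{\xi\le\eta}$ such that: (a) $\pi_\eta\colon\mathbf X\to\mathbf X_\eta$ is jointly relatively weak-mixing for $G$, or $\mathbf X_\eta=\mathbf X$ ($\mu$-mod $0$). (b) $\mathbf X_0\approx(X,\mathscr X_0,\mu,G)$ where $\mathscr X_0=\{\varnothing,X\}$. (c) For each pair of ordinals $\theta<\xi\le\eta$ there is a factor $G$-map $\pi_{\xi,\theta}\colon\mathbf X_\xi\to\mathbf X_\theta$ such that $\pi_\theta=\pi_{\xi,\theta}\circ\pi_\xi$. (d) For each ordinal $\xi<\eta$, $\pi_{\xi+1,\xi}\colon\mathbf X_{\xi+1}\to\mathbf X_\xi$ is a nontrivial relatively compact extension for $G$ itself. (e) If $\xi$ is a limit ordinal with $\xi\le\eta$, then $\mathbf X_\xi=\varprojlim_{\theta<\xi}\mathbf X_\theta$.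
   Context: Topological groups are Hausdorff. A standard Borel $G$-space $\mathbf X=(X,\mathscr X,\mu,G)$ is a standard Borel probability space $(X,\mathscr X,\mu)$ with a left action of $G$ by $\mu$-preserving transformations such that $(g,x)\mapsto g(x)$ is Borel measurable $G\times X\to X$. A Borel $G$-space is the same without requiring the probability space to be standard Borel. An extension (equivalently factor, factor $G$-map) $\pi\colon\mathbf X\to\mathbf Y=(Y,\mathscr Y,\nu,G)$ is a measure-preserving map $\pi\colon X\to Y$ with $\pi(g(x))=g(\pi(x))$ for all $g\in G,x\in X$. It is nontrivial if $\pi^{-1}[\mathscr Y]\ne\mathscr X$ ($\mu$-mod $0$). $\mathbf X$ is nontrivial if its map to the one-point system is nontrivial. A system $\mathbf Z=(Z,\mathscr Z,\mu,G)$ with factors $\beta_\theta\colon\mathbf Z\to\mathbf Z_\theta=(Z_\theta,\mathscr Z_\theta,\mu_\theta,G)$, $\theta\in\Theta$, is the inverse limit $\varprojlim_{\theta\in\Theta}\mathbf Z_\theta$ if $\mathscr Z=\sigma(\bigcup_\theta\beta_\theta^{-1}[\mathscr Z_\theta])$ ($\mu$-mod $0$). Short factors series. Given an extension $\pi\colon\mathbf X\to\mathbf Y$ with $\mathbf X$ a standard Borel $G$-space and $\mathbf Y$ a Borel $G$-space, and a $G$-invariant $\sigma$-subalgebra $\mathscr X'$ of $\mathscr X$ with $\pi^{-1}[\mathscr Y]\subseteq\mathscr X'$, put $\mathbf X'=(X,\mathscr X',\mu,G)$ and call $\mathbf X\xrightarrow{\mathrm{Id}_X}\mathbf X'\xrightarrow{\pi}\mathbf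 Y$ a short factors series. Let $\mu=\int_Y\mu_y\,\nu(dy)$ be the disintegration of $\mu$ over $\pi\colon\mathbf X\to\mathbf Y$ (probability measures $\mu_y$ on $(X,\mathscr X)$, $y\mapsto\mu_y(B)$ being $\mathscr Y$-measurable and $\mu_{\pi(x)}(B)=E_\mu(1_B|\pi^{-1}[\mathscr Y])(x)$ $\mu$-a.e. for each $B\in\mathscr X$). Let $\|\varphi\|_{2,y}=(\int_X|\varphi|^2d\mu_y)^{1/2}$, $U_g\varphi=\varphi\circ g$, and $\mu\otimes_{\mathbf Y}\mu=\int_Y\mu_y\otimes\mu_y\,\nu(dy)$ on $(X\times X,\mathscr X\otimes\mathscr X)$, with $G$ acting diagonally. $\varphi\in L^2(X,\mathscr X',\mu)$ is FK almost periodic (FK a.p.) for $G$ if for every $\varepsilon>0$ there are $\phi_1,\dots,\phi_k\in L^2(X,\mathscr X,\mu)$ such that for every $g\in G$, $\min_{j}\|U_g\varphi-\phi_j\|_{2,y}<\varepsilon$ for $\nu$-a.e. $y$. The extension $\pi\colon\mathbf X'\to\mathbf Y$ is relatively compact for $G$ if the FK a.p. functions for $G$ are dense in $L^2(X,\mathscr X',\mu)$. It is jointly relatively weak-mixing for $G$ if every $G$-invariant $H\in L^2(X\times X,\mathscr X'\otimes\mathscr X',\mu\otimes_{\mathbf Y}\mu)$ is ($\mu\otimes_{\mathbf Y}\mu$-a.e.) a function on $(Y,\mathscr Y,\nu)$, i.e. of the form $h(\pi(x))$ (here $\pi(x)=\pi(x')$ a.e.). For a link $\mathbf X_{\xi+1}\to\mathbf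 X_\xi$ of a chain of factors of $\mathbf X$ these notions refer to the short factors series $\mathbf X\to\mathbf X_{\xi+1}\to\mathbf X_\xi$ (disintegration of $\mu$ over $\mathbf X\to\mathbf X_\xi$); for $\pi_\eta\colon\mathbf X\to\mathbf X_\eta$ one takes $\mathbf X'=\mathbf X$. *)

theory Defs
  imports "HOL-Probability.Probability" "HOL-Algebra.Group_Action"
begin

section \<open>Topological groups and amenability\<close>

definition borel_of :: "'a topology \<Rightarrow> 'a measure" where
  "borel_of T = sigma (topspace T) {U. openin T U}"

definition topological_group :: "('g, 'm) monoid_scheme \<Rightarrow> 'g topology \<Rightarrow> bool" where
  "topological_group G T \<longleftrightarrow>
     group G \<and> topspace T = carrier G \<and> Hausdorff_space T \<and>
     continuous_map (prod_topology T T) T (\<lambda>(g, h). g \<otimes>\<^bsub>G\<^esub> h) \<and>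
     continuous_map T T (\<lambda>g. inv\<^bsub>G\<^esub> g)"

definition lcsc_group :: "('g, 'm) monoid_scheme \<Rightarrow> 'g topology \<Rightarrow> bool" where
  "lcsc_group G T \<longleftrightarrow>
     topological_group G T \<and> locally_compact_space T \<and> second_countable T"

text \<open>No regularity is demanded: on a second countable locally compact group, a Borel measure
  that is finite on compact sets is automatically Radon.\<close>

definition left_haar_measure :: "('g, 'm) monoid_scheme \<Rightarrow> 'g topology \<Rightarrow> 'g measure \<Rightarrow> bool" where
  "left_haar_measure G T m \<longleftrightarrow>
     sets m = sets (borel_of T) \<and> emeasure m (space m) \<noteq> 0 \<and>
     (\<forall>K. compactin T K \<longrightarrow> emeasure m K < \<infinity>) \<and>
     (\<forall>g\<in>carrier G. distr m m (\<lambda>h. g \<otimes>\<^bsub>G\<^esub> h) = m)"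

definition Linfty :: "'a measure \<Rightarrow> ('a \<Rightarrow> real) set" where
  "Linfty m = {f \<in> borel_measurable m. \<exists>C. AE x in m. \<bar>f x\<bar> \<le> C}"

text \<open>Means are functionals on representatives of classes in \<open>L\<^sup>\<infinity>\<close>; the second clause makes
  them functionals of the class.\<close>

definition left_invariant_mean ::
  "('g, 'm) monoid_scheme \<Rightarrow> 'g measure \<Rightarrow> (('g \<Rightarrow> real) \<Rightarrow> real) \<Rightarrow> bool" where
  "left_invariant_mean G m \<Lambda> \<longleftrightarrow>
     \<Lambda> (\<lambda>_. 1) = 1 \<and>
     (\<forall>f\<in>Linfty m. \<forall>f'\<in>Linfty m. (AE h in m. f h = f' h) \<longrightarrow> \<Lambda> f = \<Lambda> f') \<and>
     (\<forall>f\<in>Linfty m. \<forall>f'\<in>Linfty m. \<forall>a b. \<Lambda> (\<lambda>h. a * f h + b * f' h) = a * \<Lambda> f + b * \<Lambda> f') \<and>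
     (\<forall>f\<in>Linfty m. (AE h in m. 0 \<le> f h) \<longrightarrow> 0 \<le> \<Lambda> f) \<and>
     (\<forall>f\<in>Linfty m. \<forall>g\<in>carrier G. \<Lambda> (\<lambda>h. f (g \<otimes>\<^bsub>G\<^esub> h)) = \<Lambda> f)"

definition amenable :: "('g, 'm) monoid_scheme \<Rightarrow> 'g topology \<Rightarrow> bool" where
  "amenable G T \<longleftrightarrow> (\<exists>m \<Lambda>. left_haar_measure G T m \<and> left_invariant_mean G m \<Lambda>)"

section \<open>Borel G-spaces and their factors\<close>

record ('g, 'x) gspace =
  gmeas :: "'x measure"
  gact :: "'g \<Rightarrow> 'x \<Rightarrow> 'x"

definition standard_borel :: "'x measure \<Rightarrow> bool" where
  "standard_borel M \<longleftrightarrow>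
     (\<exists>T. completely_metrizable_space T \<and> second_countable T \<and>
          topspace T = space M \<and> sets M = sets (borel_of T))"

definition mpres :: "('x \<Rightarrow> 'y) \<Rightarrow> 'x measure \<Rightarrow> 'y measure \<Rightarrow> bool" where
  "mpres f M N \<longleftrightarrow> f \<in> measurable M N \<and> distr M N f = N"

text \<open>The library notion \<^const>\<open>group_action\<close> takes values in extensional bijections, so \<open>gact S g\<close> is normalised to be
  \<^const>\<open>undefined\<close> outside the space.\<close>

definition borel_gspace ::
  "('g, 'm) monoid_scheme \<Rightarrow> 'g topology \<Rightarrow> ('g, 'x) gspace \<Rightarrow> bool" where
  "borel_gspace G T S \<longleftrightarrow>
     prob_space (gmeas S) \<and>
     group_action G (space (gmeas S)) (gact S) \<and>
     (\<forall>g\<in>carrier G. mpres (gact S g) (gmeas S) (gmeas S)) \<and>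
     (\<lambda>(g, x). gact S g x) \<in> measurable (borel_of T \<Otimes>\<^sub>M gmeas S) (gmeas S)"

definition standard_borel_gspace ::
  "('g, 'm) monoid_scheme \<Rightarrow> 'g topology \<Rightarrow> ('g, 'x) gspace \<Rightarrow> bool" where
  "standard_borel_gspace G T S \<longleftrightarrow> borel_gspace G T S \<and> standard_borel (gmeas S)"

definition factor_map ::
  "('g, 'm) monoid_scheme \<Rightarrow> 'g topology \<Rightarrow> ('g, 'x) gspace \<Rightarrow> ('x \<Rightarrow> 'y) \<Rightarrow> ('g, 'y) gspace \<Rightarrow> bool"
  where
  "factor_map G T S \<pi> Y \<longleftrightarrow>
     borel_gspace G T S \<and> borel_gspace G T Y \<and>
     mpres \<pi> (gmeas S) (gmeas Y) \<and>
     (\<forall>g\<in>carrier G. \<forall>x\<in>space (gmeas S). \<pi> (gact S g x) = gact Y g (\<pi> x))"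

definition gspace_iso ::
  "('g, 'm) monoid_scheme \<Rightarrow> 'g topology \<Rightarrow> ('g, 'x) gspace \<Rightarrow> ('g, 'y) gspace \<Rightarrow> bool" where
  "gspace_iso G T S Y \<longleftrightarrow>
     (\<exists>\<phi> \<psi>. factor_map G T S \<phi> Y \<and> factor_map G T Y \<psi> S \<and>
        (\<forall>x\<in>space (gmeas S). \<psi> (\<phi> x) = x) \<and> (\<forall>y\<in>space (gmeas Y). \<phi> (\<psi> y) = y))"

text \<open>\<open>(X, {\<emptyset>, X}, \<mu>, G)\<close>\<close>

definition trivial_factor :: "('g, 'x) gspace \<Rightarrow> ('g, 'x) gspace" where
  "trivial_factor S =
     \<lparr>gmeas = restr_to_subalg (gmeas S) (sigma (space (gmeas S)) {{}, space (gmeas S)}),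
      gact = gact S\<rparr>"

definition eq_mod0 :: "'x measure \<Rightarrow> 'x set set \<Rightarrow> 'x set set \<Rightarrow> bool" where
  "eq_mod0 M \<A> \<B> \<longleftrightarrow>
     (\<forall>A\<in>\<A>. \<exists>B\<in>\<B>. (A - B) \<union> (B - A) \<in> null_sets M) \<and>
     (\<forall>B\<in>\<B>. \<exists>A\<in>\<A>. (A - B) \<union> (B - A) \<in> null_sets M)"

definition pullback :: "('g, 'x) gspace \<Rightarrow> ('x \<Rightarrow> 'y) \<Rightarrow> ('g, 'y) gspace \<Rightarrow> 'x measure" where
  "pullback S \<pi> Y = vimage_algebra (space (gmeas S)) \<pi> (gmeas Y)"

definition nontrivial_extension ::
  "('g, 'x) gspace \<Rightarrow> ('x \<Rightarrow> 'y) \<Rightarrow> ('g, 'y) gspace \<Rightarrow> bool" where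
  "nontrivial_extension S \<pi> Y \<longleftrightarrow>
     \<not> eq_mod0 (gmeas S) (sets (pullback S \<pi> Y)) (sets (gmeas S))"

definition one_point_gspace :: "('g, unit) gspace" where
  "one_point_gspace = \<lparr>gmeas = return (count_space UNIV) (), gact = (\<lambda>_ _. ())\<rparr>"

definition nontrivial_gspace :: "('g, 'x) gspace \<Rightarrow> bool" where
  "nontrivial_gspace S \<longleftrightarrow> nontrivial_extension S (\<lambda>_. ()) one_point_gspace"

definition inverse_limit ::
  "('g, 'm) monoid_scheme \<Rightarrow> 'g topology \<Rightarrow> ('g, 'z) gspace \<Rightarrow> 'i set \<Rightarrow>
   ('i \<Rightarrow> 'z \<Rightarrow> 'y) \<Rightarrow> ('i \<Rightarrow> ('g, 'y) gspace) \<Rightarrow> bool" where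
  "inverse_limit G T Z \<Theta> \<beta> Zs \<longleftrightarrow>
     (\<forall>\<theta>\<in>\<Theta>. factor_map G T Z (\<beta> \<theta>) (Zs \<theta>)) \<and>
     eq_mod0 (gmeas Z) (sets (gmeas Z))
       (sigma_sets (space (gmeas Z)) (\<Union>\<theta>\<in>\<Theta>. sets (pullback Z (\<beta> \<theta>) (Zs \<theta>))))"

section \<open>Relative compactness and joint relative weak mixing\<close>

text \<open>A sub-\<open>\<sigma>\<close>-algebra is given, as in \<^const>\<open>subalgebra\<close>, by a measure \<open>F\<close> of which only the
  measurable sets matter.\<close>

definition short_factors_series ::
  "('g, 'm) monoid_scheme \<Rightarrow> 'g topology \<Rightarrow> ('g, 'x) gspace \<Rightarrow> 'x measure \<Rightarrow> ('x \<Rightarrow> 'y) \<Rightarrow>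
   ('g, 'y) gspace \<Rightarrow> bool" where
  "short_factors_series G T S F \<pi> Y \<longleftrightarrow>
     standard_borel_gspace G T S \<and> factor_map G T S \<pi> Y \<and>
     subalgebra (gmeas S) F \<and>
     (\<forall>g\<in>carrier G. \<forall>A\<in>sets F. gact S g -` A \<inter> space (gmeas S) \<in> sets F) \<and>
     sets (pullback S \<pi> Y) \<subseteq> sets F"

definition disintegration ::
  "('g, 'x) gspace \<Rightarrow> ('x \<Rightarrow> 'y) \<Rightarrow> ('g, 'y) gspace \<Rightarrow> ('y \<Rightarrow> 'x measure) \<Rightarrow> bool" where
  "disintegration S \<pi> Y \<kappa> \<longleftrightarrow>
     \<kappa> \<in> measurable (gmeas Y) (prob_algebra (gmeas S)) \<and>
     (\<forall>B\<in>sets (gmeas S). AE x in gmeas S.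
        measure (\<kappa> (\<pi> x)) B = real_cond_exp (gmeas S) (pullback S \<pi> Y) (indicator B) x)"

definition L2 :: "'x measure \<Rightarrow> ('x \<Rightarrow> complex) set" where
  "L2 M = {f \<in> borel_measurable M. integrable M (\<lambda>x. (cmod (f x))\<^sup>2)}"

text \<open>For \<open>f \<in> L\<^sup>2(\<mu>)\<close> the integral is finite for almost every \<open>y\<close>; on the remaining null set
  the Bochner integral defaults to \<open>0\<close>, which is harmless.\<close>

definition fibre_norm :: "('y \<Rightarrow> 'x measure) \<Rightarrow> 'y \<Rightarrow> ('x \<Rightarrow> complex) \<Rightarrow> real" where
  "fibre_norm \<kappa> y f = sqrt (\<integral>x. (cmod (f x))\<^sup>2 \<partial>\<kappa> y)"

definition FK_almost_periodic ::
  "('g, 'm) monoid_scheme \<Rightarrow> ('g, 'x) gspace \<Rightarrow> ('g, 'y) gspace \<Rightarrow> ('y \<Rightarrow> 'x measure) \<Rightarrow>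
   ('x \<Rightarrow> complex) \<Rightarrow> bool" where
  "FK_almost_periodic G S Y \<kappa> \<phi> \<longleftrightarrow>
     (\<forall>\<epsilon>>0. \<exists>\<Psi>. finite \<Psi> \<and> \<Psi> \<noteq> {} \<and> \<Psi> \<subseteq> L2 (gmeas S) \<and>
        (\<forall>g\<in>carrier G. AE y in gmeas Y.
           (MIN \<psi>\<in>\<Psi>. fibre_norm \<kappa> y (\<lambda>x. \<phi> (gact S g x) - \<psi> x)) < \<epsilon>))"

text \<open>The disintegration in the next two definitions exists and is unique up to a null set,
  because \<open>S\<close> is standard Borel.\<close>

definition relatively_compact ::
  "('g, 'm) monoid_scheme \<Rightarrow> 'g topology \<Rightarrow> ('g, 'x) gspace \<Rightarrow> 'x measure \<Rightarrow> ('x \<Rightarrow> 'y) \<Rightarrow>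
   ('g, 'y) gspace \<Rightarrow> bool" where
  "relatively_compact G T S F \<pi> Y \<longleftrightarrow>
     short_factors_series G T S F \<pi> Y \<and>
     (\<exists>\<kappa>. disintegration S \<pi> Y \<kappa> \<and>
        (\<forall>\<phi>\<in>L2 (restr_to_subalg (gmeas S) F). \<forall>\<epsilon>>0.
           \<exists>\<psi>\<in>L2 (restr_to_subalg (gmeas S) F).
             FK_almost_periodic G S Y \<kappa> \<psi> \<and>
             sqrt (\<integral>x. (cmod (\<phi> x - \<psi> x))\<^sup>2 \<partial>gmeas S) < \<epsilon>))"

text \<open>\<open>\<mu> \<otimes>\<^sub>Y \<mu> = \<integral> \<mu>\<^sub>y \<otimes> \<mu>\<^sub>y \<nu>(dy)\<close>\<close>

definition fibre_square :: "('g, 'y) gspace \<Rightarrow> ('y \<Rightarrow> 'x measure) \<Rightarrow> ('x \<times> 'x) measure" where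
  "fibre_square Y \<kappa> = gmeas Y \<bind> (\<lambda>y. \<kappa> y \<Otimes>\<^sub>M \<kappa> y)"

definition jointly_relatively_weak_mixing ::
  "('g, 'm) monoid_scheme \<Rightarrow> 'g topology \<Rightarrow> ('g, 'x) gspace \<Rightarrow> 'x measure \<Rightarrow> ('x \<Rightarrow> 'y) \<Rightarrow>
   ('g, 'y) gspace \<Rightarrow> bool" where
  "jointly_relatively_weak_mixing G T S F \<pi> Y \<longleftrightarrow>
     short_factors_series G T S F \<pi> Y \<and>
     (\<exists>\<kappa>. disintegration S \<pi> Y \<kappa> \<and>
        (\<forall>H\<in>L2 (restr_to_subalg (fibre_square Y \<kappa>) (F \<Otimes>\<^sub>M F)).
           (\<forall>g\<in>carrier G. AE (x, x') in fibre_square Y \<kappa>. H (gact S g x, gact S g x') = H (x, x')) \<longrightarrow>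
           (\<exists>h\<in>borel_measurable (gmeas Y). AE (x, x') in fibre_square Y \<kappa>. H (x, x') = h (\<pi> x))))"

section \<open>Ordinals\<close>

text \<open>The closed initial segment \<open>{\<xi>. \<xi> \<le> \<eta>}\<close> of the ordinals is represented by a well-order
  \<open>r\<close> with greatest element \<open>\<eta>\<close>; its elements stand for the ordinals \<open>\<xi> \<le> \<eta>\<close>.\<close>

definition ordinals_upto :: "'i rel \<Rightarrow> 'i \<Rightarrow> bool" where
  "ordinals_upto r \<eta> \<longleftrightarrow> Well_order r \<and> \<eta> \<in> Field r \<and> (\<forall>\<xi>\<in>Field r. (\<xi>, \<eta>) \<in> r)"

definition ord_zero :: "'i rel \<Rightarrow> 'i" where
  "ord_zero r = wo_rel.minim r (Field r)"

text \<open>Meaningful only for \<open>\<xi>\<close> below the greatest element of \<open>r\<close>.\<close>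

definition ord_succ :: "'i rel \<Rightarrow> 'i \<Rightarrow> 'i" where
  "ord_succ r \<xi> = wo_rel.suc r {\<xi>}"

definition ord_limit :: "'i rel \<Rightarrow> 'i \<Rightarrow> bool" where
  "ord_limit r \<xi> \<longleftrightarrow> \<xi> \<in> Field r \<and> \<xi> \<noteq> ord_zero r \<and> (\<forall>\<theta>\<in>underS r \<xi>. \<xi> \<noteq> ord_succ r \<theta>)"

end

theory Submission
  imports Defs "HOL-Library.Ramsey"
begin

text \<open>
  The ordinals are realised by the factors themselves, as invariant sub-\<open>\<sigma>\<close>-algebras ordered by inclusion: starting
  from the trivial one, pass to generated \<open>\<sigma>\<close>-algebras at limits and to a nontrivial relatively compact extension
  at successors, until no such extension exists. The point is that it exists whenever \<open>X\<close> is not jointly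
  relatively weakly mixing over the factor \<open>A\<close>. Disintegrate \<open>\<mu>\<close> over \<open>A\<close> into \<open>\<kappa> x\<close>. A bounded invariant
  kernel \<open>H\<close> on the relative square that does not come from \<open>A\<close> yields a bounded \<open>f\<close> for which
  \<open>H * f = (\<lambda>x. \<integral>z. H (x, z) * f z \<partial>\<kappa> x)\<close> is not \<open>A\<close>-measurable, and the translates of \<open>H * f\<close> are
  \<open>H * (f \<circ> g)\<close>. Kernel operators with a common bound map uniformly bounded functions to sets whose packing
  numbers are bounded independently of the fibre, so a greedy choice on all fibres at once makes \<open>H * f\<close> almost
  periodic with a finite net that serves almost every fibre. Averaging \<open>H * f\<close> along orbits against Haar measure
  keeps it almost periodic and makes the generated \<open>\<sigma>\<close>-algebra jointly measurable for the action; the almost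
  periodic functions are closed under Lipschitz operations and hence dense.
\<close>


section \<open>Compactness of kernel operators\<close>

text \<open>One finite net has to serve almost every fibre, with an exceptional null set that may
  depend on \<open>g\<close>, while the spectrum of the kernel varies from fibre to fibre. An
  argument with eigenfunctions would need them chosen measurably and truncated at a uniform rank.
  Packing numbers need neither: they depend only on the tolerance and on bounds for the kernel and
  the functions. As the group may be uncountable, the centres cannot be found by enumerating
  translates; maximising the measure of countable unions gives countably many translates that
  exhaust the others up to null sets.

  The second obstacle is that factors are honest sigma-algebras, not classes modulo null sets. The
  sigma-algebra generated by \<open>H * f\<close> and its translates is invariant under each
  \<open>g\<close>, but nothing makes the action jointly measurable for it. Averages over sets of
  finite Haar measure repair this, because translating an average only moves its set. Nothing is
  lost: if all averages of \<open>H * f\<close> come from \<open>A\<close> modulo null sets, then so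
  does \<open>H * f\<close>, by Fubini and one translation back.\<close>

lemma abs_mult_le:
  fixes a b A B :: real
  assumes "\<bar>a\<bar> \<le> A" "\<bar>b\<bar> \<le> B"
  shows "\<bar>a * b\<bar> \<le> A * B"
proof -
  have "0 \<le> A" using assms(1) abs_ge_zero[of a] by linarith
  then show ?thesis unfolding abs_mult by (intro mult_mono assms) auto
qed

lemma abs_square_le:
  fixes a A :: real
  assumes "\<bar>a\<bar> \<le> A"
  shows "\<bar>a\<^sup>2\<bar> \<le> A\<^sup>2"
  using abs_mult_le[OF assms assms] by (simp add: power2_eq_square)

lemma (in prob_space) integrable_bounded:
  fixes f :: "'a \<Rightarrow> real"
  assumes "f \<in> borel_measurable M" "\<And>x. x \<in> space M \<Longrightarrow> \<bar>f x\<bar> \<le> B"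
  shows "integrable M f"
  by (rule integrable_const_bound[where B = B]) (use assms in auto)

lemma (in prob_space) abs_integral_le:
  fixes f :: "'a \<Rightarrow> real"
  assumes "f \<in> borel_measurable M" "\<And>x. x \<in> space M \<Longrightarrow> \<bar>f x\<bar> \<le> B"
  shows "\<bar>\<integral>x. f x \<partial>M\<bar> \<le> B"
proof -
  have "\<bar>\<integral>x. f x \<partial>M\<bar> \<le> (\<integral>x. \<bar>f x\<bar> \<partial>M)"
    by (rule integral_abs_bound)
  also have "\<dots> \<le> (\<integral>x. B \<partial>M)"
    using assms by (intro integral_mono integrable_abs integrable_bounded[of f B]) simp_all
  finally show ?thesis by (simp add: prob_space)
qed

lemma (in prob_space) integral_power2_le:
  fixes f :: "'a \<Rightarrow> real"
  assumes "f \<in> borel_measurable M" "\<And>x. x \<in> space M \<Longrightarrow> \<bar>f x\<bar> \<le> B"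
  shows "(\<integral>x. f x \<partial>M)\<^sup>2 \<le> (\<integral>x. (f x)\<^sup>2 \<partial>M)"
proof -
  have "\<bar>(f x)\<^sup>2\<bar> \<le> B\<^sup>2" if "x \<in> space M" for x
    by (rule abs_square_le[OF assms(2)[OF that]])
  then have "integrable M (\<lambda>x. (f x)\<^sup>2)"
    by (intro integrable_bounded) (use assms in auto)
  with variance_eq[of f] variance_positive[of f] integrable_bounded[OF assms]
  show ?thesis by simp
qed

text \<open>Finite Ramsey for pairs, phrased with an enumeration \<open>e\<close> of the homogeneous
  set so that its members can be paired off as \<open>e (2 * k)\<close> and
  \<open>e (2 * k + 1)\<close>.\<close>

lemma multicolour_ramsey_pairs:
  fixes q n :: nat
  shows "\<exists>N::nat. \<forall>c :: nat \<Rightarrow> nat \<Rightarrow> nat. (\<forall>i j. c i j = c j i) \<longrightarrow> (\<forall>i j. c i j < q) \<longrightarrow>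
     (\<exists>e p. inj_on e {..<n} \<and> e ` {..<n} \<subseteq> {..<N} \<and>
        (\<forall>i<n. \<forall>j<n. i \<noteq> j \<longrightarrow> c (e i) (e j) = p))"
proof -
  obtain N :: nat where N: "partn_lst {..<N} (replicate q n) 2"
    using ramsey_full by blast
  show ?thesis
  proof (intro exI[of _ N] allI impI)
    fix c :: "nat \<Rightarrow> nat \<Rightarrow> nat"
    assume sym: "\<forall>i j. c i j = c j i" and less: "\<forall>i j. c i j < q"
    \<comment> \<open>\<open>Min\<close> and \<open>Max\<close> only name the two elements of a
      pair; by symmetry of \<open>c\<close> their order is irrelevant.\<close>
    define F where "F S = c (Min S) (Max S)" for S
    have "F \<in> nsets {..<N} 2 \<rightarrow> {..<length (replicate q n)}"
      using less by (auto simp: F_def)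
    with N obtain p H where p: "p < q" and H: "H \<in> nsets {..<N} n"
      and hom: "F ` nsets H 2 \<subseteq> {p}"
      unfolding partn_lst_def monochromatic_def by fastforce
    have Fp: "c i j = p" if "i \<in> H" "j \<in> H" "i \<noteq> j" for i j
    proof -
      have "F {i, j} = p" using hom that by (auto simp: image_subset_iff)
      moreover have "F {i, j} = c i j"
        using sym that by (auto simp: F_def min_def max_def)
      ultimately show ?thesis by simp
    qed
    have "finite H" "card H = n" "H \<subseteq> {..<N}"
      using H by (auto simp: nsets_def)
    then obtain e where e: "bij_betw e {0..<n} H"
      using ex_bij_betw_nat_finite by blast
    have e': "inj_on e {..<n}" "e ` {..<n} = H"
      using e by (auto simp: bij_betw_def lessThan_atLeast0)
    show "\<exists>e p. inj_on e {..<n} \<and> e ` {..<n} \<subseteq> {..<N} \<and>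
        (\<forall>i<n. \<forall>j<n. i \<noteq> j \<longrightarrow> c (e i) (e j) = p)"
    proof (intro exI conjI allI impI)
      show "inj_on e {..<n}" "e ` {..<n} \<subseteq> {..<N}" using e' \<open>H \<subseteq> {..<N}\<close> by auto
      fix i j assume ij: "i < n" "j < n" "i \<noteq> j"
      then have "e i \<noteq> e j" using e'(1) by (auto dest: inj_onD)
      moreover have "e i \<in> H" "e j \<in> H" using ij e'(2) by auto
      ultimately show "c (e i) (e j) = p" by (intro Fp)
    qed
  qed
qed

text \<open>Bessel's inequality with an error term. With \<open>v\<close> the combination of the
  \<open>u k\<close> by their own coefficients, the sum \<open>S\<close> is the inner product of
  \<open>w\<close> and \<open>v\<close>, so \<open>S\<^sup>2\<close> is at most
  \<open>C\<^sup>2\<close> times the squared norm of \<open>v\<close>. There the diagonal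
  contributes at most \<open>4 * b\<^sup>2 * S\<close>. The off-diagonal terms are at most
  \<open>m\<^sup>2\<close> in number, and the tolerance carries the factor
  \<open>1 / m\<^sup>2\<close> so that their total does not grow with \<open>m\<close>.\<close>

lemma (in prob_space) almost_orthogonal_bessel:
  fixes u :: "nat \<Rightarrow> 'a \<Rightarrow> real" and w :: "'a \<Rightarrow> real"
  assumes u[measurable]: "\<And>k. u k \<in> borel_measurable M" and ub: "\<And>k x. \<bar>u k x\<bar> \<le> 2 * b"
    and w[measurable]: "w \<in> borel_measurable M" and wC: "\<And>x. \<bar>w x\<bar> \<le> C"
    and orth: "\<And>k l. k < m \<Longrightarrow> l < m \<Longrightarrow> k \<noteq> l \<Longrightarrow> \<bar>\<integral>z. u k z * u l z \<partial>M\<bar> \<le> 2 * (b\<^sup>2 / (real m)\<^sup>2)"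
    and pos: "b > 0" "C > 0" "m > 0"
  shows "(\<Sum>k<m. (\<integral>z. w z * u k z \<partial>M)\<^sup>2) \<le> 6 * (C\<^sup>2 * b\<^sup>2)"
proof -
  define a where "a k = (\<integral>z. w z * u k z \<partial>M)" for k
  define S where "S = (\<Sum>k<m. (a k)\<^sup>2)"
  define v where "v z = (\<Sum>k<m. a k * u k z)" for z
  have v[measurable]: "v \<in> borel_measurable M" unfolding v_def by measurable
  have wu: "\<bar>w z * u k z\<bar> \<le> C * (2 * b)" for k z
    by (rule abs_mult_le[OF wC ub])
  have iwu: "integrable M (\<lambda>z. w z * u k z)" for k
    by (rule integrable_bounded[OF _ wu]) measurable
  have uu: "\<bar>u k z * u l z\<bar> \<le> 4 * b\<^sup>2" for k l z
    using abs_mult_le[OF ub ub, of k z l z] by (simp add: power2_eq_square)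
  have iuu: "integrable M (\<lambda>z. u k z * u l z)" for k l
    by (rule integrable_bounded[OF _ uu]) measurable
  have ab: "\<bar>a k\<bar> \<le> 2 * b * C" for k
    unfolding a_def using abs_integral_le[OF _ wu[of _ k]] by (simp add: mult.commute mult.left_commute)
  have vb: "\<bar>v z\<bar> \<le> (\<Sum>k<m. \<bar>a k\<bar> * (2 * b))" for z
    unfolding v_def by (rule order_trans[OF sum_abs]) (auto simp: abs_mult intro!: sum_mono mult_left_mono ub)
  have wv: "\<bar>w z * v z\<bar> \<le> C * (\<Sum>k<m. \<bar>a k\<bar> * (2 * b))" for z
    by (rule abs_mult_le[OF wC vb])
  have "S = (\<Sum>k<m. a k * (\<integral>z. w z * u k z \<partial>M))"
    unfolding S_def a_def by (simp add: power2_eq_square)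
  also have "\<dots> = (\<integral>z. (\<Sum>k<m. a k * (w z * u k z)) \<partial>M)"
    using iwu by (subst Bochner_Integration.integral_sum) auto
  also have "\<dots> = (\<integral>z. w z * v z \<partial>M)"
    unfolding v_def by (rule Bochner_Integration.integral_cong) (auto simp: sum_distrib_left ac_simps)
  finally have S1: "S = (\<integral>z. w z * v z \<partial>M)" .
  have "S\<^sup>2 \<le> (\<integral>z. (w z * v z)\<^sup>2 \<partial>M)"
    unfolding S1 by (rule integral_power2_le[OF _ wv]) measurable
  also have "\<dots> \<le> (\<integral>z. C\<^sup>2 * (v z)\<^sup>2 \<partial>M)"
  proof (rule integral_mono)
    show "integrable M (\<lambda>z. (w z * v z)\<^sup>2)"
      by (rule integrable_bounded[OF _ abs_square_le[OF wv]]) measurable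
    have "integrable M (\<lambda>z. (v z)\<^sup>2)"
      by (rule integrable_bounded[OF _ abs_square_le[OF vb]]) measurable
    then show "integrable M (\<lambda>z. C\<^sup>2 * (v z)\<^sup>2)" by simp
    fix z
    have "(w z)\<^sup>2 \<le> C\<^sup>2" using abs_square_le[OF wC[of z]] by simp
    then show "(w z * v z)\<^sup>2 \<le> C\<^sup>2 * (v z)\<^sup>2"
      by (simp add: power_mult_distrib mult_right_mono)
  qed
  also have "\<dots> = C\<^sup>2 * (\<integral>z. (\<Sum>k<m. \<Sum>l<m. (a k * a l) * (u k z * u l z)) \<partial>M)"
  proof -
    have "(v z)\<^sup>2 = (\<Sum>k<m. \<Sum>l<m. (a k * a l) * (u k z * u l z))" for z
      unfolding v_def power2_eq_square sum_product by (simp add: ac_simps)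
    then show ?thesis by simp
  qed
  also have "(\<integral>z. (\<Sum>k<m. \<Sum>l<m. (a k * a l) * (u k z * u l z)) \<partial>M) =
      (\<Sum>k<m. \<Sum>l<m. (a k * a l) * (\<integral>z. u k z * u l z \<partial>M))"
    using iuu by (subst Bochner_Integration.integral_sum, simp)+ simp
  also have "\<dots> \<le> (\<Sum>k<m. \<Sum>l<m. (if k = l then (a k)\<^sup>2 * (4 * b\<^sup>2) else 0) + (2 * b * C)\<^sup>2 * (2 * (b\<^sup>2 / (real m)\<^sup>2)))"
  proof (intro sum_mono)
    fix k l assume kl: "k \<in> {..<m}" "l \<in> {..<m}"
    have nn: "(2 * b * C)\<^sup>2 * (2 * (b\<^sup>2 / (real m)\<^sup>2)) \<ge> 0" by simp
    show "(a k * a l) * (\<integral>z. u k z * u l z \<partial>M) \<le>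
        (if k = l then (a k)\<^sup>2 * (4 * b\<^sup>2) else 0) + (2 * b * C)\<^sup>2 * (2 * (b\<^sup>2 / (real m)\<^sup>2))"
    proof (cases "k = l")
      case True
      have "(a k)\<^sup>2 * (\<integral>z. u k z * u k z \<partial>M) \<le> (a k)\<^sup>2 * (4 * b\<^sup>2)"
        using abs_integral_le[OF _ uu[of k _ k]] by (intro mult_left_mono) auto
      with True nn show ?thesis by (simp add: power2_eq_square)
    next
      case False
      have "(a k * a l) * (\<integral>z. u k z * u l z \<partial>M) \<le> \<bar>a k\<bar> * \<bar>a l\<bar> * \<bar>\<integral>z. u k z * u l z \<partial>M\<bar>"
        by (metis abs_ge_self abs_mult)
      also have "\<dots> \<le> (2 * b * C) * (2 * b * C) * (2 * (b\<^sup>2 / (real m)\<^sup>2))"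
        by (intro mult_mono ab orth) (use kl False pos in auto)
      finally show ?thesis using False by (simp add: power2_eq_square)
    qed
  qed
  also have "\<dots> = 4 * b\<^sup>2 * S + 8 * (b\<^sup>2)\<^sup>2 * C\<^sup>2"
  proof -
    have "(\<Sum>k<m. \<Sum>l<m. (if k = l then A k else 0) + c) = (\<Sum>k<m. A k) + (real m)\<^sup>2 * c"
      for A :: "nat \<Rightarrow> real" and c
      by (simp add: sum.distrib power2_eq_square)
    moreover have "(real m)\<^sup>2 * ((2 * b * C)\<^sup>2 * (2 * (b\<^sup>2 / (real m)\<^sup>2))) = 8 * (b\<^sup>2)\<^sup>2 * C\<^sup>2"
      using pos by (simp add: power2_eq_square)
    moreover have "(\<Sum>k<m. (a k)\<^sup>2 * (4 * b\<^sup>2)) = 4 * b\<^sup>2 * S"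
      unfolding S_def sum_distrib_right[symmetric] by simp
    ultimately show ?thesis by simp
  qed
  finally have S2: "S\<^sup>2 \<le> C\<^sup>2 * (4 * b\<^sup>2 * S + 8 * (b\<^sup>2)\<^sup>2 * C\<^sup>2)"
    by (simp add: mult_left_mono)
  \<comment> \<open>In units of \<open>t\<close> the inequality is
    \<open>S\<^sup>2 \<le> 4 * t * S + 8 * t\<^sup>2\<close>. It fails beyond \<open>6 * t\<close>,
    since there \<open>8 * t\<^sup>2\<close> is less than \<open>2 * t * S\<close>.\<close>
  define t where "t = C\<^sup>2 * b\<^sup>2"
  have t0: "t \<ge> 0" unfolding t_def by simp
  have S3: "S * S \<le> 4 * t * S + 8 * t * t"
    using S2 unfolding t_def by (simp add: algebra_simps power2_eq_square)
  have "S \<le> 6 * t"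
  proof (rule ccontr)
    assume "\<not> S \<le> 6 * t"
    then have lt: "6 * t < S" by simp
    have "t * (6 * t) \<le> t * S" using lt t0 by (intro mult_left_mono) auto
    moreover have "6 * t * S < S * S" using lt t0 by (intro mult_strict_right_mono) auto
    moreover have "0 \<le> t * t" by simp
    ultimately show False using S3 by linarith
  qed
  then show ?thesis unfolding S_def a_def t_def .
qed

text \<open>By Ramsey's theorem a long list of bounded functions contains a subfamily with almost constant pairwise
  inner products; consecutive differences in it are almost orthogonal.\<close>

lemma kernel_packing:
  fixes C b \<epsilon> :: real
  assumes pos: "\<epsilon> > 0" "C > 0" "b > 0"
  shows "\<exists>N::nat. \<forall>(P :: 'x measure) H f. prob_space P \<longrightarrow> H \<in> borel_measurable (P \<Otimes>\<^sub>M P) \<longrightarrow>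
     (\<forall>z. \<bar>H z\<bar> \<le> C) \<longrightarrow> (\<forall>i. f i \<in> borel_measurable P) \<longrightarrow> (\<forall>i x. \<bar>f i x\<bar> \<le> b) \<longrightarrow>
     (\<exists>i<N. \<exists>j<N. i \<noteq> j \<and>
        (\<integral>x. ((\<integral>z. H (x, z) * f i z \<partial>P) - (\<integral>z. H (x, z) * f j z \<partial>P))\<^sup>2 \<partial>P) < \<epsilon>)"
proof -
  \<comment> \<open>If \<open>m\<close> numbers have a sum below \<open>m * \<epsilon>\<close>, one
    of them is below \<open>\<epsilon>\<close>; the bound on the sum is the one from
    \<open>almost_orthogonal_bessel\<close>.\<close>
  obtain m :: nat where m0: "m > 0" and m: "6 * (C\<^sup>2 * b\<^sup>2) < real m * \<epsilon>"
  proof -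
    obtain m :: nat where "6 * (C\<^sup>2 * b\<^sup>2) / \<epsilon> < real m" using reals_Archimedean2 by blast
    moreover have "0 \<le> 6 * (C\<^sup>2 * b\<^sup>2) / \<epsilon>" using pos by simp
    ultimately have "real m > 0" "6 * (C\<^sup>2 * b\<^sup>2) < real m * \<epsilon>" using pos
      by (linarith, simp add: field_simps)
    then have "m > 0" "6 * (C\<^sup>2 * b\<^sup>2) < real m * \<epsilon>" by simp_all
    then show ?thesis using that by blast
  qed
  \<comment> \<open>\<open>\<delta>\<close> is half of the orthogonality tolerance required for
    \<open>m\<close> functions. The inner products, shifted by \<open>b\<^sup>2\<close>, lie between
    0 and \<open>2 * b\<^sup>2\<close>, and \<open>q\<close> boxes of width \<open>\<delta>\<close>
    cover that range.\<close>
  define \<delta> where "\<delta> = b\<^sup>2 / (real m)\<^sup>2"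
  have \<delta>: "\<delta> > 0" unfolding \<delta>_def using pos m0 by simp
  define q where "q = Suc (nat \<lfloor>2 * b\<^sup>2 / \<delta>\<rfloor>)"
  obtain N :: nat where N: "\<And>c :: nat \<Rightarrow> nat \<Rightarrow> nat. (\<forall>i j. c i j = c j i) \<Longrightarrow> (\<forall>i j. c i j < q) \<Longrightarrow>
     (\<exists>e p. inj_on e {..<2 * m} \<and> e ` {..<2 * m} \<subseteq> {..<N} \<and>
        (\<forall>i<2 * m. \<forall>j<2 * m. i \<noteq> j \<longrightarrow> c (e i) (e j) = p))"
    using multicolour_ramsey_pairs[of q "2 * m"] by blast
  show ?thesis
  proof (rule exI[of _ N], intro allI impI)
    fix P :: "'x measure" and H :: "'x \<times> 'x \<Rightarrow> real" and f :: "nat \<Rightarrow> 'x \<Rightarrow> real"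
    assume "prob_space P" and H[measurable]: "H \<in> borel_measurable (P \<Otimes>\<^sub>M P)"
      and HC: "\<forall>z. \<bar>H z\<bar> \<le> C" and f[measurable]: "\<forall>i. f i \<in> borel_measurable P"
      and fb: "\<forall>i x. \<bar>f i x\<bar> \<le> b"
    interpret prob_space P by fact
    have fm[measurable]: "f i \<in> borel_measurable P" for i using f by blast
    have ff: "\<bar>f i z * f j z\<bar> \<le> b\<^sup>2" for i j z
      unfolding power2_eq_square using abs_mult_le fb by blast
    have iff: "integrable P (\<lambda>z. f i z * f j z)" for i j
      by (rule integrable_bounded[OF _ ff]) measurable
    define I where "I i j = (\<integral>z. f i z * f j z \<partial>P)" for i j
    have Ib: "\<bar>I i j\<bar> \<le> b\<^sup>2" for i j
      unfolding I_def by (rule abs_integral_le[OF _ ff]) measurable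
    define c where "c i j = nat \<lfloor>(I i j + b\<^sup>2) / \<delta>\<rfloor>" for i j
    have "\<forall>i j. c i j = c j i" unfolding c_def I_def by (simp add: mult.commute)
    moreover have "\<forall>i j. c i j < q"
    proof (intro allI)
      fix i j
      have "(I i j + b\<^sup>2) / \<delta> \<le> 2 * b\<^sup>2 / \<delta>"
        using Ib[of i j] \<delta> by (intro divide_right_mono) auto
      then show "c i j < q" unfolding c_def q_def
        by (simp add: floor_mono nat_mono less_Suc_eq_le)
    qed
    ultimately obtain e p where e: "inj_on e {..<2 * m}" "e ` {..<2 * m} \<subseteq> {..<N}"
      and hom: "\<And>i j. i < 2 * m \<Longrightarrow> j < 2 * m \<Longrightarrow> i \<noteq> j \<Longrightarrow> c (e i) (e j) = p"
      using N by metis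
    have near: "\<bar>I (e i) (e j) - (real p * \<delta> - b\<^sup>2 + \<delta> / 2)\<bar> \<le> \<delta> / 2"
      if "i < 2 * m" "j < 2 * m" "i \<noteq> j" for i j
    proof -
      let ?r = "(I (e i) (e j) + b\<^sup>2) / \<delta>"
      have "?r \<ge> 0" using Ib[of "e i" "e j"] \<delta> by simp
      moreover have "nat \<lfloor>?r\<rfloor> = p" using hom[OF that] unfolding c_def .
      ultimately have "real p \<le> ?r" "?r < real p + 1"
        by linarith+
      then have "real p * \<delta> \<le> I (e i) (e j) + b\<^sup>2" "I (e i) (e j) + b\<^sup>2 \<le> real p * \<delta> + \<delta>"
        using \<delta> by (auto simp: field_simps)
      then show ?thesis unfolding abs_le_iff by (simp add: field_simps)
    qed
    define u where "u k z = f (e (2 * k)) z - f (e (2 * k + 1)) z" for k z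
    have um[measurable]: "u k \<in> borel_measurable P" for k unfolding u_def by measurable
    have ub: "\<bar>u k z\<bar> \<le> 2 * b" for k z
    proof -
      have "\<bar>f (e (2 * k)) z\<bar> \<le> b" "\<bar>f (e (2 * k + 1)) z\<bar> \<le> b" using fb by auto
      then show ?thesis unfolding u_def by linarith
    qed
    \<comment> \<open>The four inner products are between distinct indices, hence within
      \<open>\<delta> / 2\<close> of one common number, which cancels in the alternating sum. The
      norms \<open>I i i\<close>, which the colouring does not control, do not occur.\<close>
    have orth: "\<bar>\<integral>z. u k z * u l z \<partial>P\<bar> \<le> 2 * \<delta>" if "k < m" "l < m" "k \<noteq> l" for k l
    proof -
      have "(\<integral>z. u k z * u l z \<partial>P) = (\<integral>z. (f (e (2*k)) z * f (e (2*l)) z - f (e (2*k)) z * f (e (2*l+1)) z)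
          - (f (e (2*k+1)) z * f (e (2*l)) z - f (e (2*k+1)) z * f (e (2*l+1)) z) \<partial>P)"
        by (rule Bochner_Integration.integral_cong) (auto simp: u_def algebra_simps)
      also have "\<dots> = (I (e (2*k)) (e (2*l)) - I (e (2*k)) (e (2*l+1)))
          - (I (e (2*k+1)) (e (2*l)) - I (e (2*k+1)) (e (2*l+1)))"
        unfolding I_def using iff by simp
      finally have eq: "(\<integral>z. u k z * u l z \<partial>P) = \<dots>" .
      have "2*k \<noteq> 2*l" "2*k \<noteq> 2*l+1" "2*k+1 \<noteq> 2*l" "2*k+1 \<noteq> 2*l+1" using that by presburger+
      moreover have "2*k < 2*m" "2*l < 2*m" "2*k+1 < 2*m" "2*l+1 < 2*m" using that by auto
      ultimately show ?thesis unfolding eq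
        using near[of "2*k" "2*l"] near[of "2*k" "2*l+1"] near[of "2*k+1" "2*l"] near[of "2*k+1" "2*l+1"]
        unfolding abs_le_iff by auto
    qed
    define A where "A k x = (\<integral>z. H (x, z) * u k z \<partial>P)" for k x
    have Am[measurable]: "A k \<in> borel_measurable P" for k unfolding A_def by measurable
    have Hu: "\<bar>H (x, z) * u k z\<bar> \<le> C * (2 * b)" for x z k
      using abs_mult_le HC ub by blast
    have Ab: "\<bar>A k x\<bar> \<le> C * (2 * b)" if "x \<in> space P" for k x
      unfolding A_def by (rule abs_integral_le[OF _ Hu]) (use that in measurable)
    have iA: "integrable P (\<lambda>x. (A k x)\<^sup>2)" for k
      by (rule integrable_bounded[OF _ abs_square_le[OF Ab]]) measurable
    \<comment> \<open>Applied to the section \<open>H (x, _)\<close> for each \<open>x\<close>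
      separately. The bound does not depend on \<open>x\<close>, so it survives integration.\<close>
    have bessel: "(\<Sum>k<m. (A k x)\<^sup>2) \<le> 6 * (C\<^sup>2 * b\<^sup>2)" if "x \<in> space P" for x
      unfolding A_def
      by (rule almost_orthogonal_bessel) (use that HC ub orth pos m0 in \<open>auto simp: \<delta>_def\<close>)
    have "(\<Sum>k<m. (\<integral>x. (A k x)\<^sup>2 \<partial>P)) = (\<integral>x. (\<Sum>k<m. (A k x)\<^sup>2) \<partial>P)"
      using iA by (subst Bochner_Integration.integral_sum) auto
    also have "\<dots> \<le> (\<integral>x. 6 * (C\<^sup>2 * b\<^sup>2) \<partial>P)"
      using iA bessel by (intro integral_mono) auto
    also have "\<dots> < real m * \<epsilon>" using m by (simp add: prob_space)
    finally have sum_less: "(\<Sum>k<m. (\<integral>x. (A k x)\<^sup>2 \<partial>P)) < real m * \<epsilon>" .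
    have "\<exists>k<m. (\<integral>x. (A k x)\<^sup>2 \<partial>P) < \<epsilon>"
    proof (rule ccontr)
      assume "\<not> ?thesis"
      then have "(\<Sum>k<m. \<epsilon>) \<le> (\<Sum>k<m. (\<integral>x. (A k x)\<^sup>2 \<partial>P))" by (intro sum_mono) (metis lessThan_iff not_less)
      then show False using sum_less by simp
    qed
    then obtain k where k: "k < m" "(\<integral>x. (A k x)\<^sup>2 \<partial>P) < \<epsilon>" by blast
    have Hf: "\<bar>H (x, z) * f i z\<bar> \<le> C * b" for x z i
      using abs_mult_le HC fb by blast
    have Aeq: "A k x = (\<integral>z. H (x, z) * f (e (2*k)) z \<partial>P) - (\<integral>z. H (x, z) * f (e (2*k+1)) z \<partial>P)"
      if "x \<in> space P" for x
    proof -
      have "integrable P (\<lambda>z. H (x, z) * f i z)" for i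
        by (rule integrable_bounded[OF _ Hf]) (use that in measurable)
      then show ?thesis unfolding A_def u_def right_diff_distrib by simp
    qed
    have "(\<integral>x. ((\<integral>z. H (x, z) * f (e (2*k)) z \<partial>P) - (\<integral>z. H (x, z) * f (e (2*k+1)) z \<partial>P))\<^sup>2 \<partial>P) < \<epsilon>"
      using k(2) Aeq by (simp cong: Bochner_Integration.integral_cong)
    moreover have "e (2*k) < N" "e (2*k+1) < N" using e(2) k(1) by (simp_all add: image_subset_iff)
    moreover have "e (2*k) \<noteq> e (2*k+1)"
    proof
      assume "e (2*k) = e (2*k+1)"
      then have "2*k = 2*k+1" by (rule inj_onD[OF e(1)]) (use k(1) in simp_all)
      then show False by simp
    qed
    ultimately show "\<exists>i<N. \<exists>j<N. i \<noteq> j \<and>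
        (\<integral>x. ((\<integral>z. H (x, z) * f i z \<partial>P) - (\<integral>z. H (x, z) * f j z \<partial>P))\<^sup>2 \<partial>P) < \<epsilon>"
      by blast
  qed
qed

section \<open>Disintegration over a sub-sigma-algebra\<close>

definition base4 :: "(nat \<Rightarrow> bool) \<Rightarrow> real" where
  "base4 \<beta> = (\<Sum>j. of_bool (\<beta> j) * (1/4) ^ Suc j)"

text \<open>Drops the first \<open>j\<close> digits. On reals that are no codes the value means
  nothing, but the function is Borel on the whole line.\<close>

fun base4_rest :: "nat \<Rightarrow> real \<Rightarrow> real" where
  "base4_rest 0 s = s"
| "base4_rest (Suc j) s = 4 * base4_rest j s - (if base4_rest j s \<ge> 1/4 then 1 else 0)"

lemma summable_base4: "summable (\<lambda>j. of_bool (\<beta> j) * (1/4::real) ^ Suc j)"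
proof (rule summable_comparison_test')
  show "summable (\<lambda>j. (1/4::real) ^ Suc j)"
    by (subst summable_Suc_iff) (simp add: summable_geometric)
qed auto

lemma base4_bounds: "0 \<le> base4 \<beta>" "base4 \<beta> \<le> 1/3"
proof -
  show "0 \<le> base4 \<beta>"
    unfolding base4_def by (intro suminf_nonneg summable_base4) auto
  have "(\<lambda>j. (1/4::real) ^ Suc j) sums (1/4 * (1 / (1 - 1/4)))"
    unfolding power_Suc by (intro sums_mult geometric_sums) auto
  then have s: "(\<lambda>j. (1/4::real) ^ Suc j) sums (1/3)" by simp
  have "base4 \<beta> \<le> (\<Sum>j. (1/4::real) ^ Suc j)"
    unfolding base4_def by (intro suminf_le summable_base4 sums_summable[OF s]) auto
  then show "base4 \<beta> \<le> 1/3" using sums_unique[OF s] by simp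
qed

lemma base4_head: "base4 \<beta> = of_bool (\<beta> 0) / 4 + base4 (\<lambda>j. \<beta> (Suc j)) / 4"
proof -
  have "base4 \<beta> = of_bool (\<beta> 0) * (1/4) ^ Suc 0 + (\<Sum>j. of_bool (\<beta> (Suc j)) * (1/4::real) ^ Suc (Suc j))"
    unfolding base4_def using suminf_split_head[OF summable_base4, of \<beta>] by simp
  also have "(\<Sum>j. of_bool (\<beta> (Suc j)) * (1/4::real) ^ Suc (Suc j)) =
      (\<Sum>j. (of_bool (\<beta> (Suc j)) * (1/4::real) ^ Suc j) / 4)"
    by (simp add: field_simps)
  also have "\<dots> = base4 (\<lambda>j. \<beta> (Suc j)) / 4"
    unfolding base4_def by (intro suminf_divide summable_base4)
  finally show ?thesis by simp
qed

text \<open>All digits after the first together contribute at most 1/12, so they cannot imitate a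
  leading 1. With base 2 the tail could reach the value of the leading digit and the code would be
  ambiguous.\<close>

lemma base4_ge_iff: "base4 \<beta> \<ge> 1/4 \<longleftrightarrow> \<beta> 0"
  using base4_head[of \<beta>] base4_bounds[of "\<lambda>j. \<beta> (Suc j)"] by (cases "\<beta> 0") auto

lemma base4_rest_base4: "base4_rest j (base4 \<beta>) = base4 (\<lambda>i. \<beta> (i + j))"
proof (induction j)
  case (Suc j)
  have "base4_rest (Suc j) (base4 \<beta>) = 4 * base4 (\<lambda>i. \<beta> (i + j)) - of_bool (\<beta> j)"
    using base4_ge_iff[of "\<lambda>i. \<beta> (i + j)"] by (simp add: Suc.IH)
  also have "\<dots> = base4 (\<lambda>i. \<beta> (i + Suc j))"
    using base4_head[of "\<lambda>i. \<beta> (i + j)"] by simp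
  finally show ?case .
qed simp

lemma base4_digit: "base4_rest j (base4 \<beta>) \<ge> 1/4 \<longleftrightarrow> \<beta> j"
  unfolding base4_rest_base4 base4_ge_iff by simp

lemma measurable_base4_rest[measurable]: "base4_rest j \<in> borel_measurable borel"
proof (induction j)
  case (Suc j)
  note Suc[measurable]
  show ?case unfolding base4_rest.simps by measurable
qed simp

text \<open>A point is coded by the digits saying which balls of radius \<open>2\<^sup>-\<^sup>k\<close> around a dense sequence contain it;
  decoding picks for each \<open>k\<close> the first such ball and takes the limit of the centres.\<close>

lemma standard_borel_retract_of_real:
  assumes sb: "standard_borel M" and ne: "space M \<noteq> {}"
  obtains \<Phi> :: "'x \<Rightarrow> real" and \<Psi> where "\<Phi> \<in> borel_measurable M" "\<Psi> \<in> measurable borel M"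
    "\<And>x. x \<in> space M \<Longrightarrow> \<Psi> (\<Phi> x) = x" "\<And>x. 0 \<le> \<Phi> x" "\<And>x. \<Phi> x \<le> 1"
proof -
  obtain T where T: "completely_metrizable_space T" "second_countable T" "topspace T = space M"
    "sets M = sets (borel_of T)"
    using sb unfolding standard_borel_def by blast
  obtain S d where Sd: "Metric_space S d" "Metric_space.mcomplete S d" "T = Metric_space.mtopology S d"
    using T(1) unfolding completely_metrizable_space_def by blast
  interpret Metric_space S d by fact
  have S: "S = space M" using T(3) Sd(3) by simp
  have setsM: "sets M = sigma_sets (space M) {U. openin T U}"
  proof -
    have "{U. openin T U} \<subseteq> Pow (space M)" using openin_subset T(3) by fastforce
    then show ?thesis using T(3,4) by (simp add: borel_of_def)
  qed
  have openM: "U \<in> sets M" if "openin T U" for U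
    using that unfolding setsM by auto
  have "separable_space T" using T(2) by (rule second_countable_imp_separable_space)
  then obtain C where C: "countable C" "C \<subseteq> S" "T closure_of C = S"
    unfolding separable_space_def using Sd(3) by auto
  have "C \<noteq> {}" using C(3) ne S by auto
  define a where "a = from_nat_into C"
  have aS: "a n \<in> S" for n using C(2) \<open>C \<noteq> {}\<close> unfolding a_def by (meson from_nat_into subsetD)
  have adense: "\<exists>n. d x (a n) < r" if "x \<in> S" "r > 0" for x r
  proof -
    have "x \<in> T closure_of C" using C(3) that by simp
    then have "\<exists>y\<in>C. y \<in> mball x r"
      unfolding Sd(3) metric_closure_of using that(2) by blast
    then obtain y where "y \<in> C" "y \<in> mball x r" ..
    moreover obtain n where "a n = y" using \<open>y \<in> C\<close> C(1) unfolding a_def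
      by (metis from_nat_into_to_nat_on)
    ultimately show ?thesis by auto
  qed
  define bit where "bit x j = (case prod_decode j of (k, n) \<Rightarrow> d x (a n) < (1/2)^k)" for x j
  define \<Phi> where "\<Phi> x = base4 (bit x)" for x
  have bit_m: "Measurable.pred M (\<lambda>x. bit x j)" for j
  proof -
    obtain k n where kn: "prod_decode j = (k, n)" by force
    have "{x \<in> space M. bit x j} = mball (a n) ((1/2)^k)"
      unfolding bit_def kn S[symmetric] by (auto simp: commute aS)
    then show ?thesis using openM[of "mball (a n) ((1/2)^k)"] Sd(3) by (simp add: pred_def)
  qed
  have \<Phi>m: "\<Phi> \<in> borel_measurable M"
    unfolding \<Phi>_def base4_def using bit_m by measurable
  \<comment> \<open>For a real that codes no point there may be no such \<open>n\<close>; the value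
    is then some default index, and \<open>D\<close> below tests whatever centres result.\<close>
  define nk where "nk k t = (LEAST n. base4_rest (prod_encode (k, n)) t \<ge> 1/4)" for k t
  have nk_m[measurable]: "nk k \<in> measurable borel (count_space UNIV)" for k
    unfolding nk_def by measurable
  define p where "p t q \<longleftrightarrow> q \<in> S \<and> (\<forall>k. d q (a (nk k t)) \<le> (1/2)^k)" for t q
  \<comment> \<open>For the code of a point these bounds are the triangle inequality through that
    point. Conversely they make the chosen centres a Cauchy sequence whose limit is within
    \<open>(1/2)^k\<close> of the \<open>k\<close>-th centre. Outside \<open>D\<close> decoding
    returns a fixed point \<open>x0\<close>, so it is defined on all reals.\<close>
  define D where "D = {t. \<forall>k l. d (a (nk k t)) (a (nk l t)) \<le> (1/2)^k + (1/2)^l}"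
  have D_m[measurable]: "D \<in> sets borel"
  proof -
    have "Measurable.pred borel (\<lambda>t. d (a (nk k t)) (a (nk l t)) \<le> (1/2)^k + (1/2)^l)" for k l
    proof -
      have "(\<lambda>t. (nk k t, nk l t)) \<in> measurable borel (count_space UNIV)"
      proof -
        have "(\<lambda>t. (nk k t, nk l t)) \<in> measurable borel (count_space UNIV \<Otimes>\<^sub>M count_space UNIV)"
          by measurable
        then show ?thesis by (simp add: pair_measure_countable)
      qed
      then have "(\<lambda>t. (\<lambda>(m, n). d (a m) (a n) \<le> (1/2)^k + (1/2)^l) (nk k t, nk l t)) \<in> measurable borel (count_space UNIV)"
        by (rule measurable_compose) simp
      then show ?thesis by simp
    qed
    then have "{t \<in> space borel. \<forall>k l. d (a (nk k t)) (a (nk l t)) \<le> (1/2)^k + (1/2)^l} \<in> sets borel"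
      by measurable
    then show ?thesis unfolding D_def by simp
  qed
  have small: "\<exists>k. (1/2::real)^k < e" if "e > 0" for e
    using real_arch_pow_inv[OF that, of "1/2"] by auto
  have ex: "\<exists>q. p t q" if "t \<in> D" for t
  proof -
    have Dt: "d (a (nk k t)) (a (nk l t)) \<le> (1/2)^k + (1/2)^l" for k l
      using that unfolding D_def by auto
    have mono: "(1/2::real)^n \<le> (1/2)^k" if "k \<le> n" for k n :: nat
      using that by (intro power_decreasing) auto
    have "MCauchy (\<lambda>k. a (nk k t))"
      unfolding MCauchy_def
    proof (intro conjI allI impI)
      show "range (\<lambda>k. a (nk k t)) \<subseteq> S" using aS by auto
      fix e :: real assume "e > 0"
      then obtain K where K: "(1/2::real)^K < e / 2" using small[of "e/2"] by auto
      show "\<exists>N. \<forall>n n'. N \<le> n \<longrightarrow> N \<le> n' \<longrightarrow> d (a (nk n t)) (a (nk n' t)) < e"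
      proof (intro exI[of _ K] allI impI)
        fix n n' assume "K \<le> n" "K \<le> n'"
        then show "d (a (nk n t)) (a (nk n' t)) < e"
          using Dt[of n n'] mono[of K n] mono[of K n'] K by linarith
      qed
    qed
    then obtain q where q: "limitin mtopology (\<lambda>k. a (nk k t)) q sequentially"
      using Sd(2) unfolding mcomplete_def by blast
    then have qS: "q \<in> S" by (simp add: limitin_mspace)
    have "d q (a (nk k t)) \<le> (1/2)^k" for k
    proof (rule field_le_epsilon)
      fix e :: real assume e: "e > 0"
      obtain K where K: "(1/2::real)^K < e / 2" using small[of "e/2"] e by auto
      have "\<forall>\<^sub>F l in sequentially. d (a (nk l t)) q < e / 2"
        using q[unfolded limitin_metric, THEN conjunct2, rule_format, OF half_gt_zero[OF e]]
        by (rule eventually_mono) blast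
      then obtain L where L: "\<And>l. l \<ge> L \<Longrightarrow> d (a (nk l t)) q < e / 2"
        unfolding eventually_sequentially by blast
      define l where "l = max K L"
      have "d q (a (nk k t)) \<le> d q (a (nk l t)) + d (a (nk l t)) (a (nk k t))"
        by (rule triangle) (use aS qS in auto)
      also have "\<dots> \<le> e / 2 + ((1/2)^l + (1/2)^k)"
        using L[of l] Dt[of l k] by (auto simp: l_def commute intro!: add_mono)
      also have "\<dots> \<le> (1/2)^k + e"
      proof -
        have "(1/2::real)^l \<le> (1/2)^K" by (rule mono) (simp add: l_def)
        then show ?thesis using K by linarith
      qed
      finally show "d q (a (nk k t)) \<le> (1/2)^k + e" .
    qed
    then show ?thesis using qS unfolding p_def by blast
  qed
  have uniq: "q = q'" if "p t q" "p t q'" for t q q'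
  proof (rule ccontr)
    assume "q \<noteq> q'"
    have qS: "q \<in> S" "q' \<in> S" using that unfolding p_def by auto
    then have "d q q' > 0" using \<open>q \<noteq> q'\<close> by simp
    then obtain k where k: "(1/2::real)^k < d q q' / 2" using small[of "d q q' / 2"] by auto
    have "d q q' \<le> d q (a (nk k t)) + d (a (nk k t)) q'"
      by (rule triangle) (use aS qS in auto)
    also have "\<dots> \<le> (1/2)^k + (1/2)^k"
      using that unfolding p_def by (intro add_mono) (auto simp: commute)
    finally show False using k by simp
  qed
  obtain x0 where x0: "x0 \<in> S" using ne S by auto
  define \<Psi> where "\<Psi> t = (if t \<in> D then (SOME q. p t q) else x0)" for t
  have \<Psi>p: "p t (\<Psi> t)" if "t \<in> D" for t
    using someI_ex[OF ex[OF that]] that unfolding \<Psi>_def by simp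
  have \<Psi>S: "\<Psi> t \<in> S" for t using \<Psi>p[of t] x0 unfolding p_def by (cases "t \<in> D") (auto simp: \<Psi>_def)
  have inv: "\<Psi> (\<Phi> x) = x" if "x \<in> space M" for x
  proof -
    have xS: "x \<in> S" using that S by simp
    have dig: "base4_rest (prod_encode (k, n)) (\<Phi> x) \<ge> 1/4 \<longleftrightarrow> d x (a n) < (1/2)^k" for k n
      unfolding \<Phi>_def base4_digit bit_def by simp
    have close: "d x (a (nk k (\<Phi> x))) < (1/2)^k" for k
      unfolding nk_def dig by (rule LeastI_ex) (rule adense[OF xS], simp)
    have "d (a (nk k (\<Phi> x))) (a (nk l (\<Phi> x))) \<le> (1/2)^k + (1/2)^l" for k l
    proof -
      have "d (a (nk k (\<Phi> x))) (a (nk l (\<Phi> x))) \<le> d (a (nk k (\<Phi> x))) x + d x (a (nk l (\<Phi> x)))"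
        by (rule triangle) (use aS xS in auto)
      then show ?thesis using close[of k] close[of l] commute[of x] by (smt (verit))
    qed
    then have "\<Phi> x \<in> D" unfolding D_def by blast
    moreover have "p (\<Phi> x) x" unfolding p_def using xS close by (auto intro: less_imp_le)
    ultimately show ?thesis using uniq \<Psi>p by blast
  qed
  have \<Psi>m: "\<Psi> \<in> measurable borel M"
  proof (rule measurable_sigma_sets[OF setsM])
    show "{U. openin T U} \<subseteq> Pow (space M)" using openin_subset T(3) by fastforce
    show "\<Psi> \<in> space borel \<rightarrow> space M" using \<Psi>S S by auto
    fix U assume "U \<in> {U. openin T U}"
    then have U: "openin T U" by simp
    \<comment> \<open>The decoded point lies in each of the chosen closed balls, whose radii tend to
      0. It is therefore in the open set \<open>U\<close> exactly when one of these balls is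
      contained in \<open>U\<close>, which is a countable condition on the code.\<close>
    define N where "N k = {n. mcball (a n) ((1/2)^k) \<subseteq> U}" for k
    have iff: "\<Psi> t \<in> U \<longleftrightarrow> (\<exists>k. nk k t \<in> N k)" if "t \<in> D" for t
    proof
      note pt = \<Psi>p[OF that, unfolded p_def]
      assume "\<Psi> t \<in> U"
      then obtain r where r: "r > 0" "mball (\<Psi> t) r \<subseteq> U"
        using U unfolding Sd(3) openin_mtopology by blast
      obtain k where k: "(1/2::real)^k < r / 2" using small[of "r/2"] r by auto
      have "mcball (a (nk k t)) ((1/2)^k) \<subseteq> mball (\<Psi> t) r"
      proof
        fix z assume "z \<in> mcball (a (nk k t)) ((1/2)^k)"
        then have z: "z \<in> S" "d (a (nk k t)) z \<le> (1/2)^k" by auto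
        have "d (\<Psi> t) z \<le> d (\<Psi> t) (a (nk k t)) + d (a (nk k t)) z"
          by (rule triangle) (use aS \<Psi>S z in auto)
        also have "\<dots> < r" using z pt k by (smt (verit) field_sum_of_halves)
        finally show "z \<in> mball (\<Psi> t) r" using z \<Psi>S by auto
      qed
      then show "\<exists>k. nk k t \<in> N k" unfolding N_def using r(2) by auto
    next
      note pt = \<Psi>p[OF that, unfolded p_def]
      assume "\<exists>k. nk k t \<in> N k"
      then obtain k where k: "mcball (a (nk k t)) ((1/2)^k) \<subseteq> U" unfolding N_def by auto
      have "\<Psi> t \<in> mcball (a (nk k t)) ((1/2)^k)"
        using pt aS \<Psi>S by (auto simp: commute)
      then show "\<Psi> t \<in> U" using k by blast
    qed
    have "\<Psi> -` U \<inter> space borel = (D \<inter> {t \<in> space borel. \<exists>k. nk k t \<in> N k}) \<union> (if x0 \<in> U then - D else {})"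
    proof (rule Set.set_eqI)
      fix t
      show "t \<in> \<Psi> -` U \<inter> space borel \<longleftrightarrow>
          t \<in> (D \<inter> {t \<in> space borel. \<exists>k. nk k t \<in> N k}) \<union> (if x0 \<in> U then - D else {})"
        by (cases "t \<in> D") (use iff[of t] in \<open>auto simp: \<Psi>_def\<close>)
    qed
    also have "\<dots> \<in> sets borel"
    proof -
      have "{t \<in> space borel. \<exists>k. nk k t \<in> N k} \<in> sets borel" by measurable
      then show ?thesis by auto
    qed
    finally show "\<Psi> -` U \<inter> space borel \<in> sets borel" .
  qed
  show ?thesis
    by (rule that[of \<Phi> \<Psi>, OF \<Phi>m \<Psi>m inv])
      (use base4_bounds in \<open>auto simp: \<Phi>_def intro: order_trans[OF base4_bounds(2)]\<close>)
qed

text \<open>The conditional law of a real variable is the image of Lebesgue measure on \<open>[0,1]\<close> under the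
  conditional quantile function.\<close>

lemma (in prob_space) conditional_law_real:
  fixes \<Phi> :: "'a \<Rightarrow> real"
  assumes sub: "subalgebra M A" and \<Phi>[measurable]: "\<Phi> \<in> borel_measurable M"
    and bd: "\<And>x. 0 \<le> \<Phi> x" "\<And>x. \<Phi> x \<le> 1"
  obtains L where "L \<in> measurable A (prob_algebra borel)"
    "\<And>a B. a \<in> sets A \<Longrightarrow> B \<in> sets borel \<Longrightarrow>
       (\<integral>\<^sup>+x. emeasure (L x) B * indicator a x \<partial>M) = emeasure M (a \<inter> (\<Phi> -` B \<inter> space M))"
proof -
  interpret sigma_finite_subalgebra M A
    by (intro finite_measure_subalgebra_is_sigma_finite finite_measure_subalgebra.intro
        finite_measure_subalgebra_axioms.intro sub finite_measure_axioms)
  have AM: "sets A \<subseteq> sets M" "space A = space M" using sub unfolding subalgebra_def by auto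
  define I :: "real \<Rightarrow> 'a \<Rightarrow> real" where "I q = indicator {x \<in> space M. \<Phi> x > q}" for q
  have Im[measurable]: "I q \<in> borel_measurable M" for q unfolding I_def by measurable
  have Iint: "integrable M (I q)" for q
    by (rule integrable_bounded[where B = 1]) (auto simp: I_def)
  define F where "F q = real_cond_exp M A (I q)" for q
  have FA[measurable]: "F q \<in> borel_measurable A" for q unfolding F_def by measurable
  have FM[measurable]: "F q \<in> borel_measurable M" for q unfolding F_def by measurable
  have F0: "AE x in M. 0 \<le> F q x" for q
    unfolding F_def by (rule real_cond_exp_pos) (auto simp: I_def)
  have F1: "AE x in M. F q x \<le> 1" for q
    unfolding F_def by (rule real_cond_exp_le_c) (use Iint in \<open>auto simp: I_def\<close>)
  have Fmono: "AE x in M. F q' x \<le> F q x" if "q \<le> q'" for q q'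
    unfolding F_def by (rule real_cond_exp_mono) (use Iint that in \<open>auto simp: I_def split: split_indicator\<close>)
  \<comment> \<open>\<open>F q x\<close> is the conditional probability of
    \<open>\<Phi> > q\<close>, decreasing in \<open>q\<close>, and \<open>Q\<close> is its
    generalised inverse. Rationals keep the conditions countable, and 0 is put in to make the set
    nonempty. The joint measurability of \<open>Q\<close> then holds without any almost-everywhere
    property of \<open>F\<close>.\<close>
  define R where "R x t = {q \<in> \<rat> \<inter> {0..1::real}. q = 0 \<or> t \<le> F q x}" for x t
  define Q where "Q x t = Sup (R x t)" for x t
  have R0: "0 \<in> R x t" for x t unfolding R_def by auto
  have Rb: "bdd_above (R x t)" for x t unfolding R_def by (rule bdd_aboveI[of _ 1]) auto
  have Qgr: "s < Q x t \<longleftrightarrow> (\<exists>q\<in>\<rat> \<inter> {0..1}. s < q \<and> (q = 0 \<or> t \<le> F q x))" for s x t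
    unfolding Q_def using less_cSup_iff[OF _ Rb, of x t s] R0[of x t] unfolding R_def by blast
  have cQ: "countable (\<rat> \<inter> {0..1::real})" using countable_rat by auto
  have Qm[measurable]: "(\<lambda>(x, t). Q x t) \<in> borel_measurable (A \<Otimes>\<^sub>M borel)"
  proof (subst borel_measurable_iff_greater, intro allI)
    fix s
    have "{w \<in> space (A \<Otimes>\<^sub>M borel). s < (case w of (x, t) \<Rightarrow> Q x t)} =
      {w \<in> space (A \<Otimes>\<^sub>M borel). \<exists>q\<in>\<rat> \<inter> {0..1}. s < q \<and> (q = 0 \<or> snd w \<le> F q (fst w))}"
      using Qgr by (auto simp: split_beta)
    also have "\<dots> \<in> sets (A \<Otimes>\<^sub>M borel)"
    proof -
      have "Measurable.pred (A \<Otimes>\<^sub>M borel) (\<lambda>w. s < q \<and> (q = 0 \<or> snd w \<le> F q (fst w)))" for q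
        by measurable
      then show ?thesis
        by (intro sets.sets_Collect_countable_Ex' cQ) (simp add: pred_def)
    qed
    finally show "{w \<in> space (A \<Otimes>\<^sub>M borel). s < (case w of (x, t) \<Rightarrow> Q x t)} \<in> sets (A \<Otimes>\<^sub>M borel)" .
  qed
  define U where "U = uniform_measure lborel {0..1::real}"
  have prob_U: "prob_space U" unfolding U_def by (rule prob_space_uniform_measure) auto
  then interpret U: prob_space U .
  have setsU[measurable_cong]: "sets U = sets borel" unfolding U_def by simp
  have U_le: "emeasure U {..c} = ennreal c" if "0 \<le> c" "c \<le> 1" for c
  proof -
    have "{0..1} \<inter> {..c} = {0..c}" using that by auto
    then show ?thesis unfolding U_def using that
      by (subst emeasure_uniform_measure) (auto simp: divide_ennreal_def)
  qed
  define L where "L x = distr U borel (Q x)" for x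
  have Lm: "L \<in> measurable A (prob_algebra borel)"
    unfolding L_def
  proof (rule measurable_distr_prob_space2[where M = U])
    show "(\<lambda>x. U) \<in> measurable A (prob_algebra U)"
      by (rule measurable_const) (simp add: space_prob_algebra prob_U)
    show "(\<lambda>(x, y). Q x y) \<in> measurable (A \<Otimes>\<^sub>M U) borel"
      using Qm measurable_cong_sets[OF sets_pair_measure_cong[OF refl setsU] refl] by blast
  qed
  have Qx[measurable]: "Q x \<in> borel_measurable borel" if "x \<in> space A" for x
    using measurable_Pair2[OF Qm that] by simp
  have Lgr: "(\<integral>\<^sup>+x. emeasure (L x) {s<..} * indicator a x \<partial>M) = emeasure M (a \<inter> {x \<in> space M. \<Phi> x > s})"
    if a: "a \<in> sets A" for a s
  proof -
    have aM[measurable]: "a \<in> sets M" using a AM by auto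
    have Lx: "emeasure (L x) {s<..} = emeasure U {t. s < Q x t}" if "x \<in> space M" for x
      unfolding L_def using Qx[of x] that AM
      by (subst emeasure_distr) (auto simp: vimage_def U_def measurable_cong_sets[OF setsU refl])
    \<comment> \<open>Both \<open>Q\<close> and \<open>\<Phi>\<close> take values between 0 and 1,
      so only the middle case has content.\<close>
    consider "s < 0" | "0 \<le> s" "s < 1" | "1 \<le> s" by linarith
    then show ?thesis
    proof cases
      case 1
      then have "s < Q x t" for x t unfolding Qgr by (intro bexI[of _ 0]) auto
      then have "emeasure (L x) {s<..} = 1" if "x \<in> space M" for x
        using Lx[OF that] U.emeasure_space_1 by (simp add: U_def)
      then have "(\<integral>\<^sup>+x. emeasure (L x) {s<..} * indicator a x \<partial>M) = (\<integral>\<^sup>+x. indicator a x \<partial>M)"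
        by (intro nn_integral_cong) simp
      moreover have "a \<inter> {x \<in> space M. \<Phi> x > s} = a"
      proof -
        have "\<Phi> x > s" for x using bd(1)[of x] 1 by linarith
        then show ?thesis using sets.sets_into_space[OF aM] by auto
      qed
      ultimately show ?thesis by simp
    next
      case 3
      then have "\<not> s < Q x t" for x t unfolding Qgr by auto
      then have "emeasure (L x) {s<..} = 0" if "x \<in> space M" for x
        using Lx[OF that] by simp
      then have "(\<integral>\<^sup>+x. emeasure (L x) {s<..} * indicator a x \<partial>M) = (\<integral>\<^sup>+x. 0 \<partial>M)"
        by (intro nn_integral_cong) simp
      moreover have "a \<inter> {x \<in> space M. \<Phi> x > s} = {}"
      proof -
        have "\<not> \<Phi> x > s" for x using bd(2)[of x] 3 by linarith
        then show ?thesis by auto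
      qed
      ultimately show ?thesis by simp
    next
      case 2
      \<comment> \<open>Rationals tending to \<open>s\<close> from above; their running minima
        \<open>p\<close> are also decreasing. Almost everywhere the set of \<open>t\<close> with
        \<open>s < Q x t\<close> is then the increasing union of the half-lines up to
        \<open>F (p n) x\<close>, and \<open>U\<close> gives such a half-line the mass
        \<open>F (p n) x\<close>.\<close>
      define q where "q n = (SOME q. q \<in> \<rat> \<and> s < q \<and> q < s + (1 - s) / real (Suc n))" for n
      have q: "q n \<in> \<rat>" "s < q n" "q n < s + (1 - s) / real (Suc n)" for n
      proof -
        have "s < s + (1 - s) / real (Suc n)" using 2 by simp
        then have "\<exists>q. q \<in> \<rat> \<and> s < q \<and> q < s + (1 - s) / real (Suc n)"
          using Rats_dense_in_real by blast
        from someI_ex[OF this] show "q n \<in> \<rat>" "s < q n" "q n < s + (1 - s) / real (Suc n)"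
          unfolding q_def by blast+
      qed
      have q1: "q n \<le> 1" for n
      proof -
        have "(1 - s) / real (Suc n) \<le> (1 - s) / 1" using 2 by (intro divide_left_mono) auto
        then show ?thesis using q(3)[of n] by simp
      qed
      define p where "p n = Min (q ` {..n})" for n
      have pin: "p n \<in> q ` {..n}" for n unfolding p_def by (rule Min_in) auto
      have pR: "p n \<in> \<rat>" "s < p n" "p n \<le> 1" for n using pin[of n] q q1 by auto
      have pdec: "p (Suc n) \<le> p n" for n unfolding p_def by (rule Min_antimono) auto
      have pq: "p n \<le> q n" for n unfolding p_def by (rule Min_le) auto
      have plim: "\<exists>n. p n < r" if "s < r" for r
      proof -
        obtain n where n: "inverse (real (Suc n)) < (r - s) / (1 - s)"
          using reals_Archimedean[of "(r - s) / (1 - s)"] \<open>s < r\<close> 2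
          by (metis diff_gt_0_iff_gt divide_pos_pos)
        then have "(1 - s) / real (Suc n) < r - s" using 2 by (simp add: field_simps)
        then show ?thesis using q(3)[of n] pq[of n] by (intro exI[of _ n]) linarith
      qed
      have AEF: "AE x in M. (\<forall>r\<in>\<rat> \<inter> {0..1}. 0 \<le> F r x \<and> F r x \<le> 1) \<and>
          (\<forall>r\<in>\<rat> \<inter> {0..1}. \<forall>r'\<in>\<rat> \<inter> {0..1}. r \<le> r' \<longrightarrow> F r' x \<le> F r x)"
      proof -
        have "AE x in M. \<forall>r\<in>\<rat> \<inter> {0..1}. 0 \<le> F r x \<and> F r x \<le> 1"
          using F0 F1 cQ by (subst AE_ball_countable) auto
        moreover have "AE x in M. \<forall>r\<in>\<rat> \<inter> {0..1}. \<forall>r'\<in>\<rat> \<inter> {0..1}. r \<le> r' \<longrightarrow> F r' x \<le> F r x"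
          using Fmono cQ by (subst AE_ball_countable, simp, intro ballI, subst AE_ball_countable) auto
        ultimately show ?thesis by eventually_elim auto
      qed
      have "AE x in M. emeasure (L x) {s<..} * indicator a x = (SUP n. ennreal (F (p n) x) * indicator a x)"
        using AEF AE_space
      proof eventually_elim
        case (elim x)
        have pin': "p n \<in> \<rat> \<inter> {0..1}" for n using pR[of n] 2 by auto
        have Fp: "0 \<le> F (p n) x" "F (p n) x \<le> 1" for n using elim pin' by blast+
        have Fpm: "F (p m) x \<le> F (p n) x" if "n \<ge> m" for m n
        proof -
          have "p n \<le> p m" using pdec that by (rule lift_Suc_antimono_le)
          then show ?thesis using elim pin' by blast
        qed
        have "{t. s < Q x t} = (\<Union>n. {..F (p n) x})"
        proof (intro equalityI subsetI)
          fix t assume "t \<in> {t. s < Q x t}"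
          then obtain r where r: "r \<in> \<rat> \<inter> {0..1}" "s < r" "t \<le> F r x"
            unfolding mem_Collect_eq Qgr using 2 by auto
          obtain n where n: "p n < r" using plim[OF r(2)] by auto
          then have "F r x \<le> F (p n) x" using elim pin'[of n] r(1) by auto
          then have "t \<le> F (p n) x" using r(3) by linarith
          then show "t \<in> (\<Union>n. {..F (p n) x})" by blast
        next
          fix t assume "t \<in> (\<Union>n. {..F (p n) x})"
          then obtain n where "t \<le> F (p n) x" by auto
          then show "t \<in> {t. s < Q x t}" unfolding mem_Collect_eq Qgr
            using pR(2)[of n] pin'[of n] by (intro bexI[of _ "p n"]) auto
        qed
        then have "emeasure (L x) {s<..} = emeasure U (\<Union>n. {..F (p n) x})"
          using Lx elim by simp
        also have "\<dots> = (SUP n. emeasure U {..F (p n) x})"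
          by (rule SUP_emeasure_incseq[symmetric])
            (use Fpm in \<open>auto simp: incseq_def setsU\<close>)
        also have "\<dots> = (SUP n. ennreal (F (p n) x))" using U_le Fp by simp
        finally show ?case by (simp add: SUP_mult_right_ennreal split: split_indicator)
      qed
      then have "(\<integral>\<^sup>+x. emeasure (L x) {s<..} * indicator a x \<partial>M) =
          (\<integral>\<^sup>+x. (SUP n. ennreal (F (p n) x) * indicator a x) \<partial>M)"
        by (rule nn_integral_cong_AE)
      also have "\<dots> = (SUP n. \<integral>\<^sup>+x. ennreal (F (p n) x) * indicator a x \<partial>M)"
      proof (rule nn_integral_monotone_convergence_SUP_AE)
        fix n
        show "AE x in M. ennreal (F (p n) x) * indicator a x \<le> ennreal (F (p (Suc n)) x) * indicator a x"
          using Fmono[OF pdec[of n]] by eventually_elim (auto intro!: mult_right_mono ennreal_leI)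
      qed measurable
      also have "\<dots> = (SUP n. emeasure M (a \<inter> {x \<in> space M. \<Phi> x > p n}))"
      proof (rule SUP_cong[OF refl])
        fix n
        have i: "integrable M (\<lambda>x. F (p n) x * indicator a x)"
        proof (rule integrable_const_bound[where B = 1])
          show "AE x in M. norm (F (p n) x * indicator a x) \<le> 1"
            using F0[of "p n"] F1[of "p n"] by eventually_elim (auto split: split_indicator)
        qed measurable
        have "(\<integral>\<^sup>+x. ennreal (F (p n) x) * indicator a x \<partial>M) = (\<integral>\<^sup>+x. ennreal (F (p n) x * indicator a x) \<partial>M)"
          by (intro nn_integral_cong) (auto split: split_indicator)
        also have "\<dots> = ennreal (\<integral>x. F (p n) x * indicator a x \<partial>M)"
          using F0[of "p n"] by (intro nn_integral_eq_integral i) (auto elim: eventually_mono)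
        also have "(\<integral>x. F (p n) x * indicator a x \<partial>M) = (\<integral>x\<in>a. F (p n) x \<partial>M)"
          unfolding set_lebesgue_integral_def by (simp add: mult.commute)
        also have "\<dots> = (\<integral>x\<in>a. I (p n) x \<partial>M)"
          unfolding F_def by (rule real_cond_exp_intA[OF Iint a, symmetric])
        also have "\<dots> = (\<integral>x. indicator (a \<inter> {x \<in> space M. \<Phi> x > p n}) x \<partial>M)"
          unfolding set_lebesgue_integral_def I_def
          by (intro Bochner_Integration.integral_cong) (auto split: split_indicator)
        also have "\<dots> = measure M (a \<inter> {x \<in> space M. \<Phi> x > p n})"
          by simp
        finally show "(\<integral>\<^sup>+x. ennreal (F (p n) x) * indicator a x \<partial>M) = emeasure M (a \<inter> {x \<in> space M. \<Phi> x > p n})"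
          by (simp add: emeasure_eq_measure)
      qed
      also have "\<dots> = emeasure M (\<Union>n. a \<inter> {x \<in> space M. \<Phi> x > p n})"
      proof (rule SUP_emeasure_incseq)
        have "p n \<le> p m" if "m \<le> n" for m n using pdec that by (rule lift_Suc_antimono_le)
        then show "incseq (\<lambda>n. a \<inter> {x \<in> space M. p n < \<Phi> x})"
          unfolding incseq_def by (fastforce intro: le_less_trans)
      qed auto
      also have "(\<Union>n. a \<inter> {x \<in> space M. \<Phi> x > p n}) = a \<inter> {x \<in> space M. \<Phi> x > s}"
        using pR(2) plim by (fastforce intro: less_trans)
      finally show ?thesis .
    qed
  qed
  show ?thesis
  proof (rule that[OF Lm])
    fix a B assume a: "a \<in> sets A" and B: "B \<in> sets (borel :: real measure)"
    have aM[measurable]: "a \<in> sets M" using a AM by auto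
    have LmM: "L \<in> measurable M (subprob_algebra borel)"
      by (rule measurable_from_subalg[OF sub measurable_prob_algebraD[OF Lm]])
    \<comment> \<open>For fixed \<open>a\<close> both sides are finite measures as functions of
      \<open>B\<close>, so the half-lines treated above determine them.\<close>
    define m1 where "m1 = density M (indicator a) \<bind> L"
    have m1: "emeasure m1 B = (\<integral>\<^sup>+x. emeasure (L x) B * indicator a x \<partial>M)" if "B \<in> sets borel" for B
    proof -
      have "emeasure m1 B = (\<integral>\<^sup>+x. emeasure (L x) B \<partial>density M (indicator a))"
        unfolding m1_def by (rule emeasure_bind[OF _ _ that]) (use LmM not_empty in auto)
      also have "\<dots> = (\<integral>\<^sup>+x. indicator a x * emeasure (L x) B \<partial>M)"
        using LmM that by (subst nn_integral_density) (auto intro: measurable_emeasure_kernel)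
      finally show ?thesis by (simp add: mult.commute)
    qed
    define m2 where "m2 = distr (density M (indicator a)) borel \<Phi>"
    have m2: "emeasure m2 B = emeasure M (a \<inter> (\<Phi> -` B \<inter> space M))" if [measurable]: "B \<in> sets borel" for B
    proof -
      have "\<Phi> -` B \<inter> space M \<in> sets M" by measurable
      then show ?thesis
        unfolding m2_def by (simp add: emeasure_distr emeasure_density nn_integral_indicator
            flip: indicator_inter_arith)
    qed
    have "m1 = m2"
    proof (rule measure_eqI_lessThan)
      show "sets m1 = sets borel" unfolding m1_def
        by (rule sets_bind) (use subprob_measurableD(2)[OF LmM] not_empty in simp_all)
      show "sets m2 = sets borel" unfolding m2_def by simp
      fix s
      have eq: "emeasure m1 {s<..} = emeasure M (a \<inter> {x \<in> space M. \<Phi> x > s})"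
        by (subst m1, simp) (rule Lgr[OF a])
      then show "emeasure m1 {s<..} < \<infinity>" by (simp add: less_top[symmetric])
      show "emeasure m1 {s<..} = emeasure m2 {s<..}"
        unfolding eq by (subst m2) (auto intro!: arg_cong[where f = "emeasure M"])
    qed
    then show "(\<integral>\<^sup>+x. emeasure (L x) B * indicator a x \<partial>M) = emeasure M (a \<inter> (\<Phi> -` B \<inter> space M))"
      using m1[OF B] m2[OF B] by simp
  qed
qed

text \<open>The conditional law of the code of a point is pushed forward by the decoding map.
  Decoding inverts coding on the space, so pulling \<open>B\<close> back along both maps returns
  \<open>B\<close>.\<close>

lemma (in prob_space) disintegration_kernel_exists:
  assumes sb: "standard_borel M" and sub: "subalgebra M A"
  obtains \<kappa> where "\<kappa> \<in> measurable A (prob_algebra M)"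
    "\<And>a B. a \<in> sets A \<Longrightarrow> B \<in> sets M \<Longrightarrow>
       (\<integral>\<^sup>+x. emeasure (\<kappa> x) B * indicator a x \<partial>M) = emeasure M (a \<inter> B)"
proof -
  obtain \<Phi> :: "'a \<Rightarrow> real" and \<Psi> where \<Phi>[measurable]: "\<Phi> \<in> borel_measurable M"
    and \<Psi>[measurable]: "\<Psi> \<in> measurable borel M"
    and inv: "\<And>x. x \<in> space M \<Longrightarrow> \<Psi> (\<Phi> x) = x" and bd: "\<And>x. 0 \<le> \<Phi> x" "\<And>x. \<Phi> x \<le> 1"
    using standard_borel_retract_of_real[OF sb not_empty] by metis
  obtain L where L: "L \<in> measurable A (prob_algebra borel)"
    "\<And>a B. a \<in> sets A \<Longrightarrow> B \<in> sets borel \<Longrightarrow>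
       (\<integral>\<^sup>+x. emeasure (L x) B * indicator a x \<partial>M) = emeasure M (a \<inter> (\<Phi> -` B \<inter> space M))"
    by (rule conditional_law_real[OF sub \<Phi> bd]) blast
  show ?thesis
  proof (rule that[of "\<lambda>x. distr (L x) M \<Psi>"])
    show "(\<lambda>x. distr (L x) M \<Psi>) \<in> measurable A (prob_algebra M)"
      by (rule measurable_compose[OF L(1) measurable_distr_prob_space[OF \<Psi>]])
    fix a B assume a: "a \<in> sets A" and B[measurable]: "B \<in> sets M"
    have sp: "space M = space A" using sub by (simp add: subalgebra_def)
    have B': "\<Psi> -` B \<inter> space borel \<in> sets borel" by measurable
    have "emeasure (distr (L x) M \<Psi>) B = emeasure (L x) (\<Psi> -` B \<inter> space borel)" if "x \<in> space M" for x
    proof -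
      have "sets (L x) = sets borel"
        using measurable_space[OF L(1), of x] that sp by (simp add: space_prob_algebra)
      then show ?thesis using sets_eq_imp_space_eq[of "L x" borel] \<Psi>
        by (subst emeasure_distr) (auto cong: measurable_cong_sets)
    qed
    then have "(\<integral>\<^sup>+x. emeasure (distr (L x) M \<Psi>) B * indicator a x \<partial>M) =
        (\<integral>\<^sup>+x. emeasure (L x) (\<Psi> -` B \<inter> space borel) * indicator a x \<partial>M)"
      by (intro nn_integral_cong) simp
    also have "\<dots> = emeasure M (a \<inter> (\<Phi> -` (\<Psi> -` B \<inter> space borel) \<inter> space M))"
      by (rule L(2)[OF a B'])
    also have "\<Phi> -` (\<Psi> -` B \<inter> space borel) \<inter> space M = B"
      using inv sets.sets_into_space[OF B] by auto
    finally show "(\<integral>\<^sup>+x. emeasure (distr (L x) M \<Psi>) B * indicator a x \<partial>M) = emeasure M (a \<inter> B)" .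
  qed
qed

text \<open>The integrand varies with the parameter. Replacing \<open>L x\<close> by the law of the
  pair \<open>(x, y)\<close> leaves one fixed integrand and a measurable kernel.\<close>

lemma integral_measurable_kernel:
  fixes f :: "'a \<Rightarrow> 'b \<Rightarrow> real"
  assumes f[measurable]: "(\<lambda>(x, y). f x y) \<in> borel_measurable (N \<Otimes>\<^sub>M M)"
    and L[measurable]: "L \<in> measurable N (subprob_algebra M)"
  shows "(\<lambda>x. \<integral>y. f x y \<partial>L x) \<in> borel_measurable N"
proof -
  note measurable_distr2[measurable]
  have "(\<lambda>x. integral\<^sup>L (distr (L x) (N \<Otimes>\<^sub>M M) (\<lambda>y. (x, y))) (\<lambda>(x, y). f x y)) \<in> borel_measurable N"
    by measurable
  then show ?thesis
    by (rule measurable_cong[THEN iffD1, rotated]) (simp add: integral_distr)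
qed

lemma measure_eqI_rectangles:
  assumes sets_R: "sets R = sets (M1 \<Otimes>\<^sub>M M2)" "sets R' = sets (M1 \<Otimes>\<^sub>M M2)"
    and eq: "\<And>a b. a \<in> sets M1 \<Longrightarrow> b \<in> sets M2 \<Longrightarrow> emeasure R (a \<times> b) = emeasure R' (a \<times> b)"
    and fin: "emeasure R (space M1 \<times> space M2) \<noteq> \<infinity>"
  shows "R = R'"
proof (rule measure_eqI_generator_eq[where \<Omega> = "space M1 \<times> space M2" and
      E = "{a \<times> b | a b. a \<in> sets M1 \<and> b \<in> sets M2}" and A = "\<lambda>_. space M1 \<times> space M2"])
  show "Int_stable {a \<times> b | a b. a \<in> sets M1 \<and> b \<in> sets M2}"
    by (rule Int_stable_pair_measure_generator)
  show "{a \<times> b | a b. a \<in> sets M1 \<and> b \<in> sets M2} \<subseteq> Pow (space M1 \<times> space M2)"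
    by (rule pair_measure_closed)
  show "sets R = sigma_sets (space M1 \<times> space M2) {a \<times> b | a b. a \<in> sets M1 \<and> b \<in> sets M2}"
    "sets R' = sigma_sets (space M1 \<times> space M2) {a \<times> b | a b. a \<in> sets M1 \<and> b \<in> sets M2}"
    by (simp_all add: sets_R sets_pair_measure)
  show "emeasure R X = emeasure R' X" if "X \<in> {a \<times> b | a b. a \<in> sets M1 \<and> b \<in> sets M2}" for X
    using that eq by auto
qed (use fin in auto)

text \<open>As \<open>k\<close> may change sign it is shifted: the densities
  \<open>C + 1 + k\<close> and \<open>C + 1\<close> give finite measures that agree on rectangles.
  They are thus equal, and so are their densities almost everywhere.\<close>

lemma AE_zero_if_rectangle_integrals_zero:
  fixes k :: "'a \<times> 'b \<Rightarrow> real"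
  assumes sets_R: "sets R = sets (M1 \<Otimes>\<^sub>M M2)" and R: "finite_measure R"
    and k: "k \<in> borel_measurable R" and kC: "\<And>w. w \<in> space R \<Longrightarrow> \<bar>k w\<bar> \<le> C"
    and zero: "\<And>a b. a \<in> sets M1 \<Longrightarrow> b \<in> sets M2 \<Longrightarrow> (\<integral>w. k w * indicator (a \<times> b) w \<partial>R) = 0"
  shows "AE w in R. k w = 0"
proof -
  interpret R: finite_measure R by fact
  note k[measurable]
  have space_R: "space R = space M1 \<times> space M2"
    using sets_eq_imp_space_eq[OF sets_R] by (simp add: space_pair_measure)
  have C0: "0 \<le> C + 1 + k w" "0 \<le> C" if "w \<in> space R" for w using kC[OF that] by linarith+
  have rect: "a \<times> b \<in> sets R" if "a \<in> sets M1" "b \<in> sets M2" for a b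
    unfolding sets_R using that by (rule pair_measureI)
  define D1 where "D1 = density R (\<lambda>w. ennreal (C + 1 + k w))"
  define D2 where "D2 = density R (\<lambda>w. ennreal (C + 1))"
  have i1: "integrable R (\<lambda>w. (C + 1 + k w) * indicator S w)"
    and i2: "integrable R (\<lambda>w. k w * indicator S w)"
    and i3: "integrable R (\<lambda>w. (C + 1) * indicator S w :: real)" if S[measurable]: "S \<in> sets R" for S
  proof -
    show i2: "integrable R (\<lambda>w. k w * indicator S w)"
      by (rule R.integrable_const_bound[where B = "\<bar>C\<bar>"])
        (use kC in \<open>auto intro!: AE_I2 split: split_indicator intro: order_trans[OF _ abs_ge_self]\<close>)
    show i3: "integrable R (\<lambda>w. (C + 1) * indicator S w :: real)"
      by (rule R.integrable_const_bound[where B = "\<bar>C + 1\<bar>"])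
        (auto intro!: AE_I2 split: split_indicator)
    show "integrable R (\<lambda>w. (C + 1 + k w) * indicator S w)"
      using Bochner_Integration.integrable_add[OF i3 i2] by (simp add: distrib_right)
  qed
  have eq: "emeasure D1 (a \<times> b) = emeasure D2 (a \<times> b)" if ab: "a \<in> sets M1" "b \<in> sets M2" for a b
  proof -
    let ?S = "a \<times> b"
    note S[measurable] = rect[OF ab]
    have "emeasure D1 ?S = (\<integral>\<^sup>+w. ennreal ((C + 1 + k w) * indicator ?S w) \<partial>R)"
      unfolding D1_def by (subst emeasure_density) (auto intro!: nn_integral_cong split: split_indicator)
    also have "\<dots> = ennreal (\<integral>w. (C + 1 + k w) * indicator ?S w \<partial>R)"
      using C0 by (intro nn_integral_eq_integral i1 S AE_I2) (auto split: split_indicator)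
    also have "(\<integral>w. (C + 1 + k w) * indicator ?S w \<partial>R) = (\<integral>w. (C + 1) * indicator ?S w \<partial>R)"
      using zero[OF ab] Bochner_Integration.integral_add[OF i3[OF S] i2[OF S]] by (simp add: distrib_right)
    also have "ennreal \<dots> = (\<integral>\<^sup>+w. ennreal ((C + 1) * indicator ?S w) \<partial>R)"
      using C0 by (intro nn_integral_eq_integral[symmetric] i3 S AE_I2) (force split: split_indicator)
    also have "\<dots> = emeasure D2 ?S"
      unfolding D2_def by (subst emeasure_density) (auto intro!: nn_integral_cong split: split_indicator)
    finally show ?thesis .
  qed
  have "D1 = D2"
  proof (rule measure_eqI_rectangles[OF _ _ eq])
    show "sets D1 = sets (M1 \<Otimes>\<^sub>M M2)" "sets D2 = sets (M1 \<Otimes>\<^sub>M M2)"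
      unfolding D1_def D2_def by (simp_all add: sets_R)
    have "emeasure D1 (space M1 \<times> space M2) = emeasure D2 (space R)"
      using eq[of "space M1" "space M2"] space_R by simp
    also have "\<dots> = ennreal (C + 1) * emeasure R (space R)"
      unfolding D2_def by (subst emeasure_density) (auto simp: nn_integral_cmult_indicator)
    finally show "emeasure D1 (space M1 \<times> space M2) \<noteq> \<infinity>"
      by (simp add: ennreal_mult_eq_top_iff)
  qed
  then have "AE w in R. ennreal (C + 1 + k w) = ennreal (C + 1)"
    unfolding D1_def D2_def
    by (intro R.density_unique_iff[THEN iffD1]) auto
  with AE_space show ?thesis
  proof eventually_elim
    case (elim w)
    have "0 \<le> C + 1" using C0[OF elim(1)] by simp
    then have "C + 1 + k w = C + 1"
      using elim(2) C0(1)[OF elim(1)] by (metis ennreal_inj)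
    then show ?case by simp
  qed
qed

section \<open>Kernel operators on a space disintegrated over a sub-sigma-algebra\<close>

locale disintegrated = prob_space M for M :: "'x measure" +
  fixes A :: "'x measure" and \<kappa> :: "'x \<Rightarrow> 'x measure"
  assumes sub: "subalgebra M A"
    and kernel[measurable]: "\<kappa> \<in> measurable A (prob_algebra M)"
    and disint: "\<And>a B. a \<in> sets A \<Longrightarrow> B \<in> sets M \<Longrightarrow>
      (\<integral>\<^sup>+x. emeasure (\<kappa> x) B * indicator a x \<partial>M) = emeasure M (a \<inter> B)"
begin

lemma space_A: "space A = space M" and sets_A: "a \<in> sets A \<Longrightarrow> a \<in> sets M"
  using sub unfolding subalgebra_def by auto

lemma measurable_A_M: "f \<in> measurable A N \<Longrightarrow> f \<in> measurable M N"
  by (rule measurable_from_subalg[OF sub])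

lemma kernel_M[measurable]: "\<kappa> \<in> measurable M (prob_algebra M)"
  by (rule measurable_A_M[OF kernel])

lemma kernel_sub_A[measurable]: "\<kappa> \<in> measurable A (subprob_algebra M)"
  by (rule measurable_prob_algebraD[OF kernel])

lemma kernel_sub_M[measurable]: "\<kappa> \<in> measurable M (subprob_algebra M)"
  by (rule measurable_prob_algebraD[OF kernel_M])

lemma fibre:
  assumes "x \<in> space M"
  shows prob_fibre: "prob_space (\<kappa> x)" and sets_fibre: "sets (\<kappa> x) = sets M"
    and space_fibre: "space (\<kappa> x) = space M"
proof -
  show "prob_space (\<kappa> x)" "sets (\<kappa> x) = sets M"
    using measurable_space[OF kernel_M assms] by (auto simp: space_prob_algebra)
  then show "space (\<kappa> x) = space M" by (intro sets_eq_imp_space_eq)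
qed

lemma measurable_fibre:
  assumes "x \<in> space M" "f \<in> measurable M N" shows "f \<in> measurable (\<kappa> x) N"
  using assms(2) measurable_cong_sets[OF sets_fibre[OF assms(1)] refl] by blast

lemma measurable_section:
  assumes "x \<in> space N" "H \<in> measurable (N \<Otimes>\<^sub>M M) L" shows "(\<lambda>z. H (x, z)) \<in> measurable M L"
  using measurable_compose[OF measurable_Pair1'[OF assms(1)] assms(2)] .

lemma diag_measurable: "(\<lambda>x. (x, x)) \<in> measurable M (A \<Otimes>\<^sub>M M)"
proof (rule measurable_Pair)
  show "(\<lambda>x. x) \<in> measurable M A" by (rule measurable_A_M) measurable
qed measurable

definition fibre_pair :: "'x \<Rightarrow> ('x \<times> 'x) measure" where
  "fibre_pair x = distr (\<kappa> x) (M \<Otimes>\<^sub>M M) (\<lambda>z. (x, z))"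

text \<open>The relative square, built asymmetrically: draw \<open>x\<close> from \<open>M\<close>,
  then \<open>z\<close> from the fibre of \<open>x\<close>. Statements about it thus become
  statements about almost every \<open>x\<close> and \<kappa>-almost every \<open>z\<close>; the
  symmetric form is recovered in \<open>joint_eq_bind_pair\<close>.\<close>

definition joint :: "('x \<times> 'x) measure" where
  "joint = M \<bind> fibre_pair"

lemma fibre_pair_measurable[measurable]: "fibre_pair \<in> measurable M (prob_algebra (M \<Otimes>\<^sub>M M))"
  unfolding fibre_pair_def by measurable

lemma fibre_pair_sub[measurable]: "fibre_pair \<in> measurable M (subprob_algebra (M \<Otimes>\<^sub>M M))"
  by (rule measurable_prob_algebraD) measurable

lemma in_prob_algebra: "M \<in> space (prob_algebra M)"
  by (simp add: space_prob_algebra prob_space_axioms)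

lemma sets_joint[measurable_cong]: "sets joint = sets (M \<Otimes>\<^sub>M M)"
  unfolding joint_def by (rule sets_bind'[OF in_prob_algebra fibre_pair_measurable])

lemma space_joint: "space joint = space M \<times> space M"
  using sets_eq_imp_space_eq[OF sets_joint] by (simp add: space_pair_measure)

lemma prob_joint: "prob_space joint"
  unfolding joint_def by (rule prob_space_bind'[OF in_prob_algebra fibre_pair_measurable])

lemma Pair_fibre: "x \<in> space M \<Longrightarrow> (\<lambda>z. (x, z)) \<in> measurable (\<kappa> x) (M \<Otimes>\<^sub>M M)"
  by (rule measurable_fibre) simp_all

lemma nn_integral_joint:
  assumes "u \<in> borel_measurable (M \<Otimes>\<^sub>M M)"
  shows "(\<integral>\<^sup>+w. u w \<partial>joint) = (\<integral>\<^sup>+x. \<integral>\<^sup>+z. u (x, z) \<partial>\<kappa> x \<partial>M)"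
proof -
  have "(\<integral>\<^sup>+w. u w \<partial>joint) = (\<integral>\<^sup>+x. \<integral>\<^sup>+w. u w \<partial>fibre_pair x \<partial>M)"
    unfolding joint_def by (rule nn_integral_bind[OF assms fibre_pair_sub])
  also have "\<dots> = (\<integral>\<^sup>+x. \<integral>\<^sup>+z. u (x, z) \<partial>\<kappa> x \<partial>M)"
    by (intro nn_integral_cong) (simp add: fibre_pair_def nn_integral_distr Pair_fibre assms)
  finally show ?thesis .
qed

lemma AE_joint:
  assumes "Measurable.pred (M \<Otimes>\<^sub>M M) P"
  shows "(AE w in joint. P w) \<longleftrightarrow> (AE x in M. AE z in \<kappa> x. P (x, z))"
proof -
  have "(AE w in joint. P w) \<longleftrightarrow> (AE x in M. AE w in fibre_pair x. P w)"
    unfolding joint_def by (rule AE_bind[OF fibre_pair_sub assms])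
  also have "\<dots> \<longleftrightarrow> (AE x in M. AE z in \<kappa> x. P (x, z))"
    unfolding fibre_pair_def
    by (intro AE_cong) (subst AE_distr_iff[OF Pair_fibre], use assms in \<open>auto simp: pred_def\<close>)
  finally show ?thesis .
qed

lemma integral_joint:
  fixes u :: "'x \<times> 'x \<Rightarrow> real"
  assumes u: "u \<in> borel_measurable (M \<Otimes>\<^sub>M M)" and uC: "\<And>w. \<bar>u w\<bar> \<le> C"
  shows "(\<integral>w. u w \<partial>joint) = (\<integral>x. \<integral>z. u (x, z) \<partial>\<kappa> x \<partial>M)"
proof -
  have "(\<integral>w. u w \<partial>joint) = (\<integral>x. \<integral>w. u w \<partial>fibre_pair x \<partial>M)"
    unfolding joint_def
  proof (rule integral_bind[where K = "M \<Otimes>\<^sub>M M" and B = C and B' = 1])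
    show "AE x in M. emeasure (fibre_pair x) (space (fibre_pair x)) \<le> ennreal 1"
    proof (rule AE_I2)
      fix x assume "x \<in> space M"
      then interpret p: prob_space "fibre_pair x"
        using measurable_space[OF fibre_pair_measurable] by (auto simp: space_prob_algebra)
      show "emeasure (fibre_pair x) (space (fibre_pair x)) \<le> ennreal 1" using p.emeasure_space_1 by simp
    qed
  qed (use u uC finite_measure_axioms in auto)
  also have "\<dots> = (\<integral>x. \<integral>z. u (x, z) \<partial>\<kappa> x \<partial>M)"
    by (intro Bochner_Integration.integral_cong) (simp_all add: fibre_pair_def integral_distr Pair_fibre u)
  finally show ?thesis .
qed

text \<open>Under \<open>\<kappa> x\<close> the first coordinate, seen through \<open>A\<close>, is frozen at \<open>x\<close>.\<close>

lemma diagonal_disintegration: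
  "M \<bind> (\<lambda>x. distr (\<kappa> x) (A \<Otimes>\<^sub>M M) (\<lambda>z. (x, z))) = distr M (A \<Otimes>\<^sub>M M) (\<lambda>x. (x, x))"
    (is "?L = ?R")
proof -
  have ker: "(\<lambda>x. distr (\<kappa> x) (A \<Otimes>\<^sub>M M) (\<lambda>z. (x, z))) \<in> measurable A (prob_algebra (A \<Otimes>\<^sub>M M))"
    by measurable
  then have kerM: "(\<lambda>x. distr (\<kappa> x) (A \<Otimes>\<^sub>M M) (\<lambda>z. (x, z))) \<in> measurable M (prob_algebra (A \<Otimes>\<^sub>M M))"
    by (rule measurable_A_M)
  have Pr: "(\<lambda>z. (x, z)) \<in> measurable (\<kappa> x) (A \<Otimes>\<^sub>M M)" if "x \<in> space M" for x
    by (rule measurable_fibre[OF that]) (simp add: that space_A)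
  have sets_L: "sets ?L = sets (A \<Otimes>\<^sub>M M)" by (rule sets_bind'[OF in_prob_algebra kerM])
  have eq: "emeasure ?L (a \<times> B) = emeasure ?R (a \<times> B)" if a: "a \<in> sets A" and B: "B \<in> sets M" for a B
  proof -
    have aB: "a \<times> B \<in> sets (A \<Otimes>\<^sub>M M)" using a B by (rule pair_measureI)
    have "emeasure ?L (a \<times> B) = (\<integral>\<^sup>+x. emeasure (distr (\<kappa> x) (A \<Otimes>\<^sub>M M) (\<lambda>z. (x, z))) (a \<times> B) \<partial>M)"
      by (rule emeasure_bind_prob_algebra[OF in_prob_algebra kerM aB])
    also have "\<dots> = (\<integral>\<^sup>+x. emeasure (\<kappa> x) B * indicator a x \<partial>M)"
    proof (intro nn_integral_cong)
      fix x assume x: "x \<in> space M"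
      have "(\<lambda>z. (x, z)) -` (a \<times> B) \<inter> space (\<kappa> x) = (if x \<in> a then B else {})"
        using sets.sets_into_space[OF B] space_fibre[OF x] by auto
      then show "emeasure (distr (\<kappa> x) (A \<Otimes>\<^sub>M M) (\<lambda>z. (x, z))) (a \<times> B) = emeasure (\<kappa> x) B * indicator a x"
        using emeasure_distr[OF Pr[OF x] aB] by (simp split: split_indicator)
    qed
    also have "\<dots> = emeasure M (a \<inter> B)" by (rule disint[OF a B])
    also have "a \<inter> B = (\<lambda>x. (x, x)) -` (a \<times> B) \<inter> space M"
      using sets.sets_into_space[OF B] by auto
    also have "emeasure M \<dots> = emeasure ?R (a \<times> B)"
      by (rule emeasure_distr[OF diag_measurable aB, symmetric])
    finally show ?thesis .
  qed
  show ?thesis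
  proof (rule measure_eqI_rectangles[OF sets_L _ eq])
    have "emeasure ?L (space A \<times> space M) = emeasure ?R (space A \<times> space M)" by (rule eq) auto
    also have "\<dots> \<noteq> \<infinity>"
      using finite_measure.emeasure_finite[OF finite_measure_distr[OF diag_measurable]] by auto
    finally show "emeasure ?L (space A \<times> space M) \<noteq> \<infinity>" .
  qed simp_all
qed

text \<open>By \<open>diagonal_disintegration\<close> the pairs \<open>(x, z)\<close> with
  \<open>z\<close> drawn from the fibre of \<open>x\<close> have the same law on
  \<open>A \<Otimes>\<^sub>M M\<close> as the diagonal pairs \<open>(x, x)\<close>. This is the
  device by which quantities measurable for \<open>A\<close> are frozen on fibres.\<close>

lemma AE_diagonal:
  assumes P: "Measurable.pred (A \<Otimes>\<^sub>M M) P" and "AE x in M. P (x, x)"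
  shows "AE x in M. AE z in \<kappa> x. P (x, z)"
proof -
  have ker: "(\<lambda>x. distr (\<kappa> x) (A \<Otimes>\<^sub>M M) (\<lambda>z. (x, z))) \<in> measurable M (subprob_algebra (A \<Otimes>\<^sub>M M))"
    by (rule measurable_A_M, rule measurable_prob_algebraD) measurable
  have "AE w in distr M (A \<Otimes>\<^sub>M M) (\<lambda>x. (x, x)). P w"
    using assms by (subst AE_distr_iff[OF diag_measurable]) (auto simp: pred_def)
  then have "AE x in M. AE w in distr (\<kappa> x) (A \<Otimes>\<^sub>M M) (\<lambda>z. (x, z)). P w"
    unfolding diagonal_disintegration[symmetric] by (subst (asm) AE_bind[OF ker P])
  then show ?thesis
    using AE_space
  proof eventually_elim
    case (elim x)
    have "(\<lambda>z. (x, z)) \<in> measurable (\<kappa> x) (A \<Otimes>\<^sub>M M)"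
      by (rule measurable_fibre[OF elim(2)]) (simp add: elim(2) space_A)
    from AE_distr_iff[OF this] elim(1) P show ?case by (auto simp: pred_def)
  qed
qed

lemma nn_integral_diagonal:
  assumes u: "u \<in> borel_measurable (A \<Otimes>\<^sub>M M)"
  shows "(\<integral>\<^sup>+x. \<integral>\<^sup>+z. u (x, z) \<partial>\<kappa> x \<partial>M) = (\<integral>\<^sup>+x. u (x, x) \<partial>M)"
proof -
  have ker: "(\<lambda>x. distr (\<kappa> x) (A \<Otimes>\<^sub>M M) (\<lambda>z. (x, z))) \<in> measurable M (subprob_algebra (A \<Otimes>\<^sub>M M))"
    by (rule measurable_A_M, rule measurable_prob_algebraD) measurable
  have "(\<integral>\<^sup>+x. u (x, x) \<partial>M) = (\<integral>\<^sup>+w. u w \<partial>distr M (A \<Otimes>\<^sub>M M) (\<lambda>x. (x, x)))"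
    by (rule nn_integral_distr[OF diag_measurable, symmetric]) (simp add: u)
  also have "\<dots> = (\<integral>\<^sup>+x. \<integral>\<^sup>+w. u w \<partial>distr (\<kappa> x) (A \<Otimes>\<^sub>M M) (\<lambda>z. (x, z)) \<partial>M)"
    unfolding diagonal_disintegration[symmetric] by (rule nn_integral_bind[OF u ker])
  also have "\<dots> = (\<integral>\<^sup>+x. \<integral>\<^sup>+z. u (x, z) \<partial>\<kappa> x \<partial>M)"
  proof (intro nn_integral_cong)
    fix x assume x: "x \<in> space M"
    have "(\<lambda>z. (x, z)) \<in> measurable (\<kappa> x) (A \<Otimes>\<^sub>M M)"
      by (rule measurable_fibre[OF x]) (simp add: x space_A)
    then show "(\<integral>\<^sup>+w. u w \<partial>distr (\<kappa> x) (A \<Otimes>\<^sub>M M) (\<lambda>z. (x, z))) = (\<integral>\<^sup>+z. u (x, z) \<partial>\<kappa> x)"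
      by (rule nn_integral_distr) (simp add: u)
  qed
  finally show ?thesis by simp
qed

lemma AE_fibre:
  assumes "AE x in M. P x"
  shows "AE x in M. AE z in \<kappa> x. P z"
proof -
  obtain N where N: "N \<in> sets M" "emeasure M N = 0" "{x \<in> space M. \<not> P x} \<subseteq> N"
    using assms by (auto elim: AE_E)
  have "AE x in M. x \<notin> N" using N by (intro AE_not_in) auto
  then have "AE x in M. AE z in \<kappa> x. snd (x, z) \<notin> N"
    using N(1) by (intro AE_diagonal) auto
  then show ?thesis
    using AE_space
  proof eventually_elim
    case (elim x)
    from elim(1) AE_space[of "\<kappa> x"] show ?case
      by eventually_elim (use N(3) space_fibre[OF elim(2)] in auto)
  qed
qed

text \<open>On the diagonal the equation is trivial, and it is a relation in
  \<open>A \<Otimes>\<^sub>M M\<close> because \<open>h\<close> is measurable for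
  \<open>A\<close>.\<close>

lemma AE_fibre_const:
  fixes h :: "'x \<Rightarrow> real"
  assumes h[measurable]: "h \<in> borel_measurable A"
  shows "AE x in M. AE z in \<kappa> x. h z = h x"
proof -
  have [measurable]: "h \<in> borel_measurable M" by (rule measurable_A_M[OF h])
  have "AE x in M. AE z in \<kappa> x. (\<lambda>w. h (snd w) = h (fst w)) (x, z)"
  proof (rule AE_diagonal)
    show "Measurable.pred (A \<Otimes>\<^sub>M M) (\<lambda>w. h (snd w) = h (fst w))" by measurable
  qed simp
  then show ?thesis by simp
qed

lemma integral_fibre_measurable[measurable (raw)]:
  fixes f :: "'a \<Rightarrow> 'x \<Rightarrow> real"
  assumes "(\<lambda>(x, y). f x y) \<in> borel_measurable (N \<Otimes>\<^sub>M M)" "(\<lambda>x. \<kappa> (g x)) \<in> measurable N (subprob_algebra M)"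
  shows "(\<lambda>x. \<integral>z. f x z \<partial>\<kappa> (g x)) \<in> borel_measurable N"
  by (rule integral_measurable_kernel[OF assms])

text \<open>A version of the conditional expectation given \<open>A\<close>. The almost-everywhere
  equation \<open>avg f = f\<close> is the form in which "\<open>f\<close> comes from
  \<open>A\<close>" is stated throughout.\<close>

definition avg :: "('x \<Rightarrow> real) \<Rightarrow> 'x \<Rightarrow> real" where
  "avg f x = (\<integral>z. f z \<partial>\<kappa> x)"

definition kop :: "('x \<times> 'x \<Rightarrow> real) \<Rightarrow> ('x \<Rightarrow> real) \<Rightarrow> 'x \<Rightarrow> real" where
  "kop H f x = (\<integral>z. H (x, z) * f z \<partial>\<kappa> x)"

lemma avg_measurable_A[measurable]:
  assumes [measurable]: "f \<in> borel_measurable M" shows "avg f \<in> borel_measurable A"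
  unfolding avg_def by measurable

lemma avg_measurable: "f \<in> borel_measurable M \<Longrightarrow> avg f \<in> borel_measurable M"
  by (rule measurable_A_M) measurable

lemma kop_measurable[measurable]:
  assumes [measurable]: "H \<in> borel_measurable (M \<Otimes>\<^sub>M M)" "f \<in> borel_measurable M"
  shows "kop H f \<in> borel_measurable M"
  unfolding kop_def by measurable

lemma avg_bound:
  assumes "f \<in> borel_measurable M" "\<And>x. \<bar>f x\<bar> \<le> C" "x \<in> space M"
  shows "\<bar>avg f x\<bar> \<le> C"
  unfolding avg_def using measurable_fibre[OF assms(3,1)] assms(2)
  by (intro prob_space.abs_integral_le[OF prob_fibre[OF assms(3)]])

lemma kop_bound:
  assumes "H \<in> borel_measurable (M \<Otimes>\<^sub>M M)" "f \<in> borel_measurable M"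
    "\<And>w. \<bar>H w\<bar> \<le> C" "\<And>x. \<bar>f x\<bar> \<le> b" "x \<in> space M"
  shows "\<bar>kop H f x\<bar> \<le> C * b"
  unfolding kop_def
proof (rule prob_space.abs_integral_le[OF prob_fibre[OF assms(5)]])
  have "(\<lambda>z. H (x, z) * f z) \<in> borel_measurable M"
    using measurable_section[OF assms(5,1)] assms(2) by measurable
  then show "(\<lambda>z. H (x, z) * f z) \<in> borel_measurable (\<kappa> x)" by (rule measurable_fibre[OF assms(5)])
  show "\<bar>H (x, z) * f z\<bar> \<le> C * b" for z by (rule abs_mult_le[OF assms(3,4)])
qed

text \<open>The measure \<kappa> y, but not the integrand, depends on \<open>y\<close> through
  \<open>A\<close> only. Hence on the fibre of \<open>x\<close> it may be replaced by the fixed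
  measure \<kappa> x, which reduces an operator with varying fibres to one on a single probability
  space.\<close>

lemma AE_fibre_kernel_const:
  fixes u :: "'x \<times> 'x \<Rightarrow> real"
  assumes u[measurable]: "u \<in> borel_measurable (M \<Otimes>\<^sub>M M)"
  shows "AE x in M. AE y in \<kappa> x. (\<integral>z. u (y, z) \<partial>\<kappa> y) = (\<integral>z. u (y, z) \<partial>\<kappa> x)"
proof -
  have m1[measurable]: "(\<lambda>w. \<integral>z. u (snd w, z) \<partial>\<kappa> (snd w)) \<in> borel_measurable (A \<Otimes>\<^sub>M M)"
    by measurable
  have m2[measurable]: "(\<lambda>w. \<integral>z. u (snd w, z) \<partial>\<kappa> (fst w)) \<in> borel_measurable (A \<Otimes>\<^sub>M M)"
    by measurable
  have "AE x in M. AE y in \<kappa> x. (\<lambda>w. (\<integral>z. u (snd w, z) \<partial>\<kappa> (snd w)) = (\<integral>z. u (snd w, z) \<partial>\<kappa> (fst w))) (x, y)"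
  proof (rule AE_diagonal)
    show "Measurable.pred (A \<Otimes>\<^sub>M M) (\<lambda>w. (\<integral>z. u (snd w, z) \<partial>\<kappa> (snd w)) = (\<integral>z. u (snd w, z) \<partial>\<kappa> (fst w)))"
      by measurable
  qed simp
  then show ?thesis by simp
qed

lemma avg_indicator: "B \<in> sets M \<Longrightarrow> x \<in> space M \<Longrightarrow> avg (indicator B) x = measure (\<kappa> x) B"
  unfolding avg_def using sets_fibre by simp

lemma integral_avg:
  assumes f[measurable]: "f \<in> borel_measurable M" and fC: "\<And>x. \<bar>f x\<bar> \<le> C" and a[measurable]: "a \<in> sets A"
  shows "(\<integral>x. indicator a x * avg f x \<partial>M) = (\<integral>x. indicator a x * f x \<partial>M)"
proof -
  have aM[measurable]: "a \<in> sets M" using a by (rule sets_A)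
  have C0: "0 \<le> C" using fC[of undefined] by simp
  have b: "\<bar>indicator a x * f z :: real\<bar> \<le> C" for x z using fC[of z] C0 by (auto split: split_indicator)
  have ker: "(\<lambda>x. distr (\<kappa> x) (A \<Otimes>\<^sub>M M) (\<lambda>z. (x, z))) \<in> measurable M (prob_algebra (A \<Otimes>\<^sub>M M))"
    by (rule measurable_A_M) measurable
  have u[measurable]: "(\<lambda>w. indicator a (fst w) * f (snd w)) \<in> borel_measurable (A \<Otimes>\<^sub>M M)" by measurable
  have "(\<integral>x. indicator a x * f x \<partial>M) = (\<integral>w. indicator a (fst w) * f (snd w) \<partial>distr M (A \<Otimes>\<^sub>M M) (\<lambda>x. (x, x)))"
    by (subst integral_distr[OF diag_measurable u]) simp
  also have "\<dots> = (\<integral>x. \<integral>w. indicator a (fst w) * f (snd w) \<partial>distr (\<kappa> x) (A \<Otimes>\<^sub>M M) (\<lambda>z. (x, z)) \<partial>M)"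
    unfolding diagonal_disintegration[symmetric]
  proof (rule integral_bind[where K = "A \<Otimes>\<^sub>M M" and B = C and B' = 1])
    show "AE x in M. emeasure (distr (\<kappa> x) (A \<Otimes>\<^sub>M M) (\<lambda>z. (x, z))) (space (distr (\<kappa> x) (A \<Otimes>\<^sub>M M) (\<lambda>z. (x, z)))) \<le> ennreal 1"
    proof (rule AE_I2)
      fix x assume "x \<in> space M"
      then interpret p: prob_space "distr (\<kappa> x) (A \<Otimes>\<^sub>M M) (\<lambda>z. (x, z))"
        using measurable_space[OF ker] by (auto simp: space_prob_algebra)
      show "emeasure (distr (\<kappa> x) (A \<Otimes>\<^sub>M M) (\<lambda>z. (x, z))) (space (distr (\<kappa> x) (A \<Otimes>\<^sub>M M) (\<lambda>z. (x, z)))) \<le> ennreal 1"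
        using p.emeasure_space_1 by simp
    qed
  qed (use b measurable_prob_algebraD[OF ker] finite_measure_axioms u in auto)
  also have "\<dots> = (\<integral>x. indicator a x * avg f x \<partial>M)"
  proof (intro Bochner_Integration.integral_cong refl)
    fix x assume x: "x \<in> space M"
    have "(\<lambda>z. (x, z)) \<in> measurable (\<kappa> x) (A \<Otimes>\<^sub>M M)"
      by (rule measurable_fibre[OF x]) (simp add: x space_A)
    then show "(\<integral>w. indicator a (fst w) * f (snd w) \<partial>distr (\<kappa> x) (A \<Otimes>\<^sub>M M) (\<lambda>z. (x, z))) = indicator a x * avg f x"
      by (subst integral_distr[OF _ u]) (simp_all add: avg_def)
  qed
  finally show ?thesis by simp
qed

lemma avg_unique:
  assumes f[measurable]: "f \<in> borel_measurable M" and fC: "\<And>x. \<bar>f x\<bar> \<le> C"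
    and g: "g \<in> borel_measurable A" and gC: "\<And>x. x \<in> space M \<Longrightarrow> \<bar>g x\<bar> \<le> D"
    and eq: "\<And>a. a \<in> sets A \<Longrightarrow> (\<integral>x. indicator a x * g x \<partial>M) = (\<integral>x. indicator a x * f x \<partial>M)"
  shows "AE x in M. avg f x = g x"
proof -
  interpret sigma_finite_subalgebra M A
    by (intro finite_measure_subalgebra_is_sigma_finite finite_measure_subalgebra.intro
        finite_measure_subalgebra_axioms.intro sub finite_measure_axioms)
  have [measurable]: "g \<in> borel_measurable M" by (rule measurable_A_M[OF g])
  have [measurable]: "avg f \<in> borel_measurable M" by (rule avg_measurable[OF f])
  have i: "integrable M f" "integrable M g" "integrable M (avg f)"
    using fC gC avg_bound[OF f fC] by (auto intro!: integrable_bounded)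
  have "AE x in M. real_cond_exp M A f x = avg f x"
    by (rule real_cond_exp_charact[OF _ i(1,3)])
      (auto simp: set_lebesgue_integral_def integral_avg[OF f fC])
  moreover have "AE x in M. real_cond_exp M A f x = g x"
    by (rule real_cond_exp_charact[OF _ i(1,2) g]) (auto simp: set_lebesgue_integral_def eq)
  ultimately show ?thesis by eventually_elim simp
qed

lemma avg_indicator_measurable[measurable]:
  "B \<in> sets M \<Longrightarrow> avg (indicator B) \<in> borel_measurable M"
  by (rule avg_measurable) simp

lemma cond_exp_fibre:
  assumes B[measurable]: "B \<in> sets M"
  shows "AE x in M. measure (\<kappa> x) B = real_cond_exp M A (indicator B) x"
proof -
  interpret sigma_finite_subalgebra M A
    by (intro finite_measure_subalgebra_is_sigma_finite finite_measure_subalgebra.intro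
        finite_measure_subalgebra_axioms.intro sub finite_measure_axioms)
  have b: "\<bar>indicator B x :: real\<bar> \<le> 1" for x by (auto split: split_indicator)
  have "AE x in M. real_cond_exp M A (indicator B) x = avg (indicator B) x"
  proof (rule real_cond_exp_charact)
    show "integrable M (indicator B :: _ \<Rightarrow> real)" "integrable M (avg (indicator B))"
      by (rule integrable_bounded[OF _ b], measurable) (rule integrable_bounded[OF _ avg_bound[OF _ b]], measurable)
  qed (use integral_avg[OF _ b] in \<open>auto simp: set_lebesgue_integral_def\<close>)
  then show ?thesis
    using AE_space by eventually_elim (simp add: avg_indicator)
qed

end

text \<open>Countability lets almost-everywhere identities for the single sets hold simultaneously;
  closure under intersections lets these sets determine a probability measure. The generator
  consists of the finite intersections from a countable base.\<close>

lemma standard_borel_countable_generator: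
  assumes "standard_borel M"
  obtains E where "countable E" "Int_stable E" "E \<subseteq> Pow (space M)" "space M \<in> E"
    "sets M = sigma_sets (space M) E"
proof -
  obtain T where T: "second_countable T" "topspace T = space M" "sets M = sets (borel_of T)"
    using assms unfolding standard_borel_def by blast
  obtain \<B> where \<B>: "countable \<B>" "\<And>V. V \<in> \<B> \<Longrightarrow> openin T V"
    "\<And>U x. openin T U \<Longrightarrow> x \<in> U \<Longrightarrow> \<exists>V\<in>\<B>. x \<in> V \<and> V \<subseteq> U"
    using T(1) unfolding second_countable_def by metis
  define E where "E = (\<lambda>F. space M \<inter> \<Inter>F) ` {F. finite F \<and> F \<subseteq> \<B>}"
  have setsM: "sets M = sigma_sets (space M) {U. openin T U}"
  proof -
    have "{U. openin T U} \<subseteq> Pow (space M)" using openin_subset T(2) by fastforce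
    then show ?thesis using T by (simp add: borel_of_def)
  qed
  have Vs: "V \<subseteq> space M" if "V \<in> \<B>" for V using \<B>(2)[OF that] openin_subset T(2) by blast
  have VE: "V \<in> E" if "V \<in> \<B>" for V
    unfolding E_def using that Vs[OF that] by (intro image_eqI[of _ _ "{V}"]) auto
  have "countable E"
    unfolding E_def by (intro countable_image countable_Collect_finite_subset \<B>(1))
  moreover have "Int_stable E"
  proof (rule Int_stableI)
    fix a b assume "a \<in> E" "b \<in> E"
    then obtain F F' where "a = space M \<inter> \<Inter>F" "finite F" "F \<subseteq> \<B>" "b = space M \<inter> \<Inter>F'" "finite F'" "F' \<subseteq> \<B>"
      unfolding E_def by blast
    then show "a \<inter> b \<in> E"
      unfolding E_def by (intro image_eqI[of _ _ "F \<union> F'"]) auto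
  qed
  moreover have "E \<subseteq> Pow (space M)" unfolding E_def by auto
  moreover have "space M \<in> E" unfolding E_def by (intro image_eqI[of _ _ "{}"]) auto
  moreover have "sets M = sigma_sets (space M) E"
  proof (rule antisym)
    interpret S: sigma_algebra "space M" "sigma_sets (space M) E"
      by (rule sigma_algebra_sigma_sets) fact
    show "sets M \<subseteq> sigma_sets (space M) E"
      unfolding setsM
    proof (rule S.sigma_sets_subset, safe)
      fix U assume U: "openin T U"
      have "U = \<Union>{V \<in> \<B>. V \<subseteq> U}" using \<B>(3)[OF U] by blast
      also have "\<dots> \<in> sigma_sets (space M) E"
        using \<B>(1) VE by (intro S.countable_Union) (auto intro: countable_subset[of _ \<B>])
      finally show "U \<in> sigma_sets (space M) E" .
    qed
    show "sigma_sets (space M) E \<subseteq> sets M"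
    proof (rule sets.sigma_sets_subset)
      show "E \<subseteq> sets M"
      proof
        fix a assume "a \<in> E"
        then obtain F where F: "a = space M \<inter> \<Inter>F" "finite F" "F \<subseteq> \<B>" unfolding E_def by blast
        have "V \<in> sets M" if "V \<in> F" for V using that F(3) \<B>(2) unfolding setsM by auto
        then show "a \<in> sets M"
          using F(2) unfolding F(1) by (cases "F = {}") (auto intro!: sets.Int sets.finite_INT[of F "\<lambda>V. V", simplified])
      qed
    qed
  qed
  ultimately show ?thesis by (rule that)
qed

lemma AE_kernel_eq:
  assumes sb: "standard_borel M"
    and K: "\<And>x. x \<in> space N \<Longrightarrow> prob_space (K x)" "\<And>x. x \<in> space N \<Longrightarrow> sets (K x) = sets M"
    and L: "\<And>x. x \<in> space N \<Longrightarrow> prob_space (L x)" "\<And>x. x \<in> space N \<Longrightarrow> sets (L x) = sets M"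
    and eq: "\<And>D. D \<in> sets M \<Longrightarrow> AE x in N. measure (K x) D = measure (L x) D"
  shows "AE x in N. K x = L x"
proof -
  obtain E where E: "countable E" "Int_stable E" "E \<subseteq> Pow (space M)" "space M \<in> E"
    "sets M = sigma_sets (space M) E"
    using standard_borel_countable_generator[OF sb] .
  have "AE x in N. \<forall>D\<in>E. measure (K x) D = measure (L x) D"
    using E(1) eq E(5) by (subst AE_ball_countable) auto
  then show ?thesis
    using AE_space
  proof eventually_elim
    case (elim x)
    interpret K: prob_space "K x" by (rule K(1)[OF elim(2)])
    interpret L: prob_space "L x" by (rule L(1)[OF elim(2)])
    show "K x = L x"
    proof (rule measure_eqI_generator_eq[OF E(2,3), where A = "\<lambda>_. space M"])
      show "emeasure (K x) D = emeasure (L x) D" if "D \<in> E" for D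
        using elim(1) that by (simp add: K.emeasure_eq_measure L.emeasure_eq_measure)
    qed (use K(2) L(2) elim(2) E in auto)
  qed
qed

context disintegrated
begin

lemma emeasure_joint_rectangle:
  assumes B[measurable]: "B \<in> sets M" and C[measurable]: "C \<in> sets M"
  shows "emeasure joint (B \<times> C) = (\<integral>\<^sup>+x. emeasure (\<kappa> x) B * emeasure (\<kappa> x) C \<partial>M)"
proof -
  have km: "(\<lambda>x. emeasure (\<kappa> x) D) \<in> borel_measurable A" if "D \<in> sets M" for D
    using measurable_emeasure_kernel[OF kernel_sub_A that] .
  note [measurable] = km[OF B] km[OF C]
  have BC: "B \<times> C \<in> sets joint" unfolding sets_joint by (rule pair_measureI[OF B C])
  have "emeasure joint (B \<times> C) = (\<integral>\<^sup>+w. indicator (B \<times> C) w \<partial>joint)" using BC by simp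
  also have "\<dots> = (\<integral>\<^sup>+x. \<integral>\<^sup>+z. indicator (B \<times> C) (x, z) \<partial>\<kappa> x \<partial>M)"
    using BC sets_joint by (intro nn_integral_joint) auto
  also have "\<dots> = (\<integral>\<^sup>+x. emeasure (\<kappa> x) C * indicator B x \<partial>M)"
  proof (intro nn_integral_cong)
    fix x assume x: "x \<in> space M"
    have "(\<integral>\<^sup>+z. indicator (B \<times> C) (x, z) \<partial>\<kappa> x) = (\<integral>\<^sup>+z. indicator B x * indicator C z \<partial>\<kappa> x)"
      by (intro nn_integral_cong) (auto split: split_indicator)
    also have "\<dots> = indicator B x * emeasure (\<kappa> x) C"
      using sets_fibre[OF x] C by (subst nn_integral_cmult_indicator) auto
    finally show "(\<integral>\<^sup>+z. indicator (B \<times> C) (x, z) \<partial>\<kappa> x) = emeasure (\<kappa> x) C * indicator B x"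
      by (simp add: mult.commute)
  qed
  \<comment> \<open>The factor \<open>emeasure (\<kappa> x) C\<close> is measurable for
    \<open>A\<close>, so the diagonal identity replaces the indicator of \<open>B\<close> at
    \<open>x\<close> by its fibre average.\<close>
  also have "\<dots> = (\<integral>\<^sup>+x. (\<lambda>w. emeasure (\<kappa> (fst w)) C * indicator B (snd w)) (x, x) \<partial>M)" by simp
  also have "\<dots> = (\<integral>\<^sup>+x. \<integral>\<^sup>+z. (\<lambda>w. emeasure (\<kappa> (fst w)) C * indicator B (snd w)) (x, z) \<partial>\<kappa> x \<partial>M)"
    by (rule nn_integral_diagonal[symmetric]) measurable
  also have "\<dots> = (\<integral>\<^sup>+x. emeasure (\<kappa> x) B * emeasure (\<kappa> x) C \<partial>M)"
  proof (intro nn_integral_cong)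
    fix x assume x: "x \<in> space M"
    show "(\<integral>\<^sup>+z. (\<lambda>w. emeasure (\<kappa> (fst w)) C * indicator B (snd w)) (x, z) \<partial>\<kappa> x) =
        emeasure (\<kappa> x) B * emeasure (\<kappa> x) C"
      using sets_fibre[OF x] B by (simp add: nn_integral_cmult_indicator mult.commute[of "emeasure (\<kappa> x) B"])
  qed
  finally show ?thesis .
qed

lemma joint_eqI:
  assumes "sets R = sets (M \<Otimes>\<^sub>M M)"
    and "\<And>B C. B \<in> sets M \<Longrightarrow> C \<in> sets M \<Longrightarrow>
      emeasure R (B \<times> C) = (\<integral>\<^sup>+x. emeasure (\<kappa> x) B * emeasure (\<kappa> x) C \<partial>M)"
  shows "joint = R"
proof (rule measure_eqI_rectangles[OF sets_joint assms(1)])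
  interpret joint: prob_space joint by (rule prob_joint)
  show "emeasure joint (space M \<times> space M) \<noteq> \<infinity>" using joint.emeasure_finite by auto
qed (simp add: assms(2) emeasure_joint_rectangle)

text \<open>Identifies \<open>joint\<close> with the measure in the definition of joint relative
  weak mixing: both give a rectangle the integral of the product of its two fibre measures.\<close>

lemma joint_eq_bind_pair:
  "joint = restr_to_subalg M A \<bind> (\<lambda>y. \<kappa> y \<Otimes>\<^sub>M \<kappa> y)"
proof (rule joint_eqI)
  let ?Y = "restr_to_subalg M A"
  have Y: "?Y \<in> space (prob_algebra ?Y)"
    using prob_space_restr_to_subalg[OF sub prob_space_axioms] by (simp add: space_prob_algebra)
  have ker: "\<kappa> \<in> measurable ?Y (prob_algebra M)"
    by (rule measurable_in_subalg[OF sub kernel])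
  have kp: "(\<lambda>y. \<kappa> y \<Otimes>\<^sub>M \<kappa> y) \<in> measurable ?Y (prob_algebra (M \<Otimes>\<^sub>M M))"
    by (rule measurable_pair_prob[OF ker ker])
  show "sets (?Y \<bind> (\<lambda>y. \<kappa> y \<Otimes>\<^sub>M \<kappa> y)) = sets (M \<Otimes>\<^sub>M M)"
    by (rule sets_bind'[OF Y kp])
  fix B C assume B: "B \<in> sets M" and C: "C \<in> sets M"
  have "emeasure (?Y \<bind> (\<lambda>y. \<kappa> y \<Otimes>\<^sub>M \<kappa> y)) (B \<times> C) = (\<integral>\<^sup>+y. emeasure (\<kappa> y \<Otimes>\<^sub>M \<kappa> y) (B \<times> C) \<partial>?Y)"
    by (rule emeasure_bind_prob_algebra[OF Y kp pair_measureI[OF B C]])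
  also have "\<dots> = (\<integral>\<^sup>+y. emeasure (\<kappa> y) B * emeasure (\<kappa> y) C \<partial>?Y)"
  proof (intro nn_integral_cong)
    fix y assume "y \<in> space ?Y"
    then have y: "y \<in> space M" by (simp add: space_restr_to_subalg)
    interpret p: prob_space "\<kappa> y" by (rule prob_fibre[OF y])
    show "emeasure (\<kappa> y \<Otimes>\<^sub>M \<kappa> y) (B \<times> C) = emeasure (\<kappa> y) B * emeasure (\<kappa> y) C"
      using B C sets_fibre[OF y] by (intro p.emeasure_pair_measure_Times) auto
  qed
  also have "\<dots> = (\<integral>\<^sup>+y. emeasure (\<kappa> y) B * emeasure (\<kappa> y) C \<partial>M)"
    by (intro nn_integral_subalgebra2[OF sub] borel_measurable_times_ennreal
        measurable_emeasure_kernel[OF kernel_sub_A B] measurable_emeasure_kernel[OF kernel_sub_A C])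
  finally show "emeasure (?Y \<bind> (\<lambda>y. \<kappa> y \<Otimes>\<^sub>M \<kappa> y)) (B \<times> C) =
      (\<integral>\<^sup>+y. emeasure (\<kappa> y) B * emeasure (\<kappa> y) C \<partial>M)" .
qed

text \<open>The formula for rectangles is symmetric in \<open>B\<close> and \<open>C\<close>,
  although the construction of \<open>joint\<close> is not.\<close>

lemma joint_symmetric: "joint = distr joint (M \<Otimes>\<^sub>M M) (\<lambda>(x, y). (y, x))"
proof (rule joint_eqI)
  fix B C assume BC: "B \<in> sets M" "C \<in> sets M"
  have sw: "(\<lambda>(x, y). (y, x)) \<in> measurable joint (M \<Otimes>\<^sub>M M)"
    using measurable_pair_swap' by (simp add: measurable_cong_sets[OF sets_joint refl])
  have "emeasure (distr joint (M \<Otimes>\<^sub>M M) (\<lambda>(x, y). (y, x))) (B \<times> C) =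
      emeasure joint ((\<lambda>(x, y). (y, x)) -` (B \<times> C) \<inter> space joint)"
    by (rule emeasure_distr[OF sw pair_measureI[OF BC]])
  also have "(\<lambda>(x, y). (y, x)) -` (B \<times> C) \<inter> space joint = C \<times> B"
    using sets.sets_into_space[OF BC(1)] sets.sets_into_space[OF BC(2)] space_joint by auto
  finally show "emeasure (distr joint (M \<Otimes>\<^sub>M M) (\<lambda>(x, y). (y, x))) (B \<times> C) =
      (\<integral>\<^sup>+x. emeasure (\<kappa> x) B * emeasure (\<kappa> x) C \<partial>M)"
    using emeasure_joint_rectangle[OF BC(2,1)] by (simp add: mult.commute)
qed simp

lemma AE_joint_swap:
  assumes P: "Measurable.pred (M \<Otimes>\<^sub>M M) P"
  shows "(AE w in joint. P (snd w, fst w)) \<longleftrightarrow> (AE w in joint. P w)"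
proof -
  have sw: "(\<lambda>(x, y). (y, x)) \<in> measurable joint (M \<Otimes>\<^sub>M M)"
    using measurable_pair_swap' by (simp add: measurable_cong_sets[OF sets_joint refl])
  have "(AE w in joint. P w) \<longleftrightarrow> (AE w in distr joint (M \<Otimes>\<^sub>M M) (\<lambda>(x, y). (y, x)). P w)"
    by (rule arg_cong[OF joint_symmetric])
  also have "\<dots> \<longleftrightarrow> (AE w in joint. P (case w of (x, y) \<Rightarrow> (y, x)))"
    using P by (intro AE_distr_iff[OF sw]) (simp add: pred_def)
  finally show ?thesis by (simp add: split_beta)
qed

text \<open>On almost every fibre \<open>kop H (indicator D)\<close> equals its own fibre average.
  Fubini rewrites this average as the integral over \<open>D\<close> of the other marginal, which by
  \<open>marg\<close> is a constant \<open>h x\<close> on the fibre. So \<open>H\<close> and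
  \<open>h (fst w)\<close> have equal integrals over all rectangles.\<close>

lemma kernel_on_factor:
  fixes H :: "'x \<times> 'x \<Rightarrow> real"
  assumes H[measurable]: "H \<in> borel_measurable (M \<Otimes>\<^sub>M M)" and HC: "\<And>w. \<bar>H w\<bar> \<le> C"
    and img: "\<And>D. D \<in> sets M \<Longrightarrow> AE x in M. avg (kop H (indicator D)) x = kop H (indicator D) x"
    and marg: "AE x in M. avg (kop (\<lambda>w. H (snd w, fst w)) (\<lambda>_. 1)) x = kop (\<lambda>w. H (snd w, fst w)) (\<lambda>_. 1) x"
  shows "AE w in joint. H w = avg (kop (\<lambda>w. H (snd w, fst w)) (\<lambda>_. 1)) (fst w)"
proof -
  define hb where "hb = kop (\<lambda>w. H (snd w, fst w)) (\<lambda>_. 1)"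
  define h where "h = avg hb"
  have hb_m[measurable]: "hb \<in> borel_measurable M" unfolding hb_def by measurable
  have h_A[measurable]: "h \<in> borel_measurable A" unfolding h_def by measurable
  have h_M[measurable]: "h \<in> borel_measurable M" by (rule measurable_A_M) measurable
  have C0: "0 \<le> C" using HC[of undefined] by simp
  have hb_C: "\<bar>hb x\<bar> \<le> C" if "x \<in> space M" for x
    unfolding hb_def using kop_bound[of "\<lambda>w. H (snd w, fst w)" "\<lambda>_. 1" C 1, OF _ _ HC _ that] by simp
  have h_C: "\<bar>h x\<bar> \<le> C" if x: "x \<in> space M" for x
    unfolding h_def avg_def
    using measurable_fibre[OF x hb_m] hb_C space_fibre[OF x]
    by (intro prob_space.abs_integral_le[OF prob_fibre[OF x]]) auto
  have key: "AE x in M. kop H (indicator D) x = h x * avg (indicator D) x" if D[measurable]: "D \<in> sets M" for D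
  proof -
    have ind1: "\<bar>indicator D z :: real\<bar> \<le> 1" for z by (auto split: split_indicator)
    have [measurable]: "kop H (indicator D) \<in> borel_measurable M" by measurable
    have e1: "AE x in M. AE y in \<kappa> x. (\<integral>z. H (y, z) * indicator D z \<partial>\<kappa> y) = (\<integral>z. H (y, z) * indicator D z \<partial>\<kappa> x)"
      using AE_fibre_kernel_const[of "\<lambda>w. H w * indicator D (snd w)"] by simp
    have e2: "AE x in M. AE z in \<kappa> x. (\<integral>y. H (y, z) \<partial>\<kappa> z) = (\<integral>y. H (y, z) \<partial>\<kappa> x)"
      using AE_fibre_kernel_const[of "\<lambda>w. H (snd w, fst w)"] by simp
    have e3: "AE x in M. AE z in \<kappa> x. h z = hb z"
      using AE_fibre[OF marg] unfolding h_def hb_def .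
    have e4: "AE x in M. AE z in \<kappa> x. h z = h x" by (rule AE_fibre_const[OF h_A])
    show ?thesis
      using img[OF D] e1 e2 e3 e4 AE_space
    proof eventually_elim
      case (elim x)
      note x = elim(6)
      interpret p: prob_space "\<kappa> x" by (rule prob_fibre[OF x])
      interpret pp: pair_prob_space "\<kappa> x" "\<kappa> x" ..
      note [measurable_cong] = sets_fibre[OF x]
      have Hx: "H \<in> borel_measurable (\<kappa> x \<Otimes>\<^sub>M \<kappa> x)"
        using H measurable_cong_sets[OF sets_pair_measure_cong[OF sets_fibre[OF x] sets_fibre[OF x]] refl] by blast
      note [measurable] = Hx measurable_fibre[OF x hb_m] measurable_fibre[OF x h_M]
      have Dx[measurable]: "D \<in> sets (\<kappa> x)" using sets_fibre[OF x] by simp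
      have i: "integrable (\<kappa> x \<Otimes>\<^sub>M \<kappa> x) (\<lambda>(y, z). H (y, z) * indicator D z)"
        by (rule pp.P.integrable_bounded[where B = "C * 1"])
          (measurable, simp add: split_beta, rule abs_mult_le[OF HC ind1, simplified])
      have "kop H (indicator D) x = avg (kop H (indicator D)) x" using elim(1) by simp
      also have "\<dots> = (\<integral>y. (\<integral>z. H (y, z) * indicator D z \<partial>\<kappa> y) \<partial>\<kappa> x)"
        unfolding avg_def kop_def ..
      also have "\<dots> = (\<integral>y. (\<integral>z. H (y, z) * indicator D z \<partial>\<kappa> x) \<partial>\<kappa> x)"
      proof (rule integral_cong_AE)
        have "(\<lambda>y. \<integral>z. H (y, z) * indicator D z \<partial>\<kappa> y) \<in> borel_measurable M" by measurable
        then show "(\<lambda>y. \<integral>z. H (y, z) * indicator D z \<partial>\<kappa> y) \<in> borel_measurable (\<kappa> x)"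
          by (rule measurable_fibre[OF x])
        show "(\<lambda>y. \<integral>z. H (y, z) * indicator D z \<partial>\<kappa> x) \<in> borel_measurable (\<kappa> x)" by measurable
      qed (rule elim(2))
      also have "\<dots> = (\<integral>z. (\<integral>y. H (y, z) * indicator D z \<partial>\<kappa> x) \<partial>\<kappa> x)"
        using pp.Fubini_integral[OF i] by simp
      also have "\<dots> = (\<integral>z. h x * indicator D z \<partial>\<kappa> x)"
      proof (rule integral_cong_AE)
        show "(\<lambda>z. \<integral>y. H (y, z) * indicator D z \<partial>\<kappa> x) \<in> borel_measurable (\<kappa> x)" by measurable
        show "(\<lambda>z. h x * indicator D z) \<in> borel_measurable (\<kappa> x)" by measurable
        show "AE z in \<kappa> x. (\<integral>y. H (y, z) * indicator D z \<partial>\<kappa> x) = h x * indicator D z"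
          using elim(3,4,5) by eventually_elim (simp add: hb_def kop_def)
      qed
      also have "\<dots> = h x * avg (indicator D) x" unfolding avg_def by simp
      finally show ?case .
    qed
  qed
  interpret joint: prob_space joint by (rule prob_joint)
  have "AE w in joint. H w - h (fst w) = 0"
  proof (rule AE_zero_if_rectangle_integrals_zero[OF sets_joint])
    show "finite_measure joint" by (rule joint.finite_measure_axioms)
    show "(\<lambda>w. H w - h (fst w)) \<in> borel_measurable joint"
      unfolding measurable_cong_sets[OF sets_joint refl] by measurable
    show "\<bar>H w - h (fst w)\<bar> \<le> C + C" if "w \<in> space joint" for w
    proof -
      have "\<bar>h (fst w)\<bar> \<le> C" using h_C that space_joint by auto
      then show ?thesis using HC[of w] by linarith
    qed
    fix D' D assume D'[measurable]: "D' \<in> sets M" and D[measurable]: "D \<in> sets M"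
    \<comment> \<open>\<open>h\<close> is known to be bounded on the space only, and
      \<open>integral_joint\<close> asks for a bound everywhere.\<close>
    define h' where "h' x = (if x \<in> space M then h x else 0)" for x
    have h'm[measurable]: "h' \<in> borel_measurable M" unfolding h'_def by measurable
    have h'C: "\<bar>h' x\<bar> \<le> C" for x unfolding h'_def using h_C C0 by auto
    have ind2: "\<bar>indicator D x :: real\<bar> \<le> 1" for D and x :: 'b by (auto split: split_indicator)
    have bd: "\<bar>H w - h' (fst w)\<bar> \<le> C + C" for w
      using HC[of w] h'C[of "fst w"] by linarith
    have bound: "\<bar>(H w - h' (fst w)) * indicator (D' \<times> D) w\<bar> \<le> (C + C) * 1" for w
      by (rule abs_mult_le[OF bd ind2])
    have "(\<integral>w. (H w - h (fst w)) * indicator (D' \<times> D) w \<partial>joint) =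
        (\<integral>w. (H w - h' (fst w)) * indicator (D' \<times> D) w \<partial>joint)"
      by (intro Bochner_Integration.integral_cong) (auto simp: h'_def space_joint)
    also have "\<dots> = (\<integral>x. \<integral>z. (H (x, z) - h' (fst (x, z))) * indicator (D' \<times> D) (x, z) \<partial>\<kappa> x \<partial>M)"
      by (rule integral_joint[OF _ bound]) measurable
    also have "\<dots> = (\<integral>x. 0 \<partial>M)"
    proof (rule integral_cong_AE)
      show "(\<lambda>x. \<integral>z. (H (x, z) - h' (fst (x, z))) * indicator (D' \<times> D) (x, z) \<partial>\<kappa> x) \<in> borel_measurable M"
        by measurable
      show "AE x in M. (\<integral>z. (H (x, z) - h' (fst (x, z))) * indicator (D' \<times> D) (x, z) \<partial>\<kappa> x) = 0"
        using key[OF D] AE_space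
      proof eventually_elim
        case (elim x)
        interpret p: prob_space "\<kappa> x" by (rule prob_fibre[OF elim(2)])
        have Hx: "(\<lambda>z. H (x, z)) \<in> borel_measurable (\<kappa> x)"
          by (rule measurable_fibre[OF elim(2) measurable_section[OF elim(2) H]])
        have Dx: "D \<in> sets (\<kappa> x)" using sets_fibre[OF elim(2)] by simp
        have i1: "integrable (\<kappa> x) (\<lambda>z. H (x, z) * indicator D z)"
          by (rule p.integrable_bounded[where B = "C * 1"])
            (use Hx Dx in \<open>auto intro!: borel_measurable_times abs_mult_le HC ind2 simp del: mult_1_right\<close>)
        have i2: "integrable (\<kappa> x) (\<lambda>z. h x * indicator D z)"
          using Dx by (intro integrable_mult_right) (simp add: p.emeasure_eq_measure)
        have "(\<integral>z. (H (x, z) - h' (fst (x, z))) * indicator (D' \<times> D) (x, z) \<partial>\<kappa> x) =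
            (\<integral>z. indicator D' x * (H (x, z) * indicator D z - h x * indicator D z) \<partial>\<kappa> x)"
          using elim(2) by (intro Bochner_Integration.integral_cong) (auto simp: h'_def split: split_indicator)
        also have "\<dots> = indicator D' x * (kop H (indicator D) x - h x * avg (indicator D) x)"
          using i1 i2 unfolding kop_def avg_def by simp
        also have "\<dots> = 0" using elim(1) by simp
        finally show ?case .
      qed
    qed simp
    finally show "(\<integral>w. (H w - h (fst w)) * indicator (D' \<times> D) w \<partial>joint) = 0" by simp
  qed
  then show ?thesis unfolding h_def hb_def by eventually_elim simp
qed

end

section \<open>Equivariance of the disintegration\<close>

text \<open>The inverse \<sigma> is measurable for \<open>A\<close> so that every set of
  \<open>A\<close> is the \<tau>-preimage of a set of \<open>A\<close>; conditional expectations of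
  functions composed with \<tau> can then be tested on \<open>A\<close>.\<close>

locale disintegrated_automorphism = disintegrated M A \<kappa>
  for M :: "'x measure" and A \<kappa> +
  fixes \<tau> \<sigma> :: "'x \<Rightarrow> 'x"
  assumes sb: "standard_borel M"
    and \<tau>_A[measurable]: "\<tau> \<in> measurable A A" and \<sigma>_A[measurable]: "\<sigma> \<in> measurable A A"
    and \<tau>_M[measurable]: "\<tau> \<in> measurable M M" and distr_\<tau>: "distr M M \<tau> = M"
    and inverse: "\<And>x. x \<in> space M \<Longrightarrow> \<sigma> (\<tau> x) = x"
begin

lemma \<tau>_space: "x \<in> space M \<Longrightarrow> \<tau> x \<in> space M"
  by (rule measurable_space[OF \<tau>_M])

text \<open>Evaluated at a set \<open>D\<close>, both kernels are the conditional expectation of the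
  indicator of \<open>D\<close> composed with \<tau>. The countable generator of the standard Borel
  space makes the null set independent of \<open>D\<close>.\<close>

lemma fibre_equivariant: "AE x in M. distr (\<kappa> x) M \<tau> = \<kappa> (\<tau> x)"
proof (rule AE_kernel_eq[OF sb])
  fix x assume x: "x \<in> space M"
  have "\<tau> \<in> measurable (\<kappa> x) M" by (rule measurable_fibre[OF x \<tau>_M])
  then show "prob_space (distr (\<kappa> x) M \<tau>)" by (rule prob_space.prob_space_distr[OF prob_fibre[OF x]])
  show "sets (distr (\<kappa> x) M \<tau>) = sets M" by simp
  show "prob_space (\<kappa> (\<tau> x))" "sets (\<kappa> (\<tau> x)) = sets M"
    using prob_fibre sets_fibre \<tau>_space[OF x] by auto
next
  fix D assume D[measurable]: "D \<in> sets M"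
  have b: "\<bar>indicator D x :: real\<bar> \<le> 1" for x by (auto split: split_indicator)
  have aD[measurable]: "avg (indicator D) \<in> borel_measurable A" by measurable
  have "AE x in M. avg (\<lambda>z. indicator D (\<tau> z)) x = avg (indicator D) (\<tau> x)"
  proof (rule avg_unique[where C = 1 and D = 1])
    show "(\<lambda>x. avg (indicator D) (\<tau> x)) \<in> borel_measurable A" by measurable
    show "\<bar>avg (indicator D) (\<tau> x)\<bar> \<le> 1" if "x \<in> space M" for x
      by (rule avg_bound[OF _ b \<tau>_space[OF that]]) measurable
    fix a assume a[measurable]: "a \<in> sets A"
    have a': "\<sigma> -` a \<inter> space A \<in> sets A" by measurable
    let ?a = "\<sigma> -` a \<inter> space A"
    have aM[measurable]: "?a \<in> sets M" using a' by (rule sets_A)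
    have ind: "indicator a x = (indicator ?a (\<tau> x) :: real)" if "x \<in> space M" for x
      using inverse[OF that] \<tau>_space[OF that] space_A by (simp add: indicator_def)
    have int\<tau>: "(\<integral>x. u (\<tau> x) \<partial>M) = (\<integral>x. u x \<partial>M)" if "u \<in> borel_measurable M" for u :: "'x \<Rightarrow> real"
      using integral_distr[OF \<tau>_M that] distr_\<tau> by simp
    have "(\<integral>x. indicator a x * avg (indicator D) (\<tau> x) \<partial>M) =
        (\<integral>x. indicator ?a (\<tau> x) * avg (indicator D) (\<tau> x) \<partial>M)"
      by (intro Bochner_Integration.integral_cong) (auto simp: ind)
    also have "\<dots> = (\<integral>x. indicator ?a x * avg (indicator D) x \<partial>M)"
      by (rule int\<tau>) measurable
    also have "\<dots> = (\<integral>x. indicator ?a x * indicator D x \<partial>M)"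
      by (rule integral_avg[OF _ b a']) measurable
    also have "\<dots> = (\<integral>x. indicator ?a (\<tau> x) * indicator D (\<tau> x) \<partial>M)"
      by (rule int\<tau>[symmetric]) measurable
    also have "\<dots> = (\<integral>x. indicator a x * indicator D (\<tau> x) \<partial>M)"
      by (intro Bochner_Integration.integral_cong) (auto simp: ind)
    finally show "(\<integral>x. indicator a x * avg (indicator D) (\<tau> x) \<partial>M) =
        (\<integral>x. indicator a x * indicator D (\<tau> x) \<partial>M)" .
  qed (use b in auto)
  then show "AE x in M. measure (distr (\<kappa> x) M \<tau>) D = measure (\<kappa> (\<tau> x)) D"
    using AE_space
  proof eventually_elim
    case (elim x)
    have t: "\<tau> \<in> measurable (\<kappa> x) M" by (rule measurable_fibre[OF elim(2) \<tau>_M])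
    have "measure (distr (\<kappa> x) M \<tau>) D = (\<integral>z. indicator D z \<partial>distr (\<kappa> x) M \<tau>)" by simp
    also have "\<dots> = avg (\<lambda>z. indicator D (\<tau> z)) x"
      unfolding avg_def by (rule integral_distr[OF t]) measurable
    also have "\<dots> = measure (\<kappa> (\<tau> x)) D"
      using elim avg_indicator[OF D \<tau>_space[OF elim(2)]] by simp
    finally show ?case .
  qed
qed

text \<open>The null set precedes the quantifier over \<open>u\<close>, since
  \<open>kop_equivariant\<close> uses a function \<open>u\<close> that itself depends on
  \<open>x\<close>.\<close>

lemma integral_fibre_equivariant:
  "AE x in M. \<forall>u\<in>borel_measurable M. (\<integral>z. u z \<partial>\<kappa> (\<tau> x)) = (\<integral>z. (u (\<tau> z) :: real) \<partial>\<kappa> x)"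
  using fibre_equivariant AE_space
proof eventually_elim
  case (elim x)
  have t: "\<tau> \<in> measurable (\<kappa> x) M" by (rule measurable_fibre[OF elim(2) \<tau>_M])
  show ?case unfolding elim(1)[symmetric] by (intro ballI integral_distr[OF t])
qed

lemma avg_equivariant:
  assumes "f \<in> borel_measurable M"
  shows "AE x in M. avg f (\<tau> x) = avg (\<lambda>z. f (\<tau> z)) x"
  using integral_fibre_equivariant by eventually_elim (use assms in \<open>simp add: avg_def\<close>)

lemma kop_equivariant:
  assumes H[measurable]: "H \<in> borel_measurable (M \<Otimes>\<^sub>M M)" and f[measurable]: "f \<in> borel_measurable M"
    and inv: "AE w in joint. H (\<tau> (fst w), \<tau> (snd w)) = H w"
  shows "AE x in M. kop H f (\<tau> x) = kop H (\<lambda>z. f (\<tau> z)) x"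
proof -
  have "Measurable.pred (M \<Otimes>\<^sub>M M) (\<lambda>w. H (\<tau> (fst w), \<tau> (snd w)) = H w)" by measurable
  from AE_joint[OF this] inv
  have inv': "AE x in M. AE z in \<kappa> x. H (\<tau> x, \<tau> z) = H (x, z)" by simp
  show ?thesis
    using integral_fibre_equivariant inv' AE_space
  proof eventually_elim
    case (elim x)
    note tx = \<tau>_space[OF elim(3)]
    have m: "(\<lambda>z. H (\<tau> x, z) * f z) \<in> borel_measurable M"
      using measurable_section[OF tx H] by measurable
    then have "kop H f (\<tau> x) = (\<integral>z. H (\<tau> x, \<tau> z) * f (\<tau> z) \<partial>\<kappa> x)"
      unfolding kop_def using elim(1) by blast
    also have "\<dots> = (\<integral>z. H (x, z) * f (\<tau> z) \<partial>\<kappa> x)"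
    proof (rule integral_cong_AE)
      have "(\<lambda>z. H (\<tau> x, \<tau> z) * f (\<tau> z)) \<in> borel_measurable M"
        by (rule measurable_compose[OF \<tau>_M m])
      then show "(\<lambda>z. H (\<tau> x, \<tau> z) * f (\<tau> z)) \<in> borel_measurable (\<kappa> x)"
        by (rule measurable_fibre[OF elim(3)])
      have "(\<lambda>z. H (x, z) * f (\<tau> z)) \<in> borel_measurable M"
        using measurable_section[OF elim(3) H] by measurable
      then show "(\<lambda>z. H (x, z) * f (\<tau> z)) \<in> borel_measurable (\<kappa> x)"
        by (rule measurable_fibre[OF elim(3)])
      show "AE z in \<kappa> x. H (\<tau> x, \<tau> z) * f (\<tau> z) = H (x, z) * f (\<tau> z)"
        using elim(2) by eventually_elim simp
    qed
    finally show ?case unfolding kop_def .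
  qed
qed

end

section \<open>Almost periodic functions\<close>

text \<open>A countable subfamily whose union has the largest possible measure cannot gain measure
  from any further \<open>g\<close>. The supremum is attained by uniting countably many nearly
  optimal subfamilies.\<close>

lemma (in prob_space) essential_union:
  assumes V: "\<And>g. g \<in> I \<Longrightarrow> V g \<in> sets M"
  obtains J where "countable J" "J \<subseteq> I" "\<And>g. g \<in> I \<Longrightarrow> AE y in M. y \<in> V g \<longrightarrow> y \<in> (\<Union>h\<in>J. V h)"
proof -
  define m where "m J = measure M (\<Union>h\<in>J. V h)" for J
  define \<C> where "\<C> = {J. countable J \<and> J \<subseteq> I}"
  define S where "S = Sup (m ` \<C>)"
  have bdd: "bdd_above (m ` \<C>)" unfolding m_def by (intro bdd_aboveI[of _ 1]) auto
  have ne: "m ` \<C> \<noteq> {}" unfolding \<C>_def by blast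
  have "\<exists>J\<in>\<C>. S - 1 / real (Suc n) < m J" for n
  proof -
    have "S - 1 / real (Suc n) < Sup (m ` \<C>)" unfolding S_def by simp
    then show ?thesis using less_cSup_iff[OF ne bdd] by auto
  qed
  then obtain J where J: "\<And>n. J n \<in> \<C>" "\<And>n. S - 1 / real (Suc n) < m (J n)" by metis
  define K where "K = (\<Union>n. J n)"
  have K: "K \<in> \<C>" using J(1) unfolding K_def \<C>_def by blast
  have meas: "(\<Union>h\<in>L. V h) \<in> sets M" if "L \<in> \<C>" for L
    using that V unfolding \<C>_def by (intro sets.countable_UN') auto
  have mono: "m L \<le> m L'" if "L \<subseteq> L'" "L' \<in> \<C>" for L L'
    unfolding m_def using that by (intro finite_measure_mono meas) auto
  have mK: "m K \<ge> S"
  proof (rule field_le_epsilon)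
    fix e :: real assume "e > 0"
    then obtain n where n: "1 / real (Suc n) < e" using nat_approx_posE by blast
    have "m (J n) \<le> m K" by (rule mono[OF _ K]) (auto simp: K_def)
    then show "S \<le> m K + e" using J(2)[of n] n by linarith
  qed
  show ?thesis
  proof (rule that[of K])
    show "countable K" "K \<subseteq> I" using K unfolding \<C>_def by auto
    fix g assume g: "g \<in> I"
    have K': "insert g K \<in> \<C>" using K g unfolding \<C>_def by auto
    have "m (insert g K) \<le> S" unfolding S_def using K' by (intro cSup_upper[OF _ bdd]) auto
    moreover have "m K \<le> m (insert g K)" by (rule mono[OF _ K']) auto
    ultimately have eq: "m (insert g K) = m K" using mK by linarith
    let ?N = "(\<Union>h\<in>insert g K. V h) - (\<Union>h\<in>K. V h)"
    have "measure M ?N = m (insert g K) - m K"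
      unfolding m_def by (intro finite_measure_Diff meas K K') auto
    then have "?N \<in> null_sets M"
      using eq meas[OF K] meas[OF K'] by (auto simp: null_sets_def emeasure_eq_measure)
    then have "AE y in M. y \<notin> ?N" by (rule AE_not_in)
    then show "AE y in M. y \<in> V g \<longrightarrow> y \<in> (\<Union>h\<in>K. V h)"
      by eventually_elim auto
  qed
qed

definition bounded_fun :: "('a \<Rightarrow> real) \<Rightarrow> bool" where
  "bounded_fun f \<longleftrightarrow> (\<exists>C. \<forall>x. \<bar>f x\<bar> \<le> C)"

lemma bounded_funI: "(\<And>x. \<bar>f x\<bar> \<le> C) \<Longrightarrow> bounded_fun f"
  unfolding bounded_fun_def by blast

lemma (in prob_space) integrable_square_diff:
  assumes "f \<in> borel_measurable M" "g \<in> borel_measurable M" "bounded_fun f" "bounded_fun g"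
  shows "integrable M (\<lambda>x. (f x - g x)\<^sup>2 :: real)"
proof -
  obtain C D where C: "\<And>x. \<bar>f x\<bar> \<le> C" and D: "\<And>x. \<bar>g x\<bar> \<le> D"
    using assms(3,4) unfolding bounded_fun_def by blast
  have "\<bar>f x - g x\<bar> \<le> C + D" for x using C[of x] D[of x] by linarith
  then show ?thesis
    by (intro integrable_bounded[OF _ abs_square_le]) (use assms(1,2) in measurable)
qed

context disintegrated
begin

definition sqdist :: "('x \<Rightarrow> real) \<Rightarrow> ('x \<Rightarrow> real) \<Rightarrow> 'x \<Rightarrow> real" where
  "sqdist f g y = (\<integral>x. (f x - g x)\<^sup>2 \<partial>\<kappa> y)"

lemma sqdist_measurable[measurable]:
  assumes [measurable]: "f \<in> borel_measurable M" "g \<in> borel_measurable M"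
  shows "sqdist f g \<in> borel_measurable A"
  unfolding sqdist_def by measurable

lemma sqdist_cong_AE:
  assumes "y \<in> space M" "f \<in> borel_measurable M" "f' \<in> borel_measurable M" "g \<in> borel_measurable M" "g' \<in> borel_measurable M"
    and "AE x in \<kappa> y. f x = f' x" "AE x in \<kappa> y. g x = g' x"
  shows "sqdist f g y = sqdist f' g' y"
  unfolding sqdist_def
proof (rule integral_cong_AE)
  note [measurable] = measurable_fibre[OF assms(1,2)] measurable_fibre[OF assms(1,3)]
    measurable_fibre[OF assms(1,4)] measurable_fibre[OF assms(1,5)]
  show "(\<lambda>x. (f x - g x)\<^sup>2) \<in> borel_measurable (\<kappa> y)" "(\<lambda>x. (f' x - g' x)\<^sup>2) \<in> borel_measurable (\<kappa> y)"
    by measurable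
  show "AE x in \<kappa> y. (f x - g x)\<^sup>2 = (f' x - g' x)\<^sup>2"
    using assms(6,7) by eventually_elim simp
qed

text \<open>Greedy choice: a new centre is taken, on each fibre where one is still missing, from countably many members
  of the family that are essentially exhaustive. The centres are pairwise separated, so the packing bound
  stops the procedure after \<open>N\<close> steps.\<close>

lemma uniform_net_of_packing:
  fixes F :: "'g \<Rightarrow> 'x \<Rightarrow> real" and N :: nat
  assumes F: "\<And>g. g \<in> I \<Longrightarrow> F g \<in> borel_measurable M" and Fb: "\<And>g x. g \<in> I \<Longrightarrow> \<bar>F g x\<bar> \<le> b"
    and ne: "I \<noteq> {}"
    and packing: "\<And>h. (\<And>i. i < N \<Longrightarrow> h i \<in> I) \<Longrightarrow>
      AE y in M. \<exists>i<N. \<exists>j<N. i \<noteq> j \<and> sqdist (F (h i)) (F (h j)) y < \<epsilon>"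
  shows "\<exists>\<Psi>. finite \<Psi> \<and> (\<forall>\<psi>\<in>\<Psi>. \<psi> \<in> borel_measurable M \<and> bounded_fun \<psi>) \<and>
    (\<forall>g\<in>I. AE y in M. \<exists>\<psi>\<in>\<Psi>. sqdist (F g) \<psi> y < \<epsilon>)"
proof -
  \<comment> \<open>The selector \<open>s\<close> is measurable for \<open>A\<close>, hence constant
    on almost every fibre; there a glued function coincides with a single member of the
    family.\<close>
  define glued where "glued \<psi> \<longleftrightarrow> (\<exists>J s. countable J \<and> J \<subseteq> I \<and> s \<in> measurable A (count_space J) \<and>
    (\<forall>x\<in>space M. \<psi> x = F (s x) x) \<and> (\<forall>x. \<bar>\<psi> x\<bar> \<le> \<bar>b\<bar>))" for \<psi>
  have glued_m: "\<psi> \<in> borel_measurable M" if gl: "glued \<psi>" for \<psi>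
  proof -
    obtain J s where s: "countable J" "J \<subseteq> I" "s \<in> measurable A (count_space J)" "\<forall>x\<in>space M. \<psi> x = F (s x) x"
      using gl unfolding glued_def by blast
    have "(\<lambda>x. F (s x) x) \<in> borel_measurable M"
      by (rule measurable_compose_countable'[OF _ measurable_A_M[OF s(3)] s(1)]) (use s(2) F in blast)
    then show ?thesis by (rule measurable_cong[THEN iffD1, rotated]) (simp add: s(4))
  qed
  have glued_fibre: "\<exists>J. countable J \<and> J \<subseteq> I \<and> (AE y in M. \<exists>h\<in>J. AE x in \<kappa> y. \<psi> x = F h x)"
    if gl: "glued \<psi>" for \<psi>
  proof -
    obtain J s where s: "countable J" "J \<subseteq> I" "s \<in> measurable A (count_space J)" "\<forall>x\<in>space M. \<psi> x = F (s x) x"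
      using gl unfolding glued_def by blast
    note [measurable] = glued_m[OF gl]
    have m1: "(\<lambda>w. F (s (fst w)) (snd w)) \<in> borel_measurable (A \<Otimes>\<^sub>M M)"
    proof (rule measurable_compose_countable'[OF _ _ s(1)])
      show "(\<lambda>w. F i (snd w)) \<in> borel_measurable (A \<Otimes>\<^sub>M M)" if "i \<in> J" for i
        using F[of i] that s(2) by (auto intro: measurable_compose[OF measurable_snd])
      show "(\<lambda>w. s (fst w)) \<in> measurable (A \<Otimes>\<^sub>M M) (count_space J)"
        by (rule measurable_compose[OF measurable_fst s(3)])
    qed
    have m2: "(\<lambda>w. \<psi> (snd w)) \<in> borel_measurable (A \<Otimes>\<^sub>M M)" by measurable
    have "AE y in M. AE x in \<kappa> y. (\<lambda>w. \<psi> (snd w) = F (s (fst w)) (snd w)) (y, x)"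
    proof (rule AE_diagonal)
      show "Measurable.pred (A \<Otimes>\<^sub>M M) (\<lambda>w. \<psi> (snd w) = F (s (fst w)) (snd w))"
        using borel_measurable_eq[OF m2 m1] by (simp add: pred_def)
      show "AE x in M. \<psi> (snd (x, x)) = F (s (fst (x, x))) (snd (x, x))"
        using s(4) by (intro AE_I2) simp
    qed
    then have "AE y in M. \<exists>h\<in>J. AE x in \<kappa> y. \<psi> x = F h x"
      using AE_space
    proof eventually_elim
      case (elim y)
      have "s y \<in> J" using measurable_space[OF s(3)] elim(2) space_A by simp
      then show ?case using elim(1) by auto
    qed
    with s show ?thesis by blast
  qed
  \<comment> \<open>Separation of the centres is claimed only on fibres where some
    \<open>F g\<close> is still far from all of them. Elsewhere the later centres are arbitrary, and
    nothing about them is needed. For \<open>j = N\<close> separation contradicts packing, so almost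
    no fibre is left uncaught.\<close>
  define Sep where "Sep j \<psi> \<longleftrightarrow> (\<forall>i<j. glued (\<psi> i)) \<and>
    (\<forall>g\<in>I. AE y in M. (\<forall>i<j. \<epsilon> \<le> sqdist (F g) (\<psi> i) y) \<longrightarrow>
        (\<forall>i<j. \<forall>k<i. \<epsilon> \<le> sqdist (\<psi> i) (\<psi> k) y))" for j :: nat and \<psi>
  have "\<exists>\<psi>. Sep j \<psi>" for j
  proof (induction j)
    case 0
    show ?case unfolding Sep_def by simp
  next
    case (Suc j)
    then obtain \<psi> where \<psi>: "\<And>i. i < j \<Longrightarrow> glued (\<psi> i)"
      "\<And>g. g \<in> I \<Longrightarrow> AE y in M. (\<forall>i<j. \<epsilon> \<le> sqdist (F g) (\<psi> i) y) \<longrightarrow>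
        (\<forall>i<j. \<forall>k<i. \<epsilon> \<le> sqdist (\<psi> i) (\<psi> k) y)"
      unfolding Sep_def by blast
    \<comment> \<open>The base points over which \<open>F g\<close> is still uncaught. These sets
      lie in \<open>A\<close>, and therefore the selector built from them is measurable for
      \<open>A\<close>.\<close>
    define V where "V g = {y \<in> space A. \<forall>i\<in>{..<j}. \<epsilon> \<le> sqdist (F g) (\<psi> i) y}" for g
    have V: "V g \<in> sets A" if "g \<in> I" for g
    proof -
      have "sqdist (F g) (\<psi> i) \<in> borel_measurable A" if "i < j" for i
        using F[OF \<open>g \<in> I\<close>] glued_m[OF \<psi>(1)[OF that]] by measurable
      then show ?thesis unfolding V_def
        by (intro sets.sets_Collect_finite_All borel_measurable_le) auto
    qed
    obtain J where J: "countable J" "J \<subseteq> I" "\<And>g. g \<in> I \<Longrightarrow> AE y in M. y \<in> V g \<longrightarrow> y \<in> (\<Union>h\<in>J. V h)"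
      using essential_union[of I V] V sets_A by blast
    obtain g0 where g0: "g0 \<in> I" using ne by blast
    define J' where "J' = insert g0 J"
    have J': "countable J'" "J' \<subseteq> I" "J' \<noteq> {}" using J g0 unfolding J'_def by auto
    define e where "e = from_nat_into J'"
    have eJ: "e n \<in> J'" for n unfolding e_def using J'(3) by (rule from_nat_into)
    have eV: "V (e n) \<in> sets A" for n using V eJ J'(2) by blast
    define s where "s y = e (LEAST n. y \<in> V (e n))" for y
    have s_hit: "y \<in> V (s y)" if hit: "y \<in> V h" "h \<in> J" for y h
    proof -
      obtain n where "e n = h" unfolding e_def
        using from_nat_into_surj[OF J'(1), of h] hit(2) unfolding J'_def by auto
      then have "\<exists>n. y \<in> V (e n)" using hit(1) by blast
      then show ?thesis unfolding s_def by (rule LeastI_ex)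
    qed
    have s_m: "s \<in> measurable A (count_space J')"
    proof -
      have "(\<lambda>y. LEAST n. y \<in> V (e n)) \<in> measurable A (count_space UNIV)"
        using eV by measurable
      then have "(\<lambda>y. e (LEAST n. y \<in> V (e n))) \<in> measurable A (count_space J')"
        by (rule measurable_compose) (use eJ in auto)
      then show ?thesis unfolding s_def .
    qed
    have sJ: "s y \<in> J'" for y unfolding s_def by (rule eJ)
    define \<psi>' where "\<psi>' = \<psi>(j := \<lambda>x. F (s x) x)"
    have bb: "\<bar>F g x\<bar> \<le> \<bar>b\<bar>" if "g \<in> I" for g x
      using Fb[OF that, of x] by linarith
    have gl_new: "glued (\<lambda>x. F (s x) x)"
      unfolding glued_def using J' s_m sJ bb by (intro exI[of _ J'] exI[of _ s]) auto
    have gl': "glued (\<psi>' i)" if "i < Suc j" for i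
      using that \<psi>(1) gl_new unfolding \<psi>'_def by (cases "i = j") auto
    have s_const: "AE y in M. AE x in \<kappa> y. F (s x) x = F (s y) x"
    proof -
      have m1: "(\<lambda>w. F (s (fst w)) (snd w)) \<in> borel_measurable (A \<Otimes>\<^sub>M M)"
      proof (rule measurable_compose_countable'[OF _ _ J'(1)])
        show "(\<lambda>w. F i (snd w)) \<in> borel_measurable (A \<Otimes>\<^sub>M M)" if "i \<in> J'" for i
          using F[of i] that J'(2) by (auto intro: measurable_compose[OF measurable_snd])
        show "(\<lambda>w. s (fst w)) \<in> measurable (A \<Otimes>\<^sub>M M) (count_space J')"
          by (rule measurable_compose[OF measurable_fst s_m])
      qed
      have m2: "(\<lambda>w. F (s (snd w)) (snd w)) \<in> borel_measurable (A \<Otimes>\<^sub>M M)"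
        by (rule measurable_compose[OF measurable_snd glued_m[OF gl_new]])
      have "AE y in M. AE x in \<kappa> y. (\<lambda>w. F (s (snd w)) (snd w) = F (s (fst w)) (snd w)) (y, x)"
      proof (rule AE_diagonal)
        show "Measurable.pred (A \<Otimes>\<^sub>M M) (\<lambda>w. F (s (snd w)) (snd w) = F (s (fst w)) (snd w))"
          using borel_measurable_eq[OF m2 m1] by (simp add: pred_def)
      qed simp
      then show ?thesis by simp
    qed
    have "Sep (Suc j) \<psi>'"
      unfolding Sep_def
    proof (intro conjI allI impI ballI)
      fix i assume "i < Suc j" then show "glued (\<psi>' i)" by (rule gl')
    next
      fix g assume g: "g \<in> I"
      show "AE y in M. (\<forall>i<Suc j. \<epsilon> \<le> sqdist (F g) (\<psi>' i) y) \<longrightarrow>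
          (\<forall>i<Suc j. \<forall>k<i. \<epsilon> \<le> sqdist (\<psi>' i) (\<psi>' k) y)"
        using \<psi>(2)[OF g] J(3)[OF g] s_const AE_space
      proof eventually_elim
        case (elim y)
        show ?case
        proof (intro impI allI)
          fix i k assume far: "\<forall>i<Suc j. \<epsilon> \<le> sqdist (F g) (\<psi>' i) y" and i: "i < Suc j" and k: "k < i"
          have far': "\<forall>i<j. \<epsilon> \<le> sqdist (F g) (\<psi> i) y"
          proof (intro allI impI)
            fix i assume "i < j" then show "\<epsilon> \<le> sqdist (F g) (\<psi> i) y"
              using far[rule_format, of i] unfolding \<psi>'_def by auto
          qed
          show "\<epsilon> \<le> sqdist (\<psi>' i) (\<psi>' k) y"
          proof (cases "i = j")
            case False
            then show ?thesis using elim(1) far' i k unfolding \<psi>'_def by auto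
          next
            case True
            have "y \<in> V g" unfolding V_def using far' elim(4) space_A by auto
            then obtain h where "h \<in> J" "y \<in> V h" using elim(2) by blast
            then have "y \<in> V (s y)" by (intro s_hit)
            then have "\<epsilon> \<le> sqdist (F (s y)) (\<psi> k) y" using k True unfolding V_def by auto
            also have "\<dots> = sqdist (\<psi>' i) (\<psi>' k) y"
            proof (rule sqdist_cong_AE[OF elim(4)])
              have "s y \<in> I" using sJ J'(2) by blast
              then show "F (s y) \<in> borel_measurable M" by (rule F)
              show "\<psi>' i \<in> borel_measurable M" "\<psi>' k \<in> borel_measurable M" "\<psi> k \<in> borel_measurable M"
                using gl' \<psi>(1) glued_m i k True by auto
              show "AE x in \<kappa> y. F (s y) x = \<psi>' i x" using elim(3) True unfolding \<psi>'_def by auto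
              show "AE x in \<kappa> y. \<psi> k x = \<psi>' k x" using k True unfolding \<psi>'_def by auto
            qed
            finally show ?thesis .
          qed
        qed
      qed
    qed
    then show ?case by blast
  qed
  then obtain \<psi> where \<psi>: "Sep N \<psi>" by blast
  then have gl: "glued (\<psi> i)" if "i < N" for i using that unfolding Sep_def by blast
  define \<Psi> where "\<Psi> = \<psi> ` {..<N}"
  show ?thesis
  proof (intro exI[of _ \<Psi>] conjI ballI)
    show "finite \<Psi>" unfolding \<Psi>_def by simp
    fix p assume "p \<in> \<Psi>"
    then have "glued p" using gl unfolding \<Psi>_def by auto
    then show "p \<in> borel_measurable M" by (rule glued_m)
    show "bounded_fun p"
      using \<open>glued p\<close> bounded_funI[of p "\<bar>b\<bar>"] unfolding glued_def by blast
  next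
    fix g assume g: "g \<in> I"
    define Q where "Q i J \<longleftrightarrow> countable J \<and> J \<subseteq> I \<and> (AE y in M. \<exists>h\<in>J. AE x in \<kappa> y. \<psi> i x = F h x)" for i J
    have "\<forall>i. \<exists>J. i < N \<longrightarrow> Q i J"
      using glued_fibre[OF gl] unfolding Q_def by blast
    then obtain Js where "\<And>i. i < N \<Longrightarrow> Q i (Js i)" by metis
    then have Js: "\<And>i. i < N \<Longrightarrow> countable (Js i) \<and> Js i \<subseteq> I \<and> (AE y in M. \<exists>h\<in>Js i. AE x in \<kappa> y. \<psi> i x = F h x)"
      unfolding Q_def .
    \<comment> \<open>On a fibre the centres are \<open>F (h i)\<close> for an
      \<open>N\<close>-tuple \<open>h\<close> that varies with the fibre. Only countably many tuples
      occur, so the packing hypothesis holds for all of them outside one null set.\<close>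
    define T where "T = (\<Pi>\<^sub>E i\<in>{..<N}. Js i)"
    have "countable T" unfolding T_def using Js by (intro countable_PiE) auto
    then have pk: "AE y in M. \<forall>h\<in>T. \<exists>i<N. \<exists>j<N. i \<noteq> j \<and> sqdist (F (h i)) (F (h j)) y < \<epsilon>"
    proof (subst AE_ball_countable, safe)
      fix h assume h: "h \<in> T"
      show "AE y in M. \<exists>i<N. \<exists>j<N. i \<noteq> j \<and> sqdist (F (h i)) (F (h j)) y < \<epsilon>"
        by (rule packing) (use h Js in \<open>auto simp: T_def\<close>)
    qed
    have fib: "AE y in M. \<forall>i\<in>{..<N}. \<exists>h\<in>Js i. AE x in \<kappa> y. \<psi> i x = F h x"
      using Js by (intro AE_finite_allI) auto
    have sep: "AE y in M. (\<forall>i<N. \<epsilon> \<le> sqdist (F g) (\<psi> i) y) \<longrightarrow>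
        (\<forall>i<N. \<forall>k<i. \<epsilon> \<le> sqdist (\<psi> i) (\<psi> k) y)"
      using \<psi> g unfolding Sep_def by blast
    show "AE y in M. \<exists>p\<in>\<Psi>. sqdist (F g) p y < \<epsilon>"
      using pk fib sep AE_space
    proof eventually_elim
      case (elim y)
      obtain h where h: "\<And>i. i < N \<Longrightarrow> h i \<in> Js i \<and> (AE x in \<kappa> y. \<psi> i x = F (h i) x)"
        using elim(2) by (metis lessThan_iff)
      define h' where "h' = restrict h {..<N}"
      have "h' \<in> T" unfolding T_def h'_def using h by auto
      then obtain i j where ij: "i < N" "j < N" "i \<noteq> j" "sqdist (F (h' i)) (F (h' j)) y < \<epsilon>"
        using elim(1) by blast
      have eq: "sqdist (\<psi> i) (\<psi> j) y = sqdist (F (h i)) (F (h j)) y" if "i < N" "j < N" for i j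
        by (rule sqdist_cong_AE[OF elim(4)]) (use h Js glued_m gl that F in blast)+
      have sy: "sqdist f f' y = sqdist f' f y" for f f' unfolding sqdist_def by (simp add: power2_commute)
      have less: "sqdist (\<psi> i) (\<psi> j) y < \<epsilon>" using ij eq[OF ij(1,2)] unfolding h'_def by simp
      have "\<not> (\<forall>i<N. \<forall>k<i. \<epsilon> \<le> sqdist (\<psi> i) (\<psi> k) y)"
      proof (cases "j < i")
        case True then show ?thesis using less ij by force
      next
        case False
        then have "i < j" using ij by simp
        then show ?thesis using less ij sy by force
      qed
      then obtain i where "i < N" "sqdist (F g) (\<psi> i) y < \<epsilon>" using elim(3) by force
      then show ?case unfolding \<Psi>_def by auto
    qed
  qed
qed

text \<open>On almost every fibre the functions \<open>F g\<close> are images of functions bounded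
  by \<open>b\<close> under a kernel operator on the one probability space \<kappa> y. The number
  from \<open>kernel_packing\<close> depends on \<open>\<epsilon>\<close>, \<open>C\<close> and
  \<open>b\<close> alone, hence not on the fibre.\<close>

lemma kernel_image_packing:
  fixes H :: "'x \<times> 'x \<Rightarrow> real" and f F :: "'g \<Rightarrow> 'x \<Rightarrow> real"
  assumes pos: "\<epsilon> > 0" "C > 0" "b > 0"
    and H[measurable]: "H \<in> borel_measurable (M \<Otimes>\<^sub>M M)" and HC: "\<And>w. \<bar>H w\<bar> \<le> C"
    and f: "\<And>g. g \<in> I \<Longrightarrow> f g \<in> borel_measurable M" "\<And>g x. g \<in> I \<Longrightarrow> \<bar>f g x\<bar> \<le> b"
    and F: "\<And>g. g \<in> I \<Longrightarrow> F g \<in> borel_measurable M" "\<And>g. g \<in> I \<Longrightarrow> AE x in M. F g x = kop H (f g) x"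
  obtains N :: nat where "\<And>h. (\<And>i. i < N \<Longrightarrow> h i \<in> I) \<Longrightarrow>
      AE y in M. \<exists>i<N. \<exists>j<N. i \<noteq> j \<and> sqdist (F (h i)) (F (h j)) y < \<epsilon>"
proof -
  obtain N :: nat where N: "\<forall>(P :: 'x measure) H f. prob_space P \<longrightarrow> H \<in> borel_measurable (P \<Otimes>\<^sub>M P) \<longrightarrow>
     (\<forall>z. \<bar>H z\<bar> \<le> C) \<longrightarrow> (\<forall>i. f i \<in> borel_measurable P) \<longrightarrow> (\<forall>i x. \<bar>f i x\<bar> \<le> b) \<longrightarrow>
     (\<exists>i<N. \<exists>j<N. i \<noteq> j \<and>
        (\<integral>x. ((\<integral>z. H (x, z) * f i z \<partial>P) - (\<integral>z. H (x, z) * f j z \<partial>P))\<^sup>2 \<partial>P) < \<epsilon>)"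
    using kernel_packing[OF pos] ..
  show ?thesis
  proof (rule that[of N])
    fix h :: "nat \<Rightarrow> 'g" assume hI: "\<And>i. i < N \<Longrightarrow> h i \<in> I"
    have e1: "AE y in M. \<forall>i\<in>{..<N}. AE x in \<kappa> y. F (h i) x = kop H (f (h i)) x"
      by (rule AE_finite_allI, simp, rule AE_fibre, rule F(2), rule hI, simp)
    have e2: "AE y in M. \<forall>i\<in>{..<N}. AE x in \<kappa> y. kop H (f (h i)) x = (\<integral>z. H (x, z) * f (h i) z \<partial>\<kappa> y)"
    proof (rule AE_finite_allI)
      fix i assume "i \<in> {..<N}"
      then have [measurable]: "f (h i) \<in> borel_measurable M" using f hI by auto
      show "AE y in M. AE x in \<kappa> y. kop H (f (h i)) x = (\<integral>z. H (x, z) * f (h i) z \<partial>\<kappa> y)"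
        using AE_fibre_kernel_const[of "\<lambda>w. H w * f (h i) (snd w)"] unfolding kop_def by simp
    qed simp
    show "AE y in M. \<exists>i<N. \<exists>j<N. i \<noteq> j \<and> sqdist (F (h i)) (F (h j)) y < \<epsilon>"
      using e1 e2 AE_space
    proof eventually_elim
      case (elim y)
      note y = elim(3)
      \<comment> \<open>The packing statement takes an infinite sequence, whereas \<open>h\<close>
        is controlled below \<open>N\<close> only.\<close>
      define f' where "f' i = (if i < N then f (h i) else (\<lambda>_. 0))" for i
      have Hy: "H \<in> borel_measurable (\<kappa> y \<Otimes>\<^sub>M \<kappa> y)"
        using H measurable_cong_sets[OF sets_pair_measure_cong[OF sets_fibre[OF y] sets_fibre[OF y]] refl] by blast
      have f'm: "f' i \<in> borel_measurable M" for i unfolding f'_def using f hI by auto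
      have f'b: "\<bar>f' i x\<bar> \<le> b" for i x unfolding f'_def using f hI pos by auto
      have "\<exists>i<N. \<exists>j<N. i \<noteq> j \<and>
        (\<integral>x. ((\<integral>z. H (x, z) * f' i z \<partial>\<kappa> y) - (\<integral>z. H (x, z) * f' j z \<partial>\<kappa> y))\<^sup>2 \<partial>\<kappa> y) < \<epsilon>"
        by (rule N[rule_format, OF prob_fibre[OF y] Hy HC measurable_fibre[OF y f'm] f'b])
      then obtain i j where ij: "i < N" "j < N" "i \<noteq> j"
        "(\<integral>x. ((\<integral>z. H (x, z) * f' i z \<partial>\<kappa> y) - (\<integral>z. H (x, z) * f' j z \<partial>\<kappa> y))\<^sup>2 \<partial>\<kappa> y) < \<epsilon>"
        by (elim exE conjE)
      have m: "(\<lambda>x. \<integral>z. H (x, z) * f' i z \<partial>\<kappa> y) \<in> borel_measurable M" for i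
      proof -
        note [measurable] = f'm[of i]
        have k: "(\<lambda>_. \<kappa> y) \<in> measurable M (subprob_algebra M)"
          by (rule measurable_const[OF measurable_space[OF kernel_sub_M y]])
        show ?thesis by (rule integral_measurable_kernel[OF _ k]) measurable
      qed
      have "sqdist (F (h i)) (F (h j)) y =
          sqdist (\<lambda>x. \<integral>z. H (x, z) * f' i z \<partial>\<kappa> y) (\<lambda>x. \<integral>z. H (x, z) * f' j z \<partial>\<kappa> y) y"
      proof (rule sqdist_cong_AE[OF y F(1)[OF hI[OF ij(1)]] m F(1)[OF hI[OF ij(2)]] m])
        have "AE x in \<kappa> y. F (h i) x = (\<integral>z. H (x, z) * f' i z \<partial>\<kappa> y)" if i: "i < N" for i
        proof -
          have "AE x in \<kappa> y. F (h i) x = kop H (f (h i)) x"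
            "AE x in \<kappa> y. kop H (f (h i)) x = (\<integral>z. H (x, z) * f (h i) z \<partial>\<kappa> y)"
            using elim(1,2) i by auto
          then show ?thesis by eventually_elim (simp add: f'_def i)
        qed
        then show "AE x in \<kappa> y. F (h i) x = (\<integral>z. H (x, z) * f' i z \<partial>\<kappa> y)"
          "AE x in \<kappa> y. F (h j) x = (\<integral>z. H (x, z) * f' j z \<partial>\<kappa> y)" using ij by auto
      qed
      then have "sqdist (F (h i)) (F (h j)) y < \<epsilon>" using ij(4) unfolding sqdist_def by simp
      then show ?case using ij by blast
    qed
  qed
qed

end

lemma lipschitz_square_le:
  fixes \<theta> :: "real \<Rightarrow> real \<Rightarrow> real"
  assumes "\<bar>\<theta> a b - \<theta> c d\<bar> \<le> L * (\<bar>a - c\<bar> + \<bar>b - d\<bar>)"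
  shows "(\<theta> a b - \<theta> c d)\<^sup>2 \<le> 2 * L\<^sup>2 * ((a - c)\<^sup>2 + (b - d)\<^sup>2)"
proof -
  have "(\<theta> a b - \<theta> c d)\<^sup>2 \<le> (L * (\<bar>a - c\<bar> + \<bar>b - d\<bar>))\<^sup>2"
    using abs_square_le[OF assms] by simp
  also have "\<dots> = L\<^sup>2 * (\<bar>a - c\<bar> + \<bar>b - d\<bar>)\<^sup>2" by (simp add: power_mult_distrib)
  also have "\<dots> \<le> L\<^sup>2 * (2 * ((a - c)\<^sup>2 + (b - d)\<^sup>2))"
  proof (rule mult_left_mono)
    have "0 \<le> (\<bar>a - c\<bar> - \<bar>b - d\<bar>)\<^sup>2" by simp
    then show "(\<bar>a - c\<bar> + \<bar>b - d\<bar>)\<^sup>2 \<le> 2 * ((a - c)\<^sup>2 + (b - d)\<^sup>2)"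
      by (simp add: power2_eq_square algebra_simps)
  qed simp
  finally show ?thesis by (simp add: algebra_simps)
qed

lemma lipschitz_tolerance:
  fixes L \<epsilon> :: real
  assumes "\<epsilon> > 0"
  obtains \<delta> where "\<delta> > 0" "2 * L\<^sup>2 * (\<delta> + \<delta>) < \<epsilon>"
proof -
  \<comment> \<open>The added 1 covers \<open>L = 0\<close> and makes the final inequality
    strict.\<close>
  define \<delta> where "\<delta> = \<epsilon> / (4 * (L\<^sup>2 + 1))"
  have L1: "L\<^sup>2 + 1 > 0" by (simp add: add_nonneg_pos)
  have \<delta>: "\<delta> > 0" unfolding \<delta>_def using assms L1 by simp
  have "2 * L\<^sup>2 * (\<delta> + \<delta>) < 4 * (L\<^sup>2 + 1) * \<delta>" using \<delta> by (simp add: algebra_simps)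
  also have "\<dots> = \<epsilon>" unfolding \<delta>_def using L1 by simp
  finally show ?thesis using that \<delta> by blast
qed

lemma lipschitz_linear:
  fixes r s a b c d :: real
  shows "\<bar>(r * a + s * b) - (r * c + s * d)\<bar> \<le> (\<bar>r\<bar> + \<bar>s\<bar>) * (\<bar>a - c\<bar> + \<bar>b - d\<bar>)"
proof -
  have "\<bar>r * a + s * b - (r * c + s * d)\<bar> = \<bar>r * (a - c) + s * (b - d)\<bar>" by (simp add: algebra_simps)
  also have "\<dots> \<le> \<bar>r\<bar> * \<bar>a - c\<bar> + \<bar>s\<bar> * \<bar>b - d\<bar>"
    by (rule order_trans[OF abs_triangle_ineq]) (simp add: abs_mult)
  also have "\<dots> \<le> (\<bar>r\<bar> + \<bar>s\<bar>) * (\<bar>a - c\<bar> + \<bar>b - d\<bar>)"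
    by (simp add: algebra_simps)
  finally show ?thesis .
qed

section \<open>Closure properties of almost periodic functions\<close>

locale factor_action = disintegrated M A \<kappa>
  for M :: "'x measure" and A \<kappa> +
  fixes act :: "'g \<Rightarrow> 'x \<Rightarrow> 'x" and I :: "'g set"
  assumes act_M: "g \<in> I \<Longrightarrow> act g \<in> measurable M M"
    and act_A: "g \<in> I \<Longrightarrow> act g \<in> measurable A A"
    and I_nonempty: "I \<noteq> {}"
begin

text \<open>FK almost periodicity for bounded real functions, with bounded nets and squared fibre
  distances. Boundedness makes every fibre integral genuinely finite and is preserved by Lipschitz
  operations; complex functions are assembled from real and imaginary parts later.\<close>

definition almost_periodic :: "('x \<Rightarrow> real) \<Rightarrow> bool" where
  "almost_periodic \<phi> \<longleftrightarrow> \<phi> \<in> borel_measurable M \<and> bounded_fun \<phi> \<and>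
    (\<forall>\<epsilon>>0. \<exists>\<Psi>. finite \<Psi> \<and> (\<forall>\<psi>\<in>\<Psi>. \<psi> \<in> borel_measurable M \<and> bounded_fun \<psi>) \<and>
      (\<forall>g\<in>I. AE y in M. \<exists>\<psi>\<in>\<Psi>. sqdist (\<lambda>x. \<phi> (act g x)) \<psi> y < \<epsilon>))"

lemma almost_periodicD:
  assumes "almost_periodic \<phi>"
  shows "\<phi> \<in> borel_measurable M" "bounded_fun \<phi>"
    "\<epsilon> > 0 \<Longrightarrow> \<exists>\<Psi>. finite \<Psi> \<and> (\<forall>\<psi>\<in>\<Psi>. \<psi> \<in> borel_measurable M \<and> bounded_fun \<psi>) \<and>
      (\<forall>g\<in>I. AE y in M. \<exists>\<psi>\<in>\<Psi>. sqdist (\<lambda>x. \<phi> (act g x)) \<psi> y < \<epsilon>)"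
  using assms unfolding almost_periodic_def by blast+

lemma measurable_act: "g \<in> I \<Longrightarrow> \<phi> \<in> borel_measurable M \<Longrightarrow> (\<lambda>x. \<phi> (act g x)) \<in> borel_measurable M"
  by (rule measurable_compose[OF act_M])

lemma almost_periodic_kernel:
  fixes H :: "'x \<times> 'x \<Rightarrow> real"
  assumes H: "H \<in> borel_measurable (M \<Otimes>\<^sub>M M)" and HC: "\<And>w. \<bar>H w\<bar> \<le> C"
    and \<phi>: "\<phi> \<in> borel_measurable M" "\<And>x. \<bar>\<phi> x\<bar> \<le> c"
    and f: "\<And>g. g \<in> I \<Longrightarrow> f g \<in> borel_measurable M" "\<And>g x. g \<in> I \<Longrightarrow> \<bar>f g x\<bar> \<le> b"
    and eq: "\<And>g. g \<in> I \<Longrightarrow> AE x in M. \<phi> (act g x) = kop H (f g) x"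
  shows "almost_periodic \<phi>"
  unfolding almost_periodic_def
proof (intro conjI allI impI \<phi>(1) bounded_funI[OF \<phi>(2)])
  fix \<epsilon> :: real assume \<epsilon>: "\<epsilon> > 0"
  have HC': "\<bar>H w\<bar> \<le> \<bar>C\<bar> + 1" for w using HC[of w] by linarith
  have fb': "\<bar>f g x\<bar> \<le> \<bar>b\<bar> + 1" if "g \<in> I" for g x using f(2)[OF that, of x] by linarith
  have pos: "\<bar>C\<bar> + 1 > 0" "\<bar>b\<bar> + 1 > 0" by auto
  obtain N :: nat where N: "\<And>h. (\<And>i. i < N \<Longrightarrow> h i \<in> I) \<Longrightarrow>
      AE y in M. \<exists>i<N. \<exists>j<N. i \<noteq> j \<and> sqdist (\<lambda>x. \<phi> (act (h i) x)) (\<lambda>x. \<phi> (act (h j) x)) y < \<epsilon>"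
    by (rule kernel_image_packing[where I = I and f = f and F = "\<lambda>g x. \<phi> (act g x)",
          OF \<epsilon> pos H HC' f(1) fb' measurable_act[OF _ \<phi>(1)] eq])
      (assumption | erule that)+
  show "\<exists>\<Psi>. finite \<Psi> \<and> (\<forall>\<psi>\<in>\<Psi>. \<psi> \<in> borel_measurable M \<and> bounded_fun \<psi>) \<and>
      (\<forall>g\<in>I. AE y in M. \<exists>\<psi>\<in>\<Psi>. sqdist (\<lambda>x. \<phi> (act g x)) \<psi> y < \<epsilon>)"
    by (rule uniform_net_of_packing[OF measurable_act[OF _ \<phi>(1)] \<phi>(2) I_nonempty N])
qed

text \<open>On almost every fibre a translate of \<phi> is constant with a value between
  \<open>- C\<close> and \<open>C\<close>, so finitely many constants with spacing \<delta> form a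
  net.\<close>

lemma almost_periodic_A:
  assumes \<phi>: "\<phi> \<in> borel_measurable A" "\<And>x. \<bar>\<phi> x\<bar> \<le> C"
  shows "almost_periodic \<phi>"
  unfolding almost_periodic_def
proof (intro conjI allI impI bounded_funI[OF \<phi>(2)])
  show \<phi>M: "\<phi> \<in> borel_measurable M" by (rule measurable_A_M[OF \<phi>(1)])
  fix \<epsilon> :: real assume \<epsilon>: "\<epsilon> > 0"
  define \<delta> where "\<delta> = sqrt (\<epsilon> / 2)"
  have \<delta>: "\<delta> > 0" "\<delta>\<^sup>2 < \<epsilon>" unfolding \<delta>_def using \<epsilon> by auto
  define K where "K = {\<lfloor>- C / \<delta>\<rfloor>..\<lfloor>C / \<delta>\<rfloor>}"
  define \<Psi> where "\<Psi> = (\<lambda>k (x :: 'x). \<delta> * real_of_int k :: real) ` K"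
  show "\<exists>\<Psi>. finite \<Psi> \<and> (\<forall>\<psi>\<in>\<Psi>. \<psi> \<in> borel_measurable M \<and> bounded_fun \<psi>) \<and>
      (\<forall>g\<in>I. AE y in M. \<exists>\<psi>\<in>\<Psi>. sqdist (\<lambda>x. \<phi> (act g x)) \<psi> y < \<epsilon>)"
  proof (intro exI[of _ \<Psi>] conjI ballI)
    show "finite \<Psi>" unfolding \<Psi>_def K_def by simp
    fix \<psi> assume "\<psi> \<in> \<Psi>"
    then obtain k where "\<psi> = (\<lambda>x. \<delta> * real_of_int k)" unfolding \<Psi>_def by blast
    then show "\<psi> \<in> borel_measurable M" "bounded_fun \<psi>"
      unfolding bounded_fun_def by auto
  next
    fix g assume g: "g \<in> I"
    have m: "(\<lambda>x. \<phi> (act g x)) \<in> borel_measurable A"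
      by (rule measurable_compose[OF act_A[OF g] \<phi>(1)])
    show "AE y in M. \<exists>\<psi>\<in>\<Psi>. sqdist (\<lambda>x. \<phi> (act g x)) \<psi> y < \<epsilon>"
      using AE_fibre_const[OF m] AE_space
    proof eventually_elim
      case (elim y)
      define v where "v = \<phi> (act g y)"
      define k where "k = \<lfloor>v / \<delta>\<rfloor>"
      have "\<bar>v\<bar> \<le> C" unfolding v_def by (rule \<phi>(2))
      then have "- C / \<delta> \<le> v / \<delta>" "v / \<delta> \<le> C / \<delta>"
        using \<delta>(1) divide_right_mono[of "- C" v \<delta>] divide_right_mono[of v C \<delta>] by auto
      then have "k \<in> K" unfolding k_def K_def by (auto intro: floor_mono)
      then have mem: "(\<lambda>x. \<delta> * real_of_int k) \<in> \<Psi>" unfolding \<Psi>_def by blast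
      have "real_of_int k \<le> v / \<delta>" "v / \<delta> < real_of_int k + 1"
        unfolding k_def by linarith+
      then have "\<delta> * real_of_int k \<le> v" "v < \<delta> * real_of_int k + \<delta>"
        using \<delta>(1) by (auto simp: field_simps)
      then have "\<bar>v - \<delta> * real_of_int k\<bar> \<le> \<delta>" by linarith
      then have sq: "(v - \<delta> * real_of_int k)\<^sup>2 \<le> \<delta>\<^sup>2" using abs_square_le by fastforce
      interpret p: prob_space "\<kappa> y" by (rule prob_fibre[OF elim(2)])
      have "sqdist (\<lambda>x. \<phi> (act g x)) (\<lambda>x. \<delta> * real_of_int k) y =
          sqdist (\<lambda>x. v) (\<lambda>x. \<delta> * real_of_int k) y"
        by (rule sqdist_cong_AE[OF elim(2) measurable_act[OF g \<phi>M]]) (use elim(1) in \<open>auto simp: v_def\<close>)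
      also have "\<dots> = (v - \<delta> * real_of_int k)\<^sup>2" unfolding sqdist_def by (simp add: p.prob_space)
      also have "\<dots> < \<epsilon>" using sq \<delta>(2) by linarith
      finally show ?case using mem by blast
    qed
  qed
qed

text \<open>The net consists of the \<theta>-combinations of two nets. The Lipschitz bound turns two
  small fibre distances into one, uniformly in the fibre.\<close>

lemma almost_periodic_lipschitz:
  fixes \<theta> :: "real \<Rightarrow> real \<Rightarrow> real"
  assumes "almost_periodic \<phi>1" and "almost_periodic \<phi>2"
    and lip: "\<And>a b c d. \<bar>\<theta> a b - \<theta> c d\<bar> \<le> L * (\<bar>a - c\<bar> + \<bar>b - d\<bar>)"
    and \<theta>: "(\<lambda>w. \<theta> (fst w) (snd w)) \<in> borel_measurable (borel \<Otimes>\<^sub>M borel)"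
  shows "almost_periodic (\<lambda>x. \<theta> (\<phi>1 x) (\<phi>2 x))"
proof -
  note 1 = almost_periodicD[OF assms(1)]
  note 2 = almost_periodicD[OF assms(2)]
  have L0: "0 \<le> L"
  proof -
    have "0 \<le> L * (\<bar>1 - 0\<bar> + \<bar>0 - 0 :: real\<bar>)"
      by (rule order_trans[OF abs_ge_zero lip])
    then show ?thesis by simp
  qed
  have meas: "(\<lambda>x. \<theta> (f x) (f' x)) \<in> borel_measurable M"
    if f: "f \<in> borel_measurable M" "f' \<in> borel_measurable M" for f f'
  proof -
    have "(\<lambda>x. (f x, f' x)) \<in> measurable M (borel \<Otimes>\<^sub>M borel)" using f by measurable
    from measurable_compose[OF this \<theta>] show ?thesis by simp
  qed
  have bdd: "bounded_fun (\<lambda>x. \<theta> (f x) (f' x))" if f: "bounded_fun f" "bounded_fun f'" for f f' :: "'x \<Rightarrow> real"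
  proof -
    obtain C C' where C: "\<And>x. \<bar>f x\<bar> \<le> C" "\<And>x. \<bar>f' x\<bar> \<le> C'"
      using f unfolding bounded_fun_def by blast
    have "\<bar>\<theta> (f x) (f' x)\<bar> \<le> \<bar>\<theta> 0 0\<bar> + L * (C + C')" for x
    proof -
      have "\<bar>\<theta> (f x) (f' x) - \<theta> 0 0\<bar> \<le> L * (\<bar>f x\<bar> + \<bar>f' x\<bar>)" using lip[of "f x" "f' x" 0 0] by simp
      also have "\<dots> \<le> L * (C + C')" using C L0 by (intro mult_left_mono add_mono) auto
      finally show ?thesis by linarith
    qed
    then show ?thesis by (rule bounded_funI)
  qed
  note sq = lipschitz_square_le[of \<theta>, OF lip]
  show ?thesis
    unfolding almost_periodic_def
  proof (intro conjI allI impI meas 1 2 bdd)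
    fix \<epsilon> :: real assume \<epsilon>: "\<epsilon> > 0"
    obtain \<delta> where \<delta>: "\<delta> > 0" and \<delta>\<epsilon>: "2 * L\<^sup>2 * (\<delta> + \<delta>) < \<epsilon>"
      using lipschitz_tolerance[OF \<epsilon>] .
    obtain \<Psi>1 where \<Psi>1: "finite \<Psi>1" "\<And>\<psi>. \<psi> \<in> \<Psi>1 \<Longrightarrow> \<psi> \<in> borel_measurable M \<and> bounded_fun \<psi>"
      "\<And>g. g \<in> I \<Longrightarrow> AE y in M. \<exists>\<psi>\<in>\<Psi>1. sqdist (\<lambda>x. \<phi>1 (act g x)) \<psi> y < \<delta>"
      using 1(3)[OF \<delta>] by blast
    obtain \<Psi>2 where \<Psi>2: "finite \<Psi>2" "\<And>\<psi>. \<psi> \<in> \<Psi>2 \<Longrightarrow> \<psi> \<in> borel_measurable M \<and> bounded_fun \<psi>"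
      "\<And>g. g \<in> I \<Longrightarrow> AE y in M. \<exists>\<psi>\<in>\<Psi>2. sqdist (\<lambda>x. \<phi>2 (act g x)) \<psi> y < \<delta>"
      using 2(3)[OF \<delta>] by blast
    define \<Psi> where "\<Psi> = (\<lambda>(\<psi>1, \<psi>2) x. \<theta> (\<psi>1 x) (\<psi>2 x)) ` (\<Psi>1 \<times> \<Psi>2)"
    show "\<exists>\<Psi>. finite \<Psi> \<and> (\<forall>\<psi>\<in>\<Psi>. \<psi> \<in> borel_measurable M \<and> bounded_fun \<psi>) \<and>
      (\<forall>g\<in>I. AE y in M. \<exists>\<psi>\<in>\<Psi>. sqdist (\<lambda>x. \<theta> (\<phi>1 (act g x)) (\<phi>2 (act g x))) \<psi> y < \<epsilon>)"
    proof (intro exI[of _ \<Psi>] conjI ballI)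
      show "finite \<Psi>" unfolding \<Psi>_def using \<Psi>1(1) \<Psi>2(1) by simp
      fix \<psi> assume "\<psi> \<in> \<Psi>"
      then obtain \<psi>1 \<psi>2 where "\<psi>1 \<in> \<Psi>1" "\<psi>2 \<in> \<Psi>2" "\<psi> = (\<lambda>x. \<theta> (\<psi>1 x) (\<psi>2 x))"
        unfolding \<Psi>_def by auto
      then show "\<psi> \<in> borel_measurable M" "bounded_fun \<psi>"
        using meas bdd \<Psi>1(2) \<Psi>2(2) by auto
    next
      fix g assume g: "g \<in> I"
      show "AE y in M. \<exists>\<psi>\<in>\<Psi>. sqdist (\<lambda>x. \<theta> (\<phi>1 (act g x)) (\<phi>2 (act g x))) \<psi> y < \<epsilon>"
        using \<Psi>1(3)[OF g] \<Psi>2(3)[OF g] AE_space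
      proof eventually_elim
        case (elim y)
        note y = elim(3)
        interpret p: prob_space "\<kappa> y" by (rule prob_fibre[OF y])
        obtain \<psi>1 \<psi>2 where \<psi>: "\<psi>1 \<in> \<Psi>1" "\<psi>2 \<in> \<Psi>2" "sqdist (\<lambda>x. \<phi>1 (act g x)) \<psi>1 y < \<delta>"
          "sqdist (\<lambda>x. \<phi>2 (act g x)) \<psi>2 y < \<delta>"
          using elim by blast
        have m: "(\<lambda>x. \<phi>1 (act g x)) \<in> borel_measurable M" "(\<lambda>x. \<phi>2 (act g x)) \<in> borel_measurable M"
          "\<psi>1 \<in> borel_measurable M" "\<psi>2 \<in> borel_measurable M"
          using measurable_act[OF g] 1(1) 2(1) \<psi> \<Psi>1(2) \<Psi>2(2) by auto
        have b: "bounded_fun (\<lambda>x. \<phi>1 (act g x))" "bounded_fun (\<lambda>x. \<phi>2 (act g x))" "bounded_fun \<psi>1" "bounded_fun \<psi>2"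
          using 1(2) 2(2) \<psi> \<Psi>1(2) \<Psi>2(2) unfolding bounded_fun_def by blast+
        note mf = measurable_fibre[OF y]
        have i1: "integrable (\<kappa> y) (\<lambda>x. (\<phi>1 (act g x) - \<psi>1 x)\<^sup>2)"
          and i2: "integrable (\<kappa> y) (\<lambda>x. (\<phi>2 (act g x) - \<psi>2 x)\<^sup>2)"
          and i3: "integrable (\<kappa> y) (\<lambda>x. (\<theta> (\<phi>1 (act g x)) (\<phi>2 (act g x)) - \<theta> (\<psi>1 x) (\<psi>2 x))\<^sup>2)"
          by (intro p.integrable_square_diff mf meas m bdd b)+
        have "sqdist (\<lambda>x. \<theta> (\<phi>1 (act g x)) (\<phi>2 (act g x))) (\<lambda>x. \<theta> (\<psi>1 x) (\<psi>2 x)) y \<le>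
          (\<integral>x. 2 * L\<^sup>2 * ((\<phi>1 (act g x) - \<psi>1 x)\<^sup>2 + (\<phi>2 (act g x) - \<psi>2 x)\<^sup>2) \<partial>\<kappa> y)"
          unfolding sqdist_def using sq
          by (intro integral_mono i3 integrable_mult_right Bochner_Integration.integrable_add i1 i2)
        also have "\<dots> = 2 * L\<^sup>2 * (sqdist (\<lambda>x. \<phi>1 (act g x)) \<psi>1 y + sqdist (\<lambda>x. \<phi>2 (act g x)) \<psi>2 y)"
          unfolding sqdist_def using i1 i2 by simp
        also have "\<dots> \<le> 2 * L\<^sup>2 * (\<delta> + \<delta>)" using \<psi>(3,4) by (intro mult_left_mono add_mono) auto
        also have "\<dots> < \<epsilon>" by (rule \<delta>\<epsilon>)
        finally show ?case using \<psi>(1,2) unfolding \<Psi>_def by force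
      qed
    qed
  qed
qed

lemma almost_periodic_const: "almost_periodic (\<lambda>_. c)"
  by (rule almost_periodic_A[where C = "\<bar>c\<bar>"]) auto

text \<open>As \<open>n\<close> grows these ramps converge to the indicator of the set where \<phi>
  exceeds \<open>c\<close>, which brings the generating sets of a sigma-algebra within reach of
  almost periodic functions.\<close>

lemma almost_periodic_clip:
  assumes "almost_periodic \<phi>"
  shows "almost_periodic (\<lambda>x. min 1 (max 0 (real n * (\<phi> x - c))))"
proof (rule almost_periodic_lipschitz[where \<theta> = "\<lambda>a b. min 1 (max 0 (real n * (a - c)))" and L = "real n", OF assms assms])
  fix a b a' b' :: real
  have "\<bar>min 1 (max 0 s) - min 1 (max 0 t)\<bar> \<le> \<bar>s - t\<bar>" for s t :: real by auto
  then have "\<bar>min 1 (max 0 (real n * (a - c))) - min 1 (max 0 (real n * (a' - c)))\<bar> \<le>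
      \<bar>real n * (a - c) - real n * (a' - c)\<bar>" .
  also have "\<dots> = real n * \<bar>a - a'\<bar>"
    by (metis abs_mult abs_of_nat diff_diff_eq2 diff_add_cancel right_diff_distrib')
  also have "\<dots> \<le> real n * (\<bar>a - a'\<bar> + \<bar>b - b'\<bar>)" by (intro mult_left_mono) auto
  finally show "\<bar>min 1 (max 0 (real n * (a - c))) - min 1 (max 0 (real n * (a' - c)))\<bar> \<le>
    real n * (\<bar>a - a'\<bar> + \<bar>b - b'\<bar>)" .
qed measurable

subsection \<open>Density\<close>

text \<open>The \<open>L2\<close> closure of the almost periodic functions inside the functions
  measurable for \<open>B\<close>. The closure is the class to work with, because indicators of
  generating sets arise only as limits of ramps.\<close>

definition ap_limit :: "'x measure \<Rightarrow> ('x \<Rightarrow> real) \<Rightarrow> bool" where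
  "ap_limit B u \<longleftrightarrow> u \<in> borel_measurable B \<and> integrable M (\<lambda>x. (u x)\<^sup>2) \<and>
    (\<forall>\<epsilon>>0. \<exists>\<phi>\<in>borel_measurable B. almost_periodic \<phi> \<and> (\<integral>x. (u x - \<phi> x)\<^sup>2 \<partial>M) < \<epsilon>)"

lemma integrable_sq_diff:
  assumes m: "u \<in> borel_measurable M" "v \<in> borel_measurable M"
    and i: "integrable M (\<lambda>x. (u x)\<^sup>2)" "integrable M (\<lambda>x. (v x)\<^sup>2)"
  shows "integrable M (\<lambda>x. (u x - v x)\<^sup>2 :: real)"
proof (rule Bochner_Integration.integrable_bound)
  show "integrable M (\<lambda>x. 2 * ((u x)\<^sup>2 + (v x)\<^sup>2))" using i by simp
  have "(a - b)\<^sup>2 \<le> 2 * (a\<^sup>2 + b\<^sup>2)" for a b :: real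
    using zero_le_power2[of "a + b"] by (simp add: power2_eq_square algebra_simps)
  then show "AE x in M. norm ((u x - v x)\<^sup>2) \<le> norm (2 * ((u x)\<^sup>2 + (v x)\<^sup>2))" by simp
qed (use m in measurable)

lemma sq_triangle:
  assumes m: "u \<in> borel_measurable M" "v \<in> borel_measurable M" "w \<in> borel_measurable M"
    and i: "integrable M (\<lambda>x. (u x)\<^sup>2)" "integrable M (\<lambda>x. (v x)\<^sup>2)" "integrable M (\<lambda>x. (w x)\<^sup>2)"
  shows "(\<integral>x. (u x - w x)\<^sup>2 \<partial>M) \<le> 2 * (\<integral>x. (u x - v x)\<^sup>2 \<partial>M) + 2 * (\<integral>x. (v x - w x)\<^sup>2 \<partial>M :: real)"
proof -
  have "(a - c)\<^sup>2 \<le> 2 * (a - b)\<^sup>2 + 2 * (b - c)\<^sup>2" for a b c :: real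
    using zero_le_power2[of "(a - b) - (b - c)"] by (simp add: power2_eq_square algebra_simps)
  then have "(\<integral>x. (u x - w x)\<^sup>2 \<partial>M) \<le> (\<integral>x. 2 * (u x - v x)\<^sup>2 + 2 * (v x - w x)\<^sup>2 \<partial>M)"
    by (intro integral_mono Bochner_Integration.integrable_add integrable_mult_right integrable_sq_diff m i)
  also have "\<dots> = 2 * (\<integral>x. (u x - v x)\<^sup>2 \<partial>M) + 2 * (\<integral>x. (v x - w x)\<^sup>2 \<partial>M)"
    using integrable_sq_diff[OF m(1,2) i(1,2)] integrable_sq_diff[OF m(2,3) i(2,3)] by simp
  finally show ?thesis .
qed

lemma integrable_sq_bounded:
  assumes "u \<in> borel_measurable M" "bounded_fun u" shows "integrable M (\<lambda>x. (u x)\<^sup>2)"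
proof -
  obtain C where "\<And>x. \<bar>u x\<bar> \<le> C" using assms(2) unfolding bounded_fun_def by blast
  then show ?thesis using assms(1) by (intro integrable_bounded[OF _ abs_square_le]) measurable
qed

lemma ap_limit_almost_periodic:
  assumes "subalgebra M B" "\<phi> \<in> borel_measurable B" "almost_periodic \<phi>"
  shows "ap_limit B \<phi>"
  unfolding ap_limit_def using assms integrable_sq_bounded almost_periodicD[OF assms(3)]
  by (auto intro!: bexI[of _ \<phi>])

lemma ap_limit_closed:
  assumes sB: "subalgebra M B" and u: "u \<in> borel_measurable B" "integrable M (\<lambda>x. (u x)\<^sup>2)"
    and lim: "\<And>\<epsilon>. \<epsilon> > 0 \<Longrightarrow> \<exists>v. ap_limit B v \<and> (\<integral>x. (u x - v x)\<^sup>2 \<partial>M) < \<epsilon>"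
  shows "ap_limit B u"
  unfolding ap_limit_def
proof (intro conjI allI impI u)
  fix \<epsilon> :: real assume "\<epsilon> > 0"
  then have e: "\<epsilon> / 4 > 0" by simp
  obtain v where v: "ap_limit B v" "(\<integral>x. (u x - v x)\<^sup>2 \<partial>M) < \<epsilon> / 4" using lim[OF e] by blast
  obtain \<phi> where \<phi>: "\<phi> \<in> borel_measurable B" "almost_periodic \<phi>" "(\<integral>x. (v x - \<phi> x)\<^sup>2 \<partial>M) < \<epsilon> / 4"
    using v(1) e unfolding ap_limit_def by blast
  have m: "u \<in> borel_measurable M" "v \<in> borel_measurable M" "\<phi> \<in> borel_measurable M"
    using u(1) v(1) \<phi>(1) measurable_from_subalg[OF sB] unfolding ap_limit_def by auto
  have i: "integrable M (\<lambda>x. (v x)\<^sup>2)" "integrable M (\<lambda>x. (\<phi> x)\<^sup>2)"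
    using v(1) integrable_sq_bounded[OF almost_periodicD(1,2)[OF \<phi>(2)]] unfolding ap_limit_def by auto
  have "(\<integral>x. (u x - \<phi> x)\<^sup>2 \<partial>M) < \<epsilon>"
    using sq_triangle[OF m u(2) i] v(2) \<phi>(3) by linarith
  then show "\<exists>\<phi>\<in>borel_measurable B. almost_periodic \<phi> \<and> (\<integral>x. (u x - \<phi> x)\<^sup>2 \<partial>M) < \<epsilon>"
    using \<phi> by blast
qed

text \<open>Here \<open>u\<close> and \<open>v\<close> may be unbounded;
  \<open>\<theta> 0 0 = 0\<close> lets their squares dominate the square of the composite.\<close>

lemma ap_limit_lipschitz:
  fixes \<theta> :: "real \<Rightarrow> real \<Rightarrow> real"
  assumes sB: "subalgebra M B" and u: "ap_limit B u" and v: "ap_limit B v"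
    and lip: "\<And>a b c d. \<bar>\<theta> a b - \<theta> c d\<bar> \<le> L * (\<bar>a - c\<bar> + \<bar>b - d\<bar>)" and zero: "\<theta> 0 0 = 0"
    and \<theta>: "(\<lambda>w. \<theta> (fst w) (snd w)) \<in> borel_measurable (borel \<Otimes>\<^sub>M borel)"
  shows "ap_limit B (\<lambda>x. \<theta> (u x) (v x))"
  unfolding ap_limit_def
proof (intro conjI allI impI)
  note sq = lipschitz_square_le[of \<theta>, OF lip]
  have meas: "(\<lambda>x. \<theta> (f x) (g x)) \<in> borel_measurable N"
    if "f \<in> borel_measurable N" "g \<in> borel_measurable N" for f g and N :: "'x measure"
  proof -
    have "(\<lambda>x. (f x, g x)) \<in> measurable N (borel \<Otimes>\<^sub>M borel)" using that by measurable
    from measurable_compose[OF this \<theta>] show ?thesis by simp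
  qed
  have mB: "u \<in> borel_measurable B" "v \<in> borel_measurable B" using u v unfolding ap_limit_def by auto
  have m: "u \<in> borel_measurable M" "v \<in> borel_measurable M"
    using measurable_from_subalg[OF sB mB(1)] measurable_from_subalg[OF sB mB(2)] by auto
  show "(\<lambda>x. \<theta> (u x) (v x)) \<in> borel_measurable B" by (rule meas[OF mB])
  have i: "integrable M (\<lambda>x. (u x)\<^sup>2)" "integrable M (\<lambda>x. (v x)\<^sup>2)" using u v unfolding ap_limit_def by auto
  have iuv: "integrable M (\<lambda>x. 2 * L\<^sup>2 * ((u x)\<^sup>2 + (v x)\<^sup>2))" using i by simp
  have "(\<theta> a b)\<^sup>2 \<le> 2 * L\<^sup>2 * (a\<^sup>2 + b\<^sup>2)" for a b using sq[of a b 0 0] zero by simp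
  then show "integrable M (\<lambda>x. (\<theta> (u x) (v x))\<^sup>2)"
    by (intro Bochner_Integration.integrable_bound[OF iuv] AE_I2 borel_measurable_power meas[OF m]) simp
  fix \<epsilon> :: real assume \<epsilon>: "\<epsilon> > 0"
  obtain \<delta> where \<delta>: "\<delta> > 0" and \<delta>\<epsilon>: "2 * L\<^sup>2 * (\<delta> + \<delta>) < \<epsilon>"
    using lipschitz_tolerance[OF \<epsilon>] .
  obtain \<phi> \<psi> where \<phi>: "\<phi> \<in> borel_measurable B" "almost_periodic \<phi>" "(\<integral>x. (u x - \<phi> x)\<^sup>2 \<partial>M) < \<delta>"
    and \<psi>: "\<psi> \<in> borel_measurable B" "almost_periodic \<psi>" "(\<integral>x. (v x - \<psi> x)\<^sup>2 \<partial>M) < \<delta>"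
    using u v \<delta> unfolding ap_limit_def by blast
  note a\<phi> = almost_periodicD(1,2)[OF \<phi>(2)] and a\<psi> = almost_periodicD(1,2)[OF \<psi>(2)]
  have i1: "integrable M (\<lambda>x. (u x - \<phi> x)\<^sup>2)" "integrable M (\<lambda>x. (v x - \<psi> x)\<^sup>2)"
    by (rule integrable_sq_diff[OF m(1) a\<phi>(1) i(1) integrable_sq_bounded[OF a\<phi>]],
        rule integrable_sq_diff[OF m(2) a\<psi>(1) i(2) integrable_sq_bounded[OF a\<psi>]])
  have "(\<integral>x. (\<theta> (u x) (v x) - \<theta> (\<phi> x) (\<psi> x))\<^sup>2 \<partial>M) \<le>
      (\<integral>x. 2 * L\<^sup>2 * ((u x - \<phi> x)\<^sup>2 + (v x - \<psi> x)\<^sup>2) \<partial>M)"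
  proof (rule integral_mono)
    show iR: "integrable M (\<lambda>x. 2 * L\<^sup>2 * ((u x - \<phi> x)\<^sup>2 + (v x - \<psi> x)\<^sup>2))" using i1 by simp
    show "integrable M (\<lambda>x. (\<theta> (u x) (v x) - \<theta> (\<phi> x) (\<psi> x))\<^sup>2)"
      using sq by (intro Bochner_Integration.integrable_bound[OF iR] AE_I2 borel_measurable_power
          borel_measurable_diff meas m a\<phi>(1) a\<psi>(1)) simp
  qed (rule sq)
  also have "\<dots> = 2 * L\<^sup>2 * ((\<integral>x. (u x - \<phi> x)\<^sup>2 \<partial>M) + (\<integral>x. (v x - \<psi> x)\<^sup>2 \<partial>M))"
    using i1 by simp
  also have "\<dots> \<le> 2 * L\<^sup>2 * (\<delta> + \<delta>)" using \<phi>(3) \<psi>(3) by (intro mult_left_mono add_mono) auto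
  also have "\<dots> < \<epsilon>" by (rule \<delta>\<epsilon>)
  finally have "(\<integral>x. (\<theta> (u x) (v x) - \<theta> (\<phi> x) (\<psi> x))\<^sup>2 \<partial>M) < \<epsilon>" .
  moreover have "almost_periodic (\<lambda>x. \<theta> (\<phi> x) (\<psi> x))"
    by (rule almost_periodic_lipschitz[OF \<phi>(2) \<psi>(2) lip \<theta>])
  ultimately show "\<exists>\<phi>\<in>borel_measurable B. almost_periodic \<phi> \<and> (\<integral>x. (\<theta> (u x) (v x) - \<phi> x)\<^sup>2 \<partial>M) < \<epsilon>"
    using meas[OF \<phi>(1) \<psi>(1)] by blast
qed

lemma ap_limit_add_mult:
  assumes "subalgebra M B" "ap_limit B u" "ap_limit B v"
  shows "ap_limit B (\<lambda>x. r * u x + s * v x)"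
  by (rule ap_limit_lipschitz[where \<theta> = "\<lambda>a b. r * a + s * b", OF assms lipschitz_linear]) (simp, measurable)

lemma ap_limit_max:
  assumes "subalgebra M B" "ap_limit B u" "ap_limit B v"
  shows "ap_limit B (\<lambda>x. max (u x) (v x))"
  by (rule ap_limit_lipschitz[where \<theta> = max and L = 1, OF assms]) (auto simp: max_def)

lemma ap_limit_dominated:
  assumes sB: "subalgebra M B" and u: "u \<in> borel_measurable B"
    and s: "\<And>n. ap_limit B (s n)" and lim: "\<And>x. x \<in> space M \<Longrightarrow> (\<lambda>n. s n x) \<longlonglongrightarrow> u x"
    and w: "integrable M (\<lambda>x. (w x)\<^sup>2)" and dom: "\<And>n x. x \<in> space M \<Longrightarrow> \<bar>s n x\<bar> \<le> \<bar>w x\<bar>"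
  shows "ap_limit B u"
proof -
  have m[measurable]: "u \<in> borel_measurable M" "s n \<in> borel_measurable M" for n
    using u s measurable_from_subalg[OF sB] unfolding ap_limit_def by auto
  have ub: "\<bar>u x\<bar> \<le> \<bar>w x\<bar>" if "x \<in> space M" for x
    by (rule LIMSEQ_le_const2[OF tendsto_rabs[OF lim[OF that]]]) (use dom[OF that] in auto)
  have iu: "integrable M (\<lambda>x. (u x)\<^sup>2)"
    by (rule Bochner_Integration.integrable_bound[OF w]) (use ub in \<open>auto intro!: AE_I2 simp: abs_le_square_iff\<close>)
  have "(\<lambda>n. \<integral>x. (u x - s n x)\<^sup>2 \<partial>M) \<longlonglongrightarrow> (\<integral>x. 0 \<partial>M)"
  proof (rule integral_dominated_convergence[where w = "\<lambda>x. 4 * (w x)\<^sup>2"])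
    show "integrable M (\<lambda>x. 4 * (w x)\<^sup>2)" using w by simp
    show "AE x in M. (\<lambda>n. (u x - s n x)\<^sup>2) \<longlonglongrightarrow> 0"
    proof (rule AE_I2)
      fix x assume "x \<in> space M"
      have "(\<lambda>n. (u x - s n x)\<^sup>2) \<longlonglongrightarrow> (u x - u x)\<^sup>2"
        by (intro tendsto_intros lim) fact
      then show "(\<lambda>n. (u x - s n x)\<^sup>2) \<longlonglongrightarrow> 0" by simp
    qed
    show "AE x in M. norm ((u x - s n x)\<^sup>2) \<le> 4 * (w x)\<^sup>2" for n
    proof (rule AE_I2)
      fix x assume x: "x \<in> space M"
      have "\<bar>u x - s n x\<bar> \<le> 2 * \<bar>w x\<bar>" using ub[OF x] dom[OF x, of n] by linarith
      from abs_square_le[OF this] show "norm ((u x - s n x)\<^sup>2) \<le> 4 * (w x)\<^sup>2"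
        by (simp add: power_mult_distrib)
    qed
  qed measurable
  then have l0: "(\<lambda>n. \<integral>x. (u x - s n x)\<^sup>2 \<partial>M) \<longlonglongrightarrow> 0" by simp
  show ?thesis
  proof (rule ap_limit_closed[OF sB u iu])
    fix \<epsilon> :: real assume "\<epsilon> > 0"
    then obtain n where "(\<integral>x. (u x - s n x)\<^sup>2 \<partial>M) < \<epsilon>"
      using order_tendstoD(2)[OF l0] unfolding eventually_sequentially by blast
    then show "\<exists>v. ap_limit B v \<and> (\<integral>x. (u x - v x)\<^sup>2 \<partial>M) < \<epsilon>" using s by blast
  qed
qed

text \<open>The sets whose indicator is a limit of almost periodic functions form a sigma-algebra:
  complements by linearity, finite unions by \<open>max\<close>, countable unions by dominated
  convergence. It contains \<open>A\<close>, whose bounded functions are almost periodic, and the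
  sets \<open>{x \<in> space M. c < \<phi> x}\<close> by means of ramps. Simple functions then reach
  all square integrable functions.\<close>

lemma ap_limit_dense:
  assumes B: "B = sigma (space M) (sets A \<union> {{x \<in> space M. c < \<phi> x} | \<phi> c. \<phi> \<in> \<Phi>})"
    and \<Phi>: "\<And>\<phi>. \<phi> \<in> \<Phi> \<Longrightarrow> almost_periodic \<phi>"
  shows "subalgebra M B" "sets A \<subseteq> sets B" "\<And>\<phi>. \<phi> \<in> \<Phi> \<Longrightarrow> \<phi> \<in> borel_measurable B"
    "\<And>u. u \<in> borel_measurable B \<Longrightarrow> integrable M (\<lambda>x. (u x)\<^sup>2) \<Longrightarrow> ap_limit B u"
proof -
  let ?G = "sets A \<union> {{x \<in> space M. c < \<phi> x} | \<phi> c. \<phi> \<in> \<Phi>}"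
  have Gs: "?G \<subseteq> sets M"
  proof -
    have "{x \<in> space M. c < \<phi> x} \<in> sets M" if "\<phi> \<in> \<Phi>" for \<phi> c
      using almost_periodicD(1)[OF \<Phi>[OF that]] by measurable
    then show ?thesis using sets_A by blast
  qed
  then have GP: "?G \<subseteq> Pow (space M)" using sets.space_closed by blast
  have spB: "space B = space M" unfolding B using GP by (simp add: space_measure_of)
  have setsB: "sets B = sigma_sets (space M) ?G" unfolding B using GP by (simp add: sets_measure_of)
  show sB: "subalgebra M B"
    unfolding subalgebra_def spB setsB using sets.sigma_sets_subset[OF Gs] by simp
  show AB: "sets A \<subseteq> sets B" unfolding setsB by auto
  show \<Phi>B: "\<phi> \<in> borel_measurable B" if "\<phi> \<in> \<Phi>" for \<phi>
    unfolding borel_measurable_iff_greater setsB spB using that by auto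
  have A_B: "f \<in> borel_measurable B" if "f \<in> borel_measurable A" for f :: "'x \<Rightarrow> real"
    using that AB spB space_A unfolding measurable_def by auto
  have indA: "ap_limit B (indicator a)" if a: "a \<in> sets A" for a
  proof (rule ap_limit_almost_periodic[OF sB])
    have m: "(indicator a :: 'x \<Rightarrow> real) \<in> borel_measurable A" using a by simp
    then show "(indicator a :: 'x \<Rightarrow> real) \<in> borel_measurable B" by (rule A_B)
    show "almost_periodic (indicator a)" by (rule almost_periodic_A[OF m, of 1]) (auto split: split_indicator)
  qed
  have ind\<Phi>: "ap_limit B (indicator {x \<in> space M. c < \<phi> x})" if \<phi>: "\<phi> \<in> \<Phi>" for \<phi> c
  proof (rule ap_limit_dominated[OF sB, where w = "\<lambda>_. 1" and s = "\<lambda>n x. min 1 (max 0 (real n * (\<phi> x - c)))"])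
    note [measurable] = \<Phi>B[OF \<phi>]
    show "indicator {x \<in> space M. c < \<phi> x} \<in> borel_measurable B"
      unfolding spB[symmetric] by measurable
    fix n show "ap_limit B (\<lambda>x. min 1 (max 0 (real n * (\<phi> x - c))))"
      by (rule ap_limit_almost_periodic[OF sB _ almost_periodic_clip[OF \<Phi>[OF \<phi>]]]) measurable
  next
    fix x assume x: "x \<in> space M"
    show "(\<lambda>n. min 1 (max 0 (real n * (\<phi> x - c)))) \<longlonglongrightarrow> indicator {x \<in> space M. c < \<phi> x} x"
    proof (cases "c < \<phi> x")
      case True
      obtain N :: nat where N: "1 / (\<phi> x - c) < real N" using reals_Archimedean2 by blast
      have "min 1 (max 0 (real n * (\<phi> x - c))) = 1" if "n \<ge> N" for n
      proof -
        have "1 / (\<phi> x - c) \<le> real n" using N that by linarith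
        then have "1 \<le> real n * (\<phi> x - c)" using True by (simp add: field_simps)
        then show ?thesis by simp
      qed
      then show ?thesis using True x
        by (intro tendsto_eventually) (auto simp: eventually_sequentially)
    next
      case False
      then have "min 1 (max 0 (real n * (\<phi> x - c))) = 0" for n
        by (simp add: max_absorb1 mult_nonneg_nonpos)
      then show ?thesis using False by simp
    qed
  qed (auto simp: integrable_const)
  have ind: "ap_limit B (indicator S)" if S: "S \<in> sets B" for S
  proof -
    have cpl: "ap_limit B (indicator (space M - S))" if "ap_limit B (indicator S)" for S
    proof -
      have sp: "ap_limit B (indicator (space M))" by (rule indA) (simp add: space_A[symmetric])
      have "S \<inter> space M \<in> sets B"
      proof -
        have "(indicator S :: 'x \<Rightarrow> real) \<in> borel_measurable B" using that unfolding ap_limit_def by blast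
        then show ?thesis unfolding borel_measurable_indicator_iff spB .
      qed
      then have m: "(indicator (space M - S) :: 'x \<Rightarrow> real) \<in> borel_measurable B"
      proof -
        have "space M - S = space B - (S \<inter> space M)" using spB by auto
        then show ?thesis using \<open>S \<inter> space M \<in> sets B\<close> by simp
      qed
      show ?thesis
      proof (rule ap_limit_closed[OF sB m])
        show "integrable M (\<lambda>x. (indicator (space M - S) x :: real)\<^sup>2)"
          using measurable_from_subalg[OF sB m]
          by (intro integrable_sq_bounded bounded_funI[of _ 1]) (auto split: split_indicator)
        fix \<epsilon> :: real assume "\<epsilon> > 0"
        have "(\<integral>x. (indicator (space M - S) x - (1 * indicator (space M) x + (- 1) * indicator S x))\<^sup>2 \<partial>M) = (\<integral>x. 0 \<partial>M :: real)"
          by (intro Bochner_Integration.integral_cong) (auto split: split_indicator)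
        then show "\<exists>v. ap_limit B v \<and> (\<integral>x. (indicator (space M - S) x - v x)\<^sup>2 \<partial>M) < \<epsilon>"
          using ap_limit_add_mult[OF sB sp that, of 1 "- 1"] \<open>\<epsilon> > 0\<close> by (intro exI conjI) auto
      qed
    qed
    have un: "ap_limit B (indicator (S \<union> T))" if "ap_limit B (indicator S)" "ap_limit B (indicator T)" for S T
    proof -
      have "(indicator (S \<union> T) :: 'x \<Rightarrow> real) = (\<lambda>x. max (indicator S x) (indicator T x))"
        by (auto simp: fun_eq_iff split: split_indicator)
      then show ?thesis using ap_limit_max[OF sB that] by simp
    qed
    have "S \<in> sigma_sets (space M) ?G" using S setsB by simp
    then show ?thesis
    proof induction
      case (Basic a)
      then show ?case using indA ind\<Phi> by auto
    next
      case Empty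
      show ?case by (rule indA) simp
    next
      case (Compl a)
      then show ?case by (intro cpl)
    next
      case (Union a)
      define U where "U n = (\<Union>i<n. a i)" for n :: nat
      have apU: "ap_limit B (indicator (U n))" for n
      proof (induction n)
        case 0
        show ?case unfolding U_def by (rule indA) simp
      next
        case (Suc n)
        have "U (Suc n) = U n \<union> a n" unfolding U_def by (auto simp: lessThan_Suc)
        then show ?case using un[OF Suc Union.IH[of n]] by simp
      qed
      show ?case
      proof (rule ap_limit_dominated[OF sB _ apU, where w = "\<lambda>_. 1"])
        have "a i \<in> sets B" for i using Union.hyps[of i] setsB by simp
        then show "indicator (\<Union> (range a)) \<in> borel_measurable B" by simp
        fix x
        show "(\<lambda>n. indicator (U n) x) \<longlonglongrightarrow> (indicator (\<Union> (range a)) x :: real)"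
        proof (cases "x \<in> \<Union> (range a)")
          case True
          then obtain i where "x \<in> a i" by auto
          then have "x \<in> U n" if "n \<ge> Suc i" for n using that unfolding U_def by auto
          then have "indicator (U n) x = (indicator (\<Union> (range a)) x :: real)" if "n \<ge> Suc i" for n
            using that True by simp
          then show ?thesis
            by (intro tendsto_eventually) (auto simp only: eventually_sequentially)
        next
          case False
          then have "x \<notin> U n" for n unfolding U_def by auto
          then show ?thesis using False by simp
        qed
      qed (auto split: split_indicator)
    qed
  qed
  fix u :: "'x \<Rightarrow> real" assume u: "u \<in> borel_measurable B" and iu: "integrable M (\<lambda>x. (u x)\<^sup>2)"
  have sum_ind: "ap_limit B (\<lambda>x. \<Sum>y\<in>K. y * indicator (S y) x)"
    if "finite K" "\<And>y. y \<in> K \<Longrightarrow> S y \<in> sets B" for K and S :: "real \<Rightarrow> 'x set"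
    using that
  proof (induction K)
    case empty
    show ?case using ap_limit_almost_periodic[OF sB _ almost_periodic_const[of 0]] by simp
  next
    case (insert y K)
    have "ap_limit B (\<lambda>x. y * indicator (S y) x + 1 * (\<Sum>y\<in>K. y * indicator (S y) x))"
      by (rule ap_limit_add_mult[OF sB ind insert.IH]) (use insert.prems in auto)
    then show ?case using insert.hyps by (simp only: sum.insert mult_1 not_False_eq_True)
  qed
  have simple: "ap_limit B s" if s: "simple_function B s" for s :: "'x \<Rightarrow> real"
  proof -
    define S where "S y = s -` {y} \<inter> space B" for y
    define t where "t x = (\<Sum>y\<in>s ` space B. y * indicator (S y) x)" for x
    have fin: "finite (s ` space B)" and SB: "S y \<in> sets B" for y
      using s by (auto simp: simple_function_def S_def intro: simple_functionD(2)[OF s])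
    have t: "ap_limit B t" unfolding t_def using fin SB by (intro sum_ind)
    have eq: "t x = s x" if "x \<in> space M" for x
    proof -
      have "t x = (\<Sum>y\<in>s ` space B. if y = s x then y else 0)"
        unfolding t_def S_def using that spB by (intro sum.cong) (auto split: split_indicator)
      also have "\<dots> = s x" using fin that spB by (simp add: sum.delta)
      finally show ?thesis .
    qed
    show ?thesis
    \<comment> \<open>A constant sequence transfers the property from \<open>t\<close> to
      \<open>s\<close>, which agree on the space but perhaps not outside it.\<close>
    proof (rule ap_limit_dominated[OF sB, where s = "\<lambda>_. t" and w = t])
      show "s \<in> borel_measurable B" using s by (rule borel_measurable_simple_function)
      show "integrable M (\<lambda>x. (t x)\<^sup>2)" using t unfolding ap_limit_def by blast
    qed (use t eq in auto)
  qed
  obtain F where F: "\<And>i. simple_function B (F i)" "\<And>x. x \<in> space B \<Longrightarrow> (\<lambda>i. F i x) \<longlonglongrightarrow> u x"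
    "\<And>i x. x \<in> space B \<Longrightarrow> dist (F i x) 0 \<le> 2 * dist (u x) 0"
    using borel_measurable_implies_sequence_metric[OF u, of 0] by blast
  show "ap_limit B u"
  proof (rule ap_limit_dominated[OF sB u simple[OF F(1)], where w = "\<lambda>x. 2 * u x"])
    show "integrable M (\<lambda>x. (2 * u x)\<^sup>2)" using iu by (simp add: power_mult_distrib)
  qed (use F(2,3) spB in \<open>auto simp: abs_mult\<close>)
qed

end

section \<open>Locally compact groups acting on a standard Borel space\<close>

lemma sets_borel_of: "sets (borel_of T) = sigma_sets (topspace T) {U. openin T U}"
  and space_borel_of: "space (borel_of T) = topspace T"
proof -
  have "{U. openin T U} \<subseteq> Pow (topspace T)" using openin_subset by blast
  then show "sets (borel_of T) = sigma_sets (topspace T) {U. openin T U}" "space (borel_of T) = topspace T"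
    unfolding borel_of_def by (simp_all add: sets_measure_of space_measure_of)
qed

lemma openin_sets_borel_of: "openin T U \<Longrightarrow> U \<in> sets (borel_of T)"
  unfolding sets_borel_of by auto

lemma continuous_map_borel_measurable:
  assumes "continuous_map T T' f" shows "f \<in> measurable (borel_of T) (borel_of T')"
proof (rule measurable_sigma_sets[OF sets_borel_of])
  show "{U. openin T' U} \<subseteq> Pow (topspace T')" using openin_subset by blast
  show "f \<in> space (borel_of T) \<rightarrow> topspace T'"
    using assms unfolding space_borel_of continuous_map_def by blast
  fix U assume "U \<in> {U. openin T' U}"
  then have "openin T {x \<in> topspace T. f x \<in> U}" using assms unfolding continuous_map_def by blast
  moreover have "f -` U \<inter> space (borel_of T) = {x \<in> topspace T. f x \<in> U}"
    unfolding space_borel_of by auto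
  ultimately show "f -` U \<inter> space (borel_of T) \<in> sets (borel_of T)"
    by (simp add: openin_sets_borel_of)
qed

text \<open>By second countability an open set of the product space is a countable union of open
  rectangles, hence belongs to the product of the Borel sigma-algebras.\<close>

lemma continuous_map_prod_borel_measurable:
  assumes sc: "second_countable T" and f: "continuous_map (prod_topology T T) T' f"
  shows "f \<in> measurable (borel_of T \<Otimes>\<^sub>M borel_of T) (borel_of T')"
proof (rule measurable_sigma_sets[OF sets_borel_of])
  obtain \<B> where \<B>: "countable \<B>" "\<And>V. V \<in> \<B> \<Longrightarrow> openin T V"
    "\<And>U x. openin T U \<Longrightarrow> x \<in> U \<Longrightarrow> \<exists>V\<in>\<B>. x \<in> V \<and> V \<subseteq> U"
    using sc unfolding second_countable_def by metis
  show "{U. openin T' U} \<subseteq> Pow (topspace T')" using openin_subset by blast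
  show "f \<in> space (borel_of T \<Otimes>\<^sub>M borel_of T) \<rightarrow> topspace T'"
    using f unfolding space_pair_measure space_borel_of continuous_map_def by auto
  fix U assume "U \<in> {U. openin T' U}"
  then have W: "openin (prod_topology T T) {x \<in> topspace T \<times> topspace T. f x \<in> U}" (is "openin _ ?W")
    using f unfolding continuous_map_def by simp
  have "?W = (\<Union>(V, V')\<in>{(V, V') \<in> \<B> \<times> \<B>. V \<times> V' \<subseteq> ?W}. V \<times> V')"
  proof (rule Set.set_eqI, rule iffI)
    fix w assume "w \<in> ?W"
    obtain x y where xy: "w = (x, y)" by (rule prod.exhaust)
    have "\<exists>U1 U2. openin T U1 \<and> openin T U2 \<and> x \<in> U1 \<and> y \<in> U2 \<and> U1 \<times> U2 \<subseteq> ?W"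
      using W[unfolded openin_prod_topology_alt, rule_format, of x y] \<open>w \<in> ?W\<close>[unfolded xy] by blast
    then obtain U1 U2 where w: "w = (x, y)" "openin T U1" "openin T U2" "x \<in> U1" "y \<in> U2" "U1 \<times> U2 \<subseteq> ?W"
      using xy by blast
    obtain V where "V \<in> \<B>" "x \<in> V" "V \<subseteq> U1" using \<B>(3)[OF w(2,4)] by blast
    moreover obtain V' where "V' \<in> \<B>" "y \<in> V'" "V' \<subseteq> U2" using \<B>(3)[OF w(3,5)] by blast
    ultimately have "(V, V') \<in> {(V, V') \<in> \<B> \<times> \<B>. V \<times> V' \<subseteq> ?W}" "w \<in> V \<times> V'"
      using w(1,6) by blast+
    then show "w \<in> (\<Union>(V, V')\<in>{(V, V') \<in> \<B> \<times> \<B>. V \<times> V' \<subseteq> ?W}. V \<times> V')" by blast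
  qed blast
  also have "\<dots> \<in> sets (borel_of T \<Otimes>\<^sub>M borel_of T)"
  proof (rule sets.countable_UN')
    have "countable (\<B> \<times> \<B>)" using \<B>(1) by simp
    then show "countable {(V, V') \<in> \<B> \<times> \<B>. V \<times> V' \<subseteq> ?W}"
      by (rule countable_subset[rotated]) blast
  qed (use \<B>(2) openin_sets_borel_of in auto)
  finally show "f -` U \<inter> space (borel_of T \<Otimes>\<^sub>M borel_of T) \<in> sets (borel_of T \<Otimes>\<^sub>M borel_of T)"
    unfolding space_pair_measure space_borel_of by (simp add: vimage_def Int_def conj_commute)
qed

section \<open>Haar measure and averages along orbits\<close>

locale haar_action =
  fixes G :: "('g, 'mm) monoid_scheme" (structure) and T :: "'g topology"
    and X :: "('g, 'x) gspace" and m :: "'g measure"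
  assumes lcsc: "lcsc_group G T" and sys: "standard_borel_gspace G T X"
    and haar: "left_haar_measure G T m"
begin

abbreviation "M \<equiv> gmeas X"
abbreviation "act \<equiv> gact X"
abbreviation "BG \<equiv> borel_of T"

sublocale group G
  using lcsc unfolding lcsc_group_def topological_group_def by blast

sublocale X: prob_space "gmeas X"
  using sys unfolding standard_borel_gspace_def borel_gspace_def by blast

sublocale group_action G "space (gmeas X)" "gact X"
  using sys unfolding standard_borel_gspace_def borel_gspace_def by blast

lemma topspace_T: "topspace T = carrier G"
  using lcsc unfolding lcsc_group_def topological_group_def by blast

lemma space_BG: "space BG = carrier G"
  by (simp add: space_borel_of topspace_T)

lemma sets_m[measurable_cong]: "sets m = sets BG"
  using haar unfolding left_haar_measure_def by blast

lemma space_m: "space m = carrier G"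
  using sets_eq_imp_space_eq[OF sets_m] space_BG by simp

lemma mult_measurable[measurable]: "(\<lambda>w. fst w \<otimes> snd w) \<in> measurable (BG \<Otimes>\<^sub>M BG) BG"
proof -
  have "continuous_map (prod_topology T T) T (\<lambda>(g, h). g \<otimes> h)" "second_countable T"
    using lcsc unfolding lcsc_group_def topological_group_def by blast+
  from continuous_map_prod_borel_measurable[OF this(2,1)] show ?thesis by (simp add: split_beta)
qed

lemma inv_measurable[measurable]: "(\<lambda>g. inv g) \<in> measurable BG BG"
proof -
  have "continuous_map T T (\<lambda>g. inv g)"
    using lcsc unfolding lcsc_group_def topological_group_def by blast
  then show ?thesis by (rule continuous_map_borel_measurable)
qed

lemma act_joint_measurable[measurable]: "(\<lambda>w. act (fst w) (snd w)) \<in> measurable (BG \<Otimes>\<^sub>M M) M"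
  using sys unfolding standard_borel_gspace_def borel_gspace_def by (simp add: split_beta')

lemma act_space: "g \<in> carrier G \<Longrightarrow> x \<in> space M \<Longrightarrow> act g x \<in> space M"
  using element_image by blast

lemma act_inv: "g \<in> carrier G \<Longrightarrow> x \<in> space M \<Longrightarrow> act (inv g) (act g x) = x"
  using orbit_sym_aux by blast

lemma act_mpres: "g \<in> carrier G \<Longrightarrow> act g \<in> measurable M M" "g \<in> carrier G \<Longrightarrow> distr M M (act g) = M"
  using sys unfolding standard_borel_gspace_def borel_gspace_def mpres_def by blast+

lemma sb: "standard_borel M"
  using sys unfolding standard_borel_gspace_def by blast

lemma AE_act: "g \<in> carrier G \<Longrightarrow> AE x in M. P x \<Longrightarrow> AE x in M. P (act g x)"
  by (rule AE_distrD[OF act_mpres(1)]) (simp_all only: act_mpres(2))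

text \<open>Local compactness covers the group by basic open sets that lie inside compact ones.
  Compact sets have finite measure, and they are measurable because they are closed in a Hausdorff
  space.\<close>

sublocale haar: sigma_finite_measure m
proof
  have T: "Hausdorff_space T" "locally_compact_space T" "second_countable T"
    using lcsc unfolding lcsc_group_def topological_group_def by blast+
  obtain \<B> where \<B>: "countable \<B>" "\<And>V. V \<in> \<B> \<Longrightarrow> openin T V"
    "\<And>U x. openin T U \<Longrightarrow> x \<in> U \<Longrightarrow> \<exists>V\<in>\<B>. x \<in> V \<and> V \<subseteq> U"
    using T(3) unfolding second_countable_def by metis
  define \<C> where "\<C> = {V \<in> \<B>. \<exists>K. compactin T K \<and> V \<subseteq> K}"
  have "\<Union>\<C> = carrier G"
  proof (rule antisym)
    show "\<Union>\<C> \<subseteq> carrier G" using \<B>(2) openin_subset topspace_T unfolding \<C>_def by blast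
    show "carrier G \<subseteq> \<Union>\<C>"
    proof
      fix x assume "x \<in> carrier G"
      then obtain U K where UK: "openin T U" "compactin T K" "x \<in> U" "U \<subseteq> K"
        using T(2) unfolding locally_compact_space_def topspace_T by blast
      then obtain V where "V \<in> \<B>" "x \<in> V" "V \<subseteq> U" using \<B>(3) by blast
      then show "x \<in> \<Union>\<C>" unfolding \<C>_def using UK by blast
    qed
  qed
  moreover have "emeasure m V \<noteq> \<infinity>" if "V \<in> \<C>" for V
  proof -
    obtain K where K: "compactin T K" "V \<subseteq> K" using \<open>V \<in> \<C>\<close> unfolding \<C>_def by blast
    have "closedin T K" using K(1) T(1) by (rule compactin_imp_closedin[rotated])
    then have "openin T (topspace T - K)" "K \<subseteq> topspace T" by (auto simp: closedin_def)
    then have "topspace T - (topspace T - K) \<in> sets BG"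
      using openin_sets_borel_of sets.compl_sets[of _ BG] space_borel_of by metis
    then have "K \<in> sets m" using \<open>K \<subseteq> topspace T\<close> sets_m by (simp add: double_diff)
    then have "emeasure m V \<le> emeasure m K" using K(2) by (rule emeasure_mono[rotated])
    also have "\<dots> < \<infinity>" using haar K(1) unfolding left_haar_measure_def by blast
    finally show ?thesis by simp
  qed
  moreover have "countable \<C>" unfolding \<C>_def using \<B>(1) by simp
  moreover have "\<C> \<subseteq> sets m" unfolding \<C>_def sets_m using \<B>(2) openin_sets_borel_of by blast
  ultimately show "\<exists>A. countable A \<and> A \<subseteq> sets m \<and> \<Union> A = space m \<and> (\<forall>a\<in>A. emeasure m a \<noteq> \<infinity>)"
    unfolding space_m by blast
qed

lemma translate_measurable: "g \<in> carrier G \<Longrightarrow> (\<lambda>h. g \<otimes> h) \<in> measurable m m"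
proof -
  assume g: "g \<in> carrier G"
  have "(\<lambda>h. (g, h)) \<in> measurable BG (BG \<Otimes>\<^sub>M BG)" using g space_BG by simp
  from measurable_compose[OF this mult_measurable] show ?thesis
    using measurable_cong_sets[OF sets_m sets_m] by simp
qed

lemma integral_translate:
  fixes f :: "'g \<Rightarrow> real"
  assumes "g \<in> carrier G" "f \<in> borel_measurable m"
  shows "(\<integral>h. f (g \<otimes> h) \<partial>m) = (\<integral>h. f h \<partial>m)"
proof -
  have "distr m m (\<lambda>h. g \<otimes> h) = m" using haar assms(1) unfolding left_haar_measure_def by blast
  then show ?thesis using integral_distr[OF translate_measurable[OF assms(1)] assms(2)] by simp
qed

lemma orbit_measurable[measurable]:
  "(\<lambda>w. act (inv (fst w)) (snd w)) \<in> measurable (m \<Otimes>\<^sub>M M) M"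
proof -
  have "(\<lambda>w. (inv (fst w), snd w)) \<in> measurable (m \<Otimes>\<^sub>M M) (BG \<Otimes>\<^sub>M M)" by measurable
  from measurable_compose[OF this act_joint_measurable] show ?thesis by simp
qed

lemma orbit_measurable': "x \<in> space M \<Longrightarrow> (\<lambda>g. act (inv g) x) \<in> measurable m M"
  using measurable_compose[OF measurable_Pair2'[of x M m] orbit_measurable] by simp

text \<open>Having \<open>A\<close> on both sides is what makes \<open>X\<close> with the
  sigma-algebra \<open>A\<close> a Borel G-space; it is stronger than invariance of \<open>A\<close>
  under each single \<open>g\<close>.\<close>

definition admissible :: "'x measure \<Rightarrow> bool" where
  "admissible A \<longleftrightarrow> subalgebra M A \<and> (\<lambda>w. act (fst w) (snd w)) \<in> measurable (BG \<Otimes>\<^sub>M A) A"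

lemma admissible_act:
  assumes "admissible A" "g \<in> carrier G" shows "act g \<in> measurable A A"
proof -
  have "(\<lambda>x. (g, x)) \<in> measurable A (BG \<Otimes>\<^sub>M A)" using assms(2) space_BG by simp
  moreover have "(\<lambda>w. act (fst w) (snd w)) \<in> measurable (BG \<Otimes>\<^sub>M A) A"
    using assms(1) unfolding admissible_def by (rule conjunct2)
  ultimately have "(\<lambda>x. act (fst (g, x)) (snd (g, x))) \<in> measurable A A"
    by (rule measurable_compose)
  then show ?thesis by simp
qed

lemma sections_null:
  assumes P: "Measurable.pred (m \<Otimes>\<^sub>M M) P" and "\<And>g. g \<in> carrier G \<Longrightarrow> AE x in M. P (g, x)"
  shows "AE x in M. AE g in m. P (g, x)"
proof -
  interpret pair_sigma_finite m M ..
  have "AE g in m. AE x in M. P (g, x)" by (rule AE_I2) (use assms(2) space_m in simp)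
  then show ?thesis using AE_commute[of "\<lambda>g x. P (g, x)"] P by (simp add: pred_def)
qed

lemma integrable_cut:
  fixes u :: "'g \<Rightarrow> real"
  assumes C: "C \<in> sets m" "emeasure m C < \<infinity>" and u: "u \<in> borel_measurable m" and K: "\<And>g. g \<in> space m \<Longrightarrow> \<bar>u g\<bar> \<le> K"
  shows "integrable m (\<lambda>g. indicator C g * u g)"
proof (rule Bochner_Integration.integrable_bound)
  show "integrable m (\<lambda>g. \<bar>K\<bar> * indicator C g)" using C by (intro integrable_mult_right) auto
  show "AE g in m. norm (indicator C g * u g) \<le> norm (\<bar>K\<bar> * indicator C g)"
    using K by (intro AE_I2) (force split: split_indicator)
qed (use C u in measurable)

lemma abs_integral_cut:
  fixes u :: "'g \<Rightarrow> real"
  assumes C: "C \<in> sets m" "emeasure m C < \<infinity>" and u: "u \<in> borel_measurable m" and K: "\<And>g. g \<in> space m \<Longrightarrow> \<bar>u g\<bar> \<le> K"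
  shows "\<bar>\<integral>g. indicator C g * u g \<partial>m\<bar> \<le> \<bar>K\<bar> * measure m C"
proof -
  have "\<bar>\<integral>g. indicator C g * u g \<partial>m\<bar> \<le> (\<integral>g. \<bar>indicator C g * u g\<bar> \<partial>m)" by (rule integral_abs_bound)
  also have "\<dots> \<le> (\<integral>g. \<bar>K\<bar> * indicator C g \<partial>m)"
  proof (rule integral_mono)
    show "integrable m (\<lambda>g. \<bar>indicator C g * u g\<bar>)" by (rule integrable_abs[OF integrable_cut[OF assms]])
    show "integrable m (\<lambda>g. \<bar>K\<bar> * indicator C g)" using C by (intro integrable_mult_right) auto
    fix g assume "g \<in> space m"
    then show "\<bar>indicator C g * u g\<bar> \<le> \<bar>K\<bar> * indicator C g"
      using K by (force split: split_indicator)
  qed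
  also have "\<dots> = \<bar>K\<bar> * measure m C" using C by simp
  finally show ?thesis .
qed

lemma integrable_cut_pair:
  fixes u :: "'g \<times> 'x \<Rightarrow> real"
  assumes C[measurable]: "C \<in> sets m" "emeasure m C < \<infinity>" and P: "prob_space P"
    and u[measurable]: "u \<in> borel_measurable (m \<Otimes>\<^sub>M P)" and K: "\<And>w. w \<in> space (m \<Otimes>\<^sub>M P) \<Longrightarrow> \<bar>u w\<bar> \<le> K"
  shows "integrable (m \<Otimes>\<^sub>M P) (\<lambda>(g, z). indicator C g * u (g, z))"
proof (rule Bochner_Integration.integrable_bound)
  interpret P: prob_space P by fact
  have "emeasure (m \<Otimes>\<^sub>M P) (C \<times> space P) < \<infinity>"
    using C by (subst P.emeasure_pair_measure_Times) (auto simp: P.emeasure_space_1)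
  then show "integrable (m \<Otimes>\<^sub>M P) (\<lambda>w. \<bar>K\<bar> * indicator (C \<times> space P) w)"
    using C by (intro integrable_mult_right) auto
  show "AE w in m \<Otimes>\<^sub>M P. norm (case w of (g, z) \<Rightarrow> indicator C g * u (g, z)) \<le> norm (\<bar>K\<bar> * indicator (C \<times> space P) w)"
  proof (rule AE_I2)
    fix w assume w: "w \<in> space (m \<Otimes>\<^sub>M P)"
    have "\<bar>u w\<bar> \<le> \<bar>K\<bar>" using K[OF w] by linarith
    then show "norm (case w of (g, z) \<Rightarrow> indicator C g * u (g, z)) \<le> norm (\<bar>K\<bar> * indicator (C \<times> space P) w)"
      using w by (auto simp: space_pair_measure split: split_indicator prod.split)
  qed
qed (simp add: split_beta)

text \<open>An arbitrary function need not pull back measurably under the joint action; its averages along orbits do.\<close>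

definition smear :: "'g set \<Rightarrow> ('x \<Rightarrow> real) \<Rightarrow> 'x \<Rightarrow> real" where
  "smear C F x = (if x \<in> space M then \<integral>g. indicator C g * F (act (inv g) x) \<partial>m else 0)"

lemma smear_measurable[measurable]:
  assumes C[measurable]: "C \<in> sets m" and F[measurable]: "F \<in> borel_measurable M"
  shows "smear C F \<in> borel_measurable M"
proof -
  have "(\<lambda>w. F (act (inv (fst w)) (snd w))) \<in> borel_measurable (m \<Otimes>\<^sub>M M)"
    by (rule measurable_compose[OF orbit_measurable F])
  moreover have "(\<lambda>w. (snd w, fst w)) \<in> measurable (M \<Otimes>\<^sub>M m) (m \<Otimes>\<^sub>M M)" by measurable
  ultimately have "(\<lambda>w. F (act (inv (fst (snd w, fst w))) (snd (snd w, fst w)))) \<in> borel_measurable (M \<Otimes>\<^sub>M m)"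
    by (rule measurable_compose[rotated])
  then have [measurable]: "(\<lambda>w. F (act (inv (snd w)) (fst w))) \<in> borel_measurable (M \<Otimes>\<^sub>M m)" by simp
  show ?thesis unfolding smear_def by measurable
qed

lemma smear_bound:
  assumes C: "C \<in> sets m" "emeasure m C < \<infinity>" and F: "F \<in> borel_measurable M" and K: "\<And>x. \<bar>F x\<bar> \<le> K"
  shows "\<bar>smear C F x\<bar> \<le> \<bar>K\<bar> * measure m C"
proof (cases "x \<in> space M")
  case True
  then show ?thesis unfolding smear_def
    using abs_integral_cut[OF C measurable_compose[OF orbit_measurable'[OF True] F], of K] K by simp
qed (simp add: smear_def)

text \<open>Left invariance substitutes \<open>h \<otimes> g\<close> for \<open>g\<close>, and the
  translation then cancels inside \<open>F\<close>. It survives only in the set \<open>C\<close>,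
  which is why \<open>smear\<close> acts by \<open>inv g\<close>.\<close>

lemma smear_translate:
  assumes C[measurable]: "C \<in> sets m" and F[measurable]: "F \<in> borel_measurable M"
    and h: "h \<in> carrier G" and x: "x \<in> space M"
  shows "smear C F (act h x) = (\<integral>g. indicator C (h \<otimes> g) * F (act (inv g) x) \<partial>m)"
proof -
  note hx = act_space[OF h x]
  have "smear C F (act h x) = (\<integral>g. indicator C g * F (act (inv g) (act h x)) \<partial>m)"
    using hx by (simp add: smear_def)
  also have "\<dots> = (\<integral>g. indicator C (h \<otimes> g) * F (act (inv (h \<otimes> g)) (act h x)) \<partial>m)"
  proof (rule integral_translate[OF h, symmetric])
    show "(\<lambda>g. indicator C g * F (act (inv g) (act h x))) \<in> borel_measurable m"
      using measurable_compose[OF orbit_measurable'[OF hx] F] by measurable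
  qed
  also have "\<dots> = (\<integral>g. indicator C (h \<otimes> g) * F (act (inv g) x) \<partial>m)"
  proof (rule Bochner_Integration.integral_cong[OF refl])
    fix g assume "g \<in> space m"
    then have g: "g \<in> carrier G" using space_m by simp
    have "act (inv (h \<otimes> g)) (act h x) = act (inv g \<otimes> inv h) (act h x)"
      using g h by (simp add: inv_mult_group)
    also have "\<dots> = act (inv g) (act (inv h) (act h x))"
      using g h hx by (simp add: composition_rule)
    finally show "indicator C (h \<otimes> g) * F (act (inv (h \<otimes> g)) (act h x)) = indicator C (h \<otimes> g) * F (act (inv g) x)"
      using act_inv[OF h x] by simp
  qed
  finally show ?thesis .
qed

text \<open>By \<open>smear_translate\<close> the group variable \<open>h\<close> enters only
  through the indicator of the set of pairs \<open>(h, g)\<close> with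
  \<open>h \<otimes> g \<in> C\<close>. For a rectangle in place of this set the integral is an
  indicator in \<open>h\<close> times an average over a fixed set, hence measurable for
  \<open>BG \<Otimes>\<^sub>M B\<close>. Induction over the product sigma-algebra reaches all
  measurable sets of pairs.\<close>

lemma smear_joint_measurable:
  assumes F[measurable]: "F \<in> borel_measurable M" and K: "\<And>x. \<bar>F x\<bar> \<le> K"
    and spB: "space B = space M"
    and B: "\<And>C. C \<in> sets m \<Longrightarrow> emeasure m C < \<infinity> \<Longrightarrow> smear C F \<in> borel_measurable B"
    and C[measurable]: "C \<in> sets m" "emeasure m C < \<infinity>"
  shows "(\<lambda>w. smear C F (act (fst w) (snd w))) \<in> borel_measurable (BG \<Otimes>\<^sub>M B)"
proof -
  have FO: "(\<lambda>g. F (act (inv g) x)) \<in> borel_measurable m" if "x \<in> space M" for x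
    by (rule measurable_compose[OF orbit_measurable'[OF that] F])
  obtain E where E: "range E \<subseteq> sets m" "(\<Union>i. E i) = space m" "\<And>i. emeasure m (E i) \<noteq> \<infinity>" "incseq E"
    using haar.sigma_finite_incseq by blast
  have Em[measurable]: "E n \<in> sets m" and Efin: "emeasure m (E n) < \<infinity>" for n
    using E(1,3) by (auto simp: less_top)
  \<comment> \<open>Sections of a general \<open>W\<close> may have infinite Haar measure; the
    cut-offs \<open>E n\<close> keep the integrals finite and are removed in the limit at the
    end.\<close>
  define J where "J n W w = (\<integral>g. indicator (E n) g * (indicator W (fst w, g) * F (act (inv g) (snd w))) \<partial>m)"
    for n and W :: "('g \<times> 'g) set" and w :: "'g \<times> 'x"
  have sec: "(\<lambda>g. indicator W (h, g) * F (act (inv g) x)) \<in> borel_measurable m"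
    if W: "W \<in> sets (BG \<Otimes>\<^sub>M BG)" and h: "h \<in> carrier G" and x: "x \<in> space M" for W h x
  proof -
    have "(indicator W :: 'g \<times> 'g \<Rightarrow> real) \<in> borel_measurable (BG \<Otimes>\<^sub>M BG)" using W by simp
    from measurable_compose[OF measurable_Pair1'[of h BG] this] h space_BG
    have "(\<lambda>g. indicator W (h, g) :: real) \<in> borel_measurable m"
      by (simp add: measurable_cong_sets[OF sets_m refl])
    with FO[OF x] show ?thesis by measurable
  qed
  have bd: "\<bar>indicator W w * F x\<bar> \<le> K" for W and w :: "'g \<times> 'g" and x
    using K[of x] by (auto split: split_indicator intro: order_trans[OF abs_ge_zero])
  have J_m: "J n W \<in> borel_measurable (BG \<Otimes>\<^sub>M B)" if W: "W \<in> sets (BG \<Otimes>\<^sub>M BG)" for n W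
  proof -
    have ws: "fst w \<in> carrier G" "snd w \<in> space M" if "w \<in> space (BG \<Otimes>\<^sub>M B)" for w
      using that spB space_BG by (auto simp: space_pair_measure)
    have "W \<in> sigma_sets (space BG \<times> space BG) {a \<times> b |a b. a \<in> sets BG \<and> b \<in> sets BG}"
      using W by (simp add: sets_pair_measure)
    with Int_stable_pair_measure_generator pair_measure_closed show ?thesis
    proof (induction rule: sigma_sets_induct_disjoint)
      case (basic W)
      then obtain a b where ab: "W = a \<times> b" "a \<in> sets BG" "b \<in> sets BG" by blast
      have "b \<in> sets m" unfolding sets_m by (rule ab(3))
      then have b: "b \<inter> E n \<in> sets m" using Em by (rule sets.Int)
      have "emeasure m (b \<inter> E n) \<le> emeasure m (E n)" by (rule emeasure_mono[OF Int_lower2 Em])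
      then have bf: "emeasure m (b \<inter> E n) < \<infinity>" using Efin[of n] by (rule le_less_trans)
      have "J n W w = indicator a (fst w) * smear (b \<inter> E n) F (snd w)" if "w \<in> space (BG \<Otimes>\<^sub>M B)" for w
      proof -
        have "J n W w = (\<integral>g. indicator a (fst w) * (indicator (b \<inter> E n) g * F (act (inv g) (snd w))) \<partial>m)"
          unfolding J_def ab(1) by (rule Bochner_Integration.integral_cong) (auto split: split_indicator)
        then show ?thesis using ws[OF that] by (simp add: smear_def)
      qed
      moreover have "(\<lambda>w. indicator a (fst w) * smear (b \<inter> E n) F (snd w)) \<in> borel_measurable (BG \<Otimes>\<^sub>M B)"
        using B[OF b bf] ab(2) by measurable
      ultimately show ?case by (subst measurable_cong) auto
    next
      case empty
      show ?case unfolding J_def by simp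
    next
      case (compl W)
      have W: "W \<in> sets (BG \<Otimes>\<^sub>M BG)" using compl.hyps by (simp add: sets_pair_measure)
      have "J n (space BG \<times> space BG - W) w = smear (E n) F (snd w) - J n W w" if "w \<in> space (BG \<Otimes>\<^sub>M B)" for w
      proof -
        note ws' = ws[OF that]
        have "J n (space BG \<times> space BG - W) w =
            (\<integral>g. indicator (E n) g * F (act (inv g) (snd w)) - indicator (E n) g * (indicator W (fst w, g) * F (act (inv g) (snd w))) \<partial>m)"
          unfolding J_def using ws' space_m space_BG
          by (intro Bochner_Integration.integral_cong) (auto split: split_indicator)
        also have "\<dots> = (\<integral>g. indicator (E n) g * F (act (inv g) (snd w)) \<partial>m) - J n W w"
          unfolding J_def
          by (intro Bochner_Integration.integral_diff integrable_cut[OF Em Efin, where K = K] FO sec W ws' bd K)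
        finally show ?thesis using ws' by (simp add: smear_def)
      qed
      moreover have "(\<lambda>w. smear (E n) F (snd w) - J n W w) \<in> borel_measurable (BG \<Otimes>\<^sub>M B)"
        using B[OF Em Efin] compl.IH by measurable
      ultimately show ?case by (subst measurable_cong) auto
    next
      case (union Wf)
      have Wf: "Wf i \<in> sets (BG \<Otimes>\<^sub>M BG)" for i using union.hyps(2) by (auto simp: sets_pair_measure)
      define U where "U k = (\<Union>i<k. Wf i)" for k :: nat
      have Um: "U k \<in> sets (BG \<Otimes>\<^sub>M BG)" for k unfolding U_def using Wf by auto
      have sumJ: "J n (U k) w = (\<Sum>i<k. J n (Wf i) w)" if "w \<in> space (BG \<Otimes>\<^sub>M B)" for k w
      proof -
        note ws' = ws[OF that]
        have "indicator (U k) v = (\<Sum>i<k. indicator (Wf i) v :: real)" for v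
          unfolding U_def using union.hyps(1)
          by (intro indicator_UN_disjoint) (auto simp: disjoint_family_on_def)
        then have "indicator (E n) g * (indicator (U k) (fst w, g) * F (act (inv g) (snd w))) =
            (\<Sum>i<k. indicator (E n) g * (indicator (Wf i) (fst w, g) * F (act (inv g) (snd w))))" for g
          by (simp only: sum_distrib_left sum_distrib_right)
        then have "J n (U k) w = (\<integral>g. (\<Sum>i<k. indicator (E n) g * (indicator (Wf i) (fst w, g) * F (act (inv g) (snd w)))) \<partial>m)"
          unfolding J_def by (simp only:)
        also have "\<dots> = (\<Sum>i<k. J n (Wf i) w)"
          unfolding J_def
          by (intro Bochner_Integration.integral_sum integrable_cut[OF Em Efin, where K = K] sec Wf ws' bd)
        finally show ?thesis .
      qed
      have Uk: "J n (U k) \<in> borel_measurable (BG \<Otimes>\<^sub>M B)" for k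
      proof -
        have "(\<lambda>w. \<Sum>i<k. J n (Wf i) w) \<in> borel_measurable (BG \<Otimes>\<^sub>M B)"
          using union.IH by (intro borel_measurable_sum)
        then show ?thesis using sumJ by (subst measurable_cong) auto
      qed
      show ?case
      proof (rule borel_measurable_LIMSEQ_real[OF _ Uk])
        fix w assume w: "w \<in> space (BG \<Otimes>\<^sub>M B)"
        note ws' = ws[OF w]
        show "(\<lambda>k. J n (U k) w) \<longlonglongrightarrow> J n (\<Union> (range Wf)) w"
          unfolding J_def
        proof (rule integral_dominated_convergence[where w = "\<lambda>g. \<bar>K\<bar> * indicator (E n) g"])
          show "integrable m (\<lambda>g. \<bar>K\<bar> * indicator (E n) g)" using Em Efin by (intro integrable_mult_right) auto
          have "\<Union> (range Wf) \<in> sets (BG \<Otimes>\<^sub>M BG)" using Wf by auto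
          from sec[OF this ws'] show "(\<lambda>g. indicator (E n) g * (indicator (\<Union> (range Wf)) (fst w, g) * F (act (inv g) (snd w)))) \<in> borel_measurable m"
            by measurable
          show "(\<lambda>g. indicator (E n) g * (indicator (U k) (fst w, g) * F (act (inv g) (snd w)))) \<in> borel_measurable m" for k
            using sec[OF Um ws'] by measurable
          show "AE g in m. norm (indicator (E n) g * (indicator (U k) (fst w, g) * F (act (inv g) (snd w)))) \<le> \<bar>K\<bar> * indicator (E n) g" for k
          proof (rule AE_I2)
            fix g
            have "\<bar>indicator (U k) (fst w, g) * F (act (inv g) (snd w))\<bar> \<le> \<bar>K\<bar>"
              using bd[of "U k" "(fst w, g)" "act (inv g) (snd w)"] by linarith
            then show "norm (indicator (E n) g * (indicator (U k) (fst w, g) * F (act (inv g) (snd w)))) \<le> \<bar>K\<bar> * indicator (E n) g"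
              by (auto split: split_indicator)
          qed
          show "AE g in m. (\<lambda>k. indicator (E n) g * (indicator (U k) (fst w, g) * F (act (inv g) (snd w)))) \<longlonglongrightarrow>
              indicator (E n) g * (indicator (\<Union> (range Wf)) (fst w, g) * F (act (inv g) (snd w)))"
          proof (rule AE_I2, intro tendsto_intros)
            fix g
            have "(\<lambda>k. indicator (\<Union>i<k. Wf i) v :: real) \<longlonglongrightarrow> indicator (\<Union>i. Wf i) v" for v
              by (rule LIMSEQ_indicator_UN)
            then show "(\<lambda>k. indicator (U k) (fst w, g) :: real) \<longlonglongrightarrow> indicator (\<Union> (range Wf)) (fst w, g)"
              unfolding U_def .
          qed
        qed
      qed
    qed
  qed
  define W where "W = {w \<in> space (BG \<Otimes>\<^sub>M BG). fst w \<otimes> snd w \<in> C}"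
  have CB[measurable]: "C \<in> sets BG" using C(1) sets_m by simp
  have Wm: "W \<in> sets (BG \<Otimes>\<^sub>M BG)" unfolding W_def by measurable
  show ?thesis
  proof (rule borel_measurable_LIMSEQ_real[OF _ J_m[OF Wm]])
    fix w assume w: "w \<in> space (BG \<Otimes>\<^sub>M B)"
    have ws: "fst w \<in> carrier G" "snd w \<in> space M"
      using w spB space_BG by (auto simp: space_pair_measure)
    have tr[measurable]: "(\<lambda>g. fst w \<otimes> g) \<in> measurable m m" by (rule translate_measurable[OF ws(1)])
    define C' where "C' = (\<lambda>g. fst w \<otimes> g) -` C \<inter> space m"
    have C'm: "C' \<in> sets m" unfolding C'_def by measurable
    have "emeasure m C' = emeasure (distr m m (\<lambda>g. fst w \<otimes> g)) C"
      unfolding C'_def by (rule emeasure_distr[symmetric]) measurable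
    also have "\<dots> = emeasure m C" using haar ws(1) unfolding left_haar_measure_def by metis
    finally have C'f: "emeasure m C' < \<infinity>" using C(2) by simp
    have indC: "indicator W (fst w, g) = (indicator C' g :: real)" "indicator C (fst w \<otimes> g) = (indicator C' g :: real)"
      if "g \<in> space m" for g
      using that ws space_m space_BG unfolding W_def C'_def by (auto simp: space_pair_measure indicator_def)
    have JW: "J n W w = (\<integral>g. indicator (E n) g * (indicator C' g * F (act (inv g) (snd w))) \<partial>m)" for n
      unfolding J_def by (rule Bochner_Integration.integral_cong) (simp_all add: indC)
    have lim: "smear C F (act (fst w) (snd w)) = (\<integral>g. indicator C' g * F (act (inv g) (snd w)) \<partial>m)"
      unfolding smear_translate[OF C(1) F ws]
      by (rule Bochner_Integration.integral_cong) (simp_all add: indC)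
    show "(\<lambda>n. J n W w) \<longlonglongrightarrow> smear C F (act (fst w) (snd w))"
      unfolding JW lim
    proof (rule integral_dominated_convergence[where w = "\<lambda>g. \<bar>indicator C' g * F (act (inv g) (snd w))\<bar>"])
      note [measurable] = C'm FO[OF ws(2)]
      show "integrable m (\<lambda>g. \<bar>indicator C' g * F (act (inv g) (snd w))\<bar>)"
        by (rule integrable_abs[OF integrable_cut[OF C'm C'f FO[OF ws(2)] K]])
      show "(\<lambda>g. indicator C' g * F (act (inv g) (snd w))) \<in> borel_measurable m" by measurable
      show "(\<lambda>g. indicator (E n) g * (indicator C' g * F (act (inv g) (snd w)))) \<in> borel_measurable m" for n
        by measurable
      show "AE g in m. norm (indicator (E n) g * (indicator C' g * F (act (inv g) (snd w)))) \<le> \<bar>indicator C' g * F (act (inv g) (snd w))\<bar>" for n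
        by (auto split: split_indicator)
      show "AE g in m. (\<lambda>n. indicator (E n) g * (indicator C' g * F (act (inv g) (snd w)))) \<longlonglongrightarrow> indicator C' g * F (act (inv g) (snd w))"
      proof (rule AE_I2)
        fix g assume "g \<in> space m"
        then obtain N where "g \<in> E N" using E(2) by auto
        then have "g \<in> E n" if "n \<ge> N" for n using E(4) that unfolding incseq_def by blast
        then show "(\<lambda>n. indicator (E n) g * (indicator C' g * F (act (inv g) (snd w)))) \<longlonglongrightarrow> indicator C' g * F (act (inv g) (snd w))"
          by (intro tendsto_eventually) (auto simp: eventually_sequentially intro!: exI[of _ N])
      qed
    qed
  qed
qed

end

context disintegrated
begin

lemma AE_fibre_set_mod_null:
  assumes a: "a \<in> sets A" and null: "(S - a) \<union> (a - S) \<in> null_sets M"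
  shows "AE x in M. AE z in \<kappa> x. z \<in> S \<longleftrightarrow> x \<in> S"
proof -
  have "AE x in M. x \<notin> (S - a) \<union> (a - S)" using null by (rule AE_not_in)
  then have 1: "AE x in M. x \<in> S \<longleftrightarrow> x \<in> a" by eventually_elim blast
  have 2: "AE x in M. AE z in \<kappa> x. (indicator a z :: real) = indicator a x"
    by (rule AE_fibre_const) (use a in simp)
  show ?thesis
    using 1 2 AE_fibre[OF 1]
  proof eventually_elim
    case (elim x)
    from elim(2,3) show ?case
      by eventually_elim (use elim(1) in \<open>auto simp: indicator_eq_0_iff indicator_eq_1_iff split: split_indicator_asm\<close>)
  qed
qed

text \<open>Almost every fibre lies entirely on one side of each rational level of \<open>u\<close>,
  up to fibre null sets. Rational levels separate values, so \<open>u\<close> is constant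
  there.\<close>

lemma avg_eq_if_sets_mod_null:
  fixes u :: "'x \<Rightarrow> real"
  assumes u[measurable]: "u \<in> borel_measurable M"
    and ex: "\<And>q. \<exists>a\<in>sets A. ({x \<in> space M. q < u x} - a) \<union> (a - {x \<in> space M. q < u x}) \<in> null_sets M"
  shows "AE x in M. avg u x = u x"
proof -
  have "AE x in M. \<forall>q\<in>\<rat>. AE z in \<kappa> x. z \<in> {x \<in> space M. q < u x} \<longleftrightarrow> x \<in> {x \<in> space M. q < u x}"
    using ex AE_fibre_set_mod_null countable_rat by (subst AE_ball_countable) blast+
  then show ?thesis
    using AE_space
  proof eventually_elim
    case (elim x)
    interpret p: prob_space "\<kappa> x" by (rule prob_fibre[OF elim(2)])
    have "AE z in \<kappa> x. \<forall>q\<in>\<rat>. z \<in> {x \<in> space M. q < u x} \<longleftrightarrow> x \<in> {x \<in> space M. q < u x}"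
      using elim(1) countable_rat by (subst AE_ball_countable) blast+
    then have "AE z in \<kappa> x. u z = u x"
      using AE_space[of "\<kappa> x"]
    proof eventually_elim
      case (elim z)
      have zx: "z \<in> space M" "x \<in> space M" using elim(2) space_fibre[OF \<open>x \<in> space M\<close>] \<open>x \<in> space M\<close> by auto
      show ?case
      proof (rule ccontr)
        assume "u z \<noteq> u x"
        then consider "u z < u x" | "u x < u z" by linarith
        then show False
        proof cases
          case 1
          then obtain q where "q \<in> \<rat>" "u z < q" "q < u x" using Rats_dense_in_real by blast
          then show False using elim(1) zx by auto
        next
          case 2
          then obtain q where "q \<in> \<rat>" "u x < q" "q < u z" using Rats_dense_in_real by blast
          then show False using elim(1) zx by auto
        qed
      qed
    qed
    then have "(\<integral>z. u z \<partial>\<kappa> x) = (\<integral>z. u x \<partial>\<kappa> x)"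
      by (intro integral_cong_AE measurable_fibre[OF elim(2) u]) simp_all
    then show ?case unfolding avg_def by (simp add: p.prob_space)
  qed
qed

end

section \<open>A proper extension obtained from an invariant kernel\<close>

locale haar_factor = haar_action G T X m + disintegrated "gmeas X" A \<kappa>
  for G :: "('g, 'mm) monoid_scheme" (structure) and T :: "'g topology"
    and X :: "('g, 'x) gspace" and m :: "'g measure" and A \<kappa> +
  assumes adm: "admissible A"
begin

sublocale factor_action "gmeas X" A \<kappa> "gact X" "carrier G"
  by unfold_locales (use act_mpres admissible_act[OF adm] in auto)

lemma automorphism:
  assumes "g \<in> carrier G"
  shows "disintegrated_automorphism M A \<kappa> (act g) (act (inv g))"
  by unfold_locales (use assms sb act_mpres admissible_act[OF adm] act_inv in auto)

text \<open>An invariant kernel commutes with translations, hence with their averages.\<close>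

lemma smear_kop:
  fixes H :: "'x \<times> 'x \<Rightarrow> real"
  assumes C: "C \<in> sets m" "emeasure m C < \<infinity>"
    and H[measurable]: "H \<in> borel_measurable (M \<Otimes>\<^sub>M M)" and HC: "\<And>w. \<bar>H w\<bar> \<le> c"
    and inv: "\<And>g. g \<in> carrier G \<Longrightarrow> AE w in joint. H (act g (fst w), act g (snd w)) = H w"
    and f[measurable]: "f \<in> borel_measurable M" and fb: "\<And>x. \<bar>f x\<bar> \<le> b"
    and F[measurable]: "F \<in> borel_measurable M" and FH: "\<And>x. x \<in> space M \<Longrightarrow> F x = kop H f x"
  shows "AE x in M. smear C F x = kop H (smear C f) x"
proof -
  \<comment> \<open>Equivariance holds for every \<open>g\<close> and almost every \<open>x\<close>.
    Joint measurability of the identity is what permits Fubini to exchange this for almost every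
    \<open>x\<close> and almost every \<open>g\<close>.\<close>
  have P: "Measurable.pred (m \<Otimes>\<^sub>M M) (\<lambda>w. F (act (inv (fst w)) (snd w)) = (\<integral>z. H (snd w, z) * f (act (inv (fst w)) z) \<partial>\<kappa> (snd w)))"
  proof -
    have m1: "(\<lambda>w. F (act (inv (fst w)) (snd w))) \<in> borel_measurable (m \<Otimes>\<^sub>M M)"
      by (rule measurable_compose[OF orbit_measurable F])
    have m2: "(\<lambda>w. \<integral>z. H (snd w, z) * f (act (inv (fst w)) z) \<partial>\<kappa> (snd w)) \<in> borel_measurable (m \<Otimes>\<^sub>M M)"
    proof (rule integral_measurable_kernel)
      have "(\<lambda>v. (fst (fst v), snd v)) \<in> measurable ((m \<Otimes>\<^sub>M M) \<Otimes>\<^sub>M M) (m \<Otimes>\<^sub>M M)" by measurable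
      from measurable_compose[OF this measurable_compose[OF orbit_measurable f]]
      have [measurable]: "(\<lambda>v. f (act (inv (fst (fst v))) (snd v))) \<in> borel_measurable ((m \<Otimes>\<^sub>M M) \<Otimes>\<^sub>M M)" by simp
      have "(\<lambda>v. (snd (fst v), snd v)) \<in> measurable ((m \<Otimes>\<^sub>M M) \<Otimes>\<^sub>M M) (M \<Otimes>\<^sub>M M)" by measurable
      from measurable_compose[OF this H]
      have [measurable]: "(\<lambda>v. H (snd (fst v), snd v)) \<in> borel_measurable ((m \<Otimes>\<^sub>M M) \<Otimes>\<^sub>M M)" .
      have "(\<lambda>v. H (snd (fst v), snd v) * f (act (inv (fst (fst v))) (snd v))) \<in> borel_measurable ((m \<Otimes>\<^sub>M M) \<Otimes>\<^sub>M M)"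
        by measurable
      then show "(\<lambda>(w, z). H (snd w, z) * f (act (inv (fst w)) z)) \<in> borel_measurable ((m \<Otimes>\<^sub>M M) \<Otimes>\<^sub>M M)"
        by (simp add: split_beta')
      show "(\<lambda>w. \<kappa> (snd w)) \<in> measurable (m \<Otimes>\<^sub>M M) (subprob_algebra M)"
        by (rule measurable_compose[OF measurable_snd kernel_sub_M])
    qed
    show ?thesis using borel_measurable_eq[OF m1 m2] by (simp add: pred_def)
  qed
  have "AE x in M. F (act (inv g) x) = (\<integral>z. H (x, z) * f (act (inv g) z) \<partial>\<kappa> x)" if g: "g \<in> carrier G" for g
    using disintegrated_automorphism.kop_equivariant[OF automorphism[OF inv_closed[OF g]] H f inv[OF inv_closed[OF g]]] AE_space
  proof eventually_elim
    case (elim x)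
    then show ?case using FH[OF act_space[OF inv_closed[OF g] elim(2)]] by (simp add: kop_def)
  qed
  then have "AE x in M. AE g in m. F (act (inv g) x) = (\<integral>z. H (x, z) * f (act (inv g) z) \<partial>\<kappa> x)"
    using sections_null[OF P] by simp
  then show ?thesis
    using AE_space
  proof eventually_elim
    case (elim x)
    note x = elim(2)
    interpret p: prob_space "\<kappa> x" by (rule prob_fibre[OF x])
    interpret pp: pair_sigma_finite m "\<kappa> x" ..
    have mk: "measurable (m \<Otimes>\<^sub>M \<kappa> x) borel = (measurable (m \<Otimes>\<^sub>M M) borel :: ('g \<times> 'x \<Rightarrow> real) set)"
      by (rule measurable_cong_sets[OF sets_pair_measure_cong[OF refl sets_fibre[OF x]] refl])
    have fO: "(\<lambda>w. H (x, snd w) * f (act (inv (fst w)) (snd w))) \<in> borel_measurable (m \<Otimes>\<^sub>M \<kappa> x)"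
      unfolding mk using measurable_compose[OF orbit_measurable f]
        measurable_compose[OF measurable_snd measurable_section[OF x H]] by measurable
    have bd: "\<bar>H (x, snd w) * f (act (inv (fst w)) (snd w))\<bar> \<le> c * b" for w by (rule abs_mult_le[OF HC fb])
    have i: "integrable (m \<Otimes>\<^sub>M \<kappa> x) (\<lambda>(g, z). indicator C g * (H (x, z) * f (act (inv g) z)))"
      using integrable_cut_pair[OF C prob_fibre[OF x] fO bd] by simp
    have "smear C F x = (\<integral>g. indicator C g * F (act (inv g) x) \<partial>m)" using x by (simp add: smear_def)
    also have "\<dots> = (\<integral>g. (\<integral>z. indicator C g * (H (x, z) * f (act (inv g) z)) \<partial>\<kappa> x) \<partial>m)"
    proof (rule integral_cong_AE)
      show "(\<lambda>g. \<integral>z. indicator C g * (H (x, z) * f (act (inv g) z)) \<partial>\<kappa> x) \<in> borel_measurable m"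
        using i by (intro p.borel_measurable_lebesgue_integral) (auto simp: split_beta')
      show "(\<lambda>g. indicator C g * F (act (inv g) x)) \<in> borel_measurable m"
        using C measurable_compose[OF orbit_measurable'[OF x] F] by measurable
      show "AE g in m. indicator C g * F (act (inv g) x) = (\<integral>z. indicator C g * (H (x, z) * f (act (inv g) z)) \<partial>\<kappa> x)"
        using elim(1) by eventually_elim simp
    qed
    also have "\<dots> = (\<integral>z. (\<integral>g. indicator C g * (H (x, z) * f (act (inv g) z)) \<partial>m) \<partial>\<kappa> x)"
      by (rule pp.Fubini_integral[OF i, symmetric])
    also have "\<dots> = kop H (smear C f) x"
      unfolding kop_def
    proof (rule Bochner_Integration.integral_cong[OF refl])
      fix z assume "z \<in> space (\<kappa> x)"
      then have "z \<in> space M" by (simp add: space_fibre[OF x])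
      moreover have "(\<integral>g. indicator C g * (H (x, z) * f (act (inv g) z)) \<partial>m) =
          (\<integral>g. H (x, z) * (indicator C g * f (act (inv g) z)) \<partial>m)"
        by (rule Bochner_Integration.integral_cong) (simp_all add: mult.left_commute)
      ultimately show "(\<integral>g. indicator C g * (H (x, z) * f (act (inv g) z)) \<partial>m) = H (x, z) * smear C f z"
        by (simp add: smear_def)
    qed
    finally show ?case .
  qed
qed

text \<open>Conditional expectation is the kernel operator with constant kernel 1, and this kernel
  is invariant.\<close>

lemma smear_avg:
  assumes C: "C \<in> sets m" "emeasure m C < \<infinity>" and F[measurable]: "F \<in> borel_measurable M" and K: "\<And>x. \<bar>F x\<bar> \<le> K"
  shows "AE x in M. avg (smear C F) x = (\<integral>g. indicator C g * avg F (act (inv g) x) \<partial>m)"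
proof -
  have kop_one: "kop (\<lambda>_. 1) f = avg f" for f unfolding kop_def avg_def by simp
  have "AE x in M. smear C (avg F) x = kop (\<lambda>_. 1) (smear C F) x"
    by (rule smear_kop[OF C, where c = 1, OF _ _ _ F K avg_measurable[OF F]]) (simp_all add: kop_one)
  then show ?thesis
    using AE_space by eventually_elim (simp add: kop_one smear_def)
qed

text \<open>Every translate of \<open>smear C F\<close> is the image under \<open>H\<close> of a
  translate of \<open>smear C f\<close>, and these translates share one bound.\<close>

lemma smear_almost_periodic:
  fixes H :: "'x \<times> 'x \<Rightarrow> real"
  assumes C: "C \<in> sets m" "emeasure m C < \<infinity>"
    and H: "H \<in> borel_measurable (M \<Otimes>\<^sub>M M)" and HC: "\<And>w. \<bar>H w\<bar> \<le> c"
    and inv: "\<And>g. g \<in> carrier G \<Longrightarrow> AE w in joint. H (act g (fst w), act g (snd w)) = H w"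
    and f: "f \<in> borel_measurable M" and fb: "\<And>x. \<bar>f x\<bar> \<le> b"
    and F: "F \<in> borel_measurable M" and FH: "\<And>x. x \<in> space M \<Longrightarrow> F x = kop H f x" and FK: "\<And>x. \<bar>F x\<bar> \<le> K"
  shows "almost_periodic (smear C F)"
proof (rule almost_periodic_kernel[where f = "\<lambda>g x. smear C f (act g x)", OF H HC])
  show "smear C F \<in> borel_measurable M" by (rule smear_measurable[OF C(1) F])
  show "\<bar>smear C F x\<bar> \<le> \<bar>K\<bar> * measure m C" for x by (rule smear_bound[OF C F FK])
  show "\<bar>smear C f (act g x)\<bar> \<le> \<bar>b\<bar> * measure m C" for g x by (rule smear_bound[OF C f fb])
  fix g assume g: "g \<in> carrier G"
  show "(\<lambda>x. smear C f (act g x)) \<in> borel_measurable M"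
    by (rule measurable_compose[OF act_mpres(1)[OF g] smear_measurable[OF C(1) f]])
  have "AE x in M. smear C F (act g x) = kop H (smear C f) (act g x)"
    by (rule AE_act[OF g smear_kop[OF C H HC inv f fb F FH]])
  moreover have "AE x in M. kop H (smear C f) (act g x) = kop H (\<lambda>z. smear C f (act g z)) x"
    by (rule disintegrated_automorphism.kop_equivariant[OF automorphism[OF g] H smear_measurable[OF C(1) f] inv[OF g]])
  ultimately show "AE x in M. smear C F (act g x) = kop H (\<lambda>z. smear C f (act g z)) x"
    by eventually_elim simp
qed

text \<open>The deviation of \<open>F\<close> from its conditional expectation has integral 0 over
  every piece of almost every orbit. Testing on rectangles shows that it vanishes at
  \<open>act (inv g) x\<close> for almost every \<open>g\<close> in \<open>E\<close> and almost
  every \<open>x\<close>; translating back by one such \<open>g\<close> concludes.\<close>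

lemma avg_eq_if_smear:
  assumes F[measurable]: "F \<in> borel_measurable M" and K: "\<And>x. \<bar>F x\<bar> \<le> K"
    and sm: "\<And>C. C \<in> sets m \<Longrightarrow> emeasure m C < \<infinity> \<Longrightarrow> AE x in M. avg (smear C F) x = smear C F x"
  shows "AE x in M. avg F x = F x"
proof -
  \<comment> \<open>Finite, so that integrals over rectangles determine the function; of positive
    measure, so that an almost-everywhere statement on \<open>E\<close> yields an actual group
    element.\<close>
  obtain E where E: "E \<in> sets m" "emeasure m E < \<infinity>" "emeasure m E \<noteq> 0"
  proof -
    obtain E :: "nat \<Rightarrow> 'g set" where E: "range E \<subseteq> sets m" "(\<Union>i. E i) = space m" "\<And>i. emeasure m (E i) \<noteq> \<infinity>"
      using haar.sigma_finite by metis
    have "\<exists>i. emeasure m (E i) \<noteq> 0"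
    proof (rule ccontr)
      assume "\<not> ?thesis"
      then have "(\<Union>i. E i) \<in> null_sets m" using E(1) by (intro null_sets_UN) (auto simp: null_sets_def)
      then show False using E(2) haar unfolding left_haar_measure_def by auto
    qed
    then show ?thesis using that E(1,3) by (metis infinity_ennreal_def less_top rangeI subsetD)
  qed
  define mE where "mE = density m (indicator E)"
  have sets_mE[measurable_cong]: "sets mE = sets m" unfolding mE_def by simp
  interpret mE: finite_measure mE
    by (rule finite_measureI) (use E in \<open>auto simp: mE_def emeasure_density nn_integral_indicator sets.Int_space_eq2
        simp flip: indicator_inter_arith\<close>)
  interpret R: pair_sigma_finite mE M ..
  have fR: "finite_measure (mE \<Otimes>\<^sub>M M)"
    by (intro finite_measure_pair_measure mE.finite_measure_axioms X.finite_measure_axioms)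
  then interpret R2: finite_measure "mE \<Otimes>\<^sub>M M" .
  define F0 where "F0 x = (if x \<in> space M then F x - avg F x else 0)" for x
  have [measurable]: "avg F \<in> borel_measurable M" by (rule avg_measurable[OF F])
  have F0[measurable]: "F0 \<in> borel_measurable M" unfolding F0_def by measurable
  have F0K: "\<bar>F0 x\<bar> \<le> 2 * K" for x
  proof (cases "x \<in> space M")
    case True
    have "\<bar>avg F x\<bar> \<le> K" by (rule avg_bound[OF F K True])
    then show ?thesis using K[of x] True unfolding F0_def by simp
  next
    case False
    have "0 \<le> K" using K[of x] by linarith
    with False show ?thesis unfolding F0_def by simp
  qed
  define k where "k w = F0 (act (inv (fst w)) (snd w))" for w
  have k_m: "k \<in> borel_measurable (m \<Otimes>\<^sub>M M)"
    unfolding k_def by (rule measurable_compose[OF orbit_measurable F0])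
  have mR: "measurable (mE \<Otimes>\<^sub>M M) borel = (measurable (m \<Otimes>\<^sub>M M) borel :: ('g \<times> 'x \<Rightarrow> real) set)"
    by (rule measurable_cong_sets[OF sets_pair_measure_cong[OF sets_mE refl] refl])
  have "AE w in mE \<Otimes>\<^sub>M M. k w = 0"
  proof (rule AE_zero_if_rectangle_integrals_zero[OF refl fR])
    show kR: "k \<in> borel_measurable (mE \<Otimes>\<^sub>M M)" unfolding mR by (rule k_m)
    show "\<bar>k w\<bar> \<le> 2 * K" for w unfolding k_def by (rule F0K)
    fix C D assume "C \<in> sets mE" and D[measurable]: "D \<in> sets M"
    then have C[measurable]: "C \<in> sets m" using sets_mE by simp
    define C' where "C' = E \<inter> C"
    have C': "C' \<in> sets m" unfolding C'_def using E(1) C by auto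
    have "emeasure m C' \<le> emeasure m E" unfolding C'_def by (rule emeasure_mono[OF Int_lower1 E(1)])
    then have C'f: "emeasure m C' < \<infinity>" using E(2) by (rule le_less_trans)
    have kb: "\<bar>k w * indicator (C \<times> D) w\<bar> \<le> 2 * K * 1" for w
      unfolding k_def by (rule abs_mult_le[OF F0K]) (auto split: split_indicator)
    have kCD: "(\<lambda>w. k w * indicator (C \<times> D) w) \<in> borel_measurable (mE \<Otimes>\<^sub>M M)"
      using kR C D sets_mE by (intro borel_measurable_times borel_measurable_indicator pair_measureI) auto
    have i: "integrable (mE \<Otimes>\<^sub>M M) (\<lambda>w. k w * indicator (C \<times> D) w)"
      by (rule R2.integrable_const_bound[OF _ kCD, where B = "2 * K * 1"]) (use kb in auto)
    have zero: "AE x in M. (\<integral>g. indicator C' g * k (g, x) \<partial>m) = 0"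
      using sm[OF C' C'f] smear_avg[OF C' C'f F K] AE_space
    proof eventually_elim
      case (elim x)
      note x = elim(3)
      have g: "act (inv g) x \<in> space M" if "g \<in> space m" for g using that x space_m act_space by simp
      have "(\<integral>g. indicator C' g * k (g, x) \<partial>m) =
          (\<integral>g. indicator C' g * F (act (inv g) x) - indicator C' g * avg F (act (inv g) x) \<partial>m)"
        unfolding k_def F0_def using g by (intro Bochner_Integration.integral_cong) (auto simp: right_diff_distrib)
      also have "\<dots> = (\<integral>g. indicator C' g * F (act (inv g) x) \<partial>m) - (\<integral>g. indicator C' g * avg F (act (inv g) x) \<partial>m)"
      proof (rule Bochner_Integration.integral_diff)
        show "integrable m (\<lambda>g. indicator C' g * F (act (inv g) x))"
          by (rule integrable_cut[OF C' C'f measurable_compose[OF orbit_measurable'[OF x] F] K])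
        show "integrable m (\<lambda>g. indicator C' g * avg F (act (inv g) x))"
          by (rule integrable_cut[OF C' C'f measurable_compose[OF orbit_measurable'[OF x] avg_measurable[OF F]]])
            (rule avg_bound[OF F K g])
      qed
      also have "\<dots> = smear C' F x - avg (smear C' F) x" using elim(2) x by (simp add: smear_def)
      also have "\<dots> = 0" using elim(1) by simp
      finally show ?case .
    qed
    have "(\<integral>w. k w * indicator (C \<times> D) w \<partial>(mE \<Otimes>\<^sub>M M)) = (\<integral>x. (\<integral>g. k (g, x) * indicator (C \<times> D) (g, x) \<partial>mE) \<partial>M)"
      using R.integral_snd[of "\<lambda>g x. k (g, x) * indicator (C \<times> D) (g, x)"] i by (simp add: split_beta')
    also have "\<dots> = (\<integral>x. 0 \<partial>M)"
    proof (rule integral_cong_AE)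
      have "(\<lambda>w. k (snd w, fst w) * indicator (C \<times> D) (snd w, fst w)) \<in> borel_measurable (M \<Otimes>\<^sub>M mE)"
        using measurable_compose[OF measurable_pair_swap'[of M mE] kCD] by (simp add: split_beta')
      then show "(\<lambda>x. \<integral>g. k (g, x) * indicator (C \<times> D) (g, x) \<partial>mE) \<in> borel_measurable M"
        by (intro mE.borel_measurable_lebesgue_integral) (simp add: split_beta')
      show "AE x in M. (\<integral>g. k (g, x) * indicator (C \<times> D) (g, x) \<partial>mE) = 0"
        using zero AE_space
      proof eventually_elim
        case (elim x)
        have kx: "(\<lambda>g. k (g, x)) \<in> borel_measurable m"
          unfolding k_def using measurable_compose[OF orbit_measurable'[OF elim(2)] F0] by simp
        have "(\<integral>g. k (g, x) * indicator (C \<times> D) (g, x) \<partial>mE) = (\<integral>g. indicator D x * (k (g, x) * indicator C g) \<partial>mE)"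
          by (rule Bochner_Integration.integral_cong) (auto split: split_indicator)
        also have "\<dots> = indicator D x * (\<integral>g. k (g, x) * indicator C g \<partial>mE)" by simp
        also have "(\<integral>g. k (g, x) * indicator C g \<partial>mE) = (\<integral>g. indicator E g * (k (g, x) * indicator C g) \<partial>m)"
        proof -
          have "mE = density m (\<lambda>g. ennreal (indicator E g))" unfolding mE_def by (simp add: ennreal_indicator)
          then show ?thesis using kx C E(1) by (simp add: integral_density)
        qed
        also have "\<dots> = (\<integral>g. indicator C' g * k (g, x) \<partial>m)"
          unfolding C'_def by (rule Bochner_Integration.integral_cong) (auto split: split_indicator)
        finally show ?case using elim(1) by simp
      qed
    qed simp
    finally show "(\<integral>w. k w * indicator (C \<times> D) w \<partial>(mE \<Otimes>\<^sub>M M)) = 0" by simp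
  qed
  then have AEg: "AE g in mE. AE x in M. k (g, x) = 0" by (rule R.AE_pair)
  have "\<not> (AE g in mE. False)"
  proof
    assume "AE g in mE. False"
    then have "emeasure mE (space mE) = 0" by (simp add: AE_iff_null null_sets_def) 
    moreover have "emeasure mE (space mE) = emeasure m E"
      unfolding mE_def using E(1) by (simp add: emeasure_density sets.Int_space_eq2 flip: indicator_inter_arith)
    ultimately show False using E(3) by simp
  qed
  moreover have "AE g in mE. False" if no: "\<not> (\<exists>g\<in>space mE. AE x in M. k (g, x) = 0)"
    using AEg AE_space by eventually_elim (use no in blast)
  ultimately have "\<exists>g\<in>space mE. AE x in M. k (g, x) = 0" by blast
  then obtain g where g: "g \<in> carrier G" "AE x in M. k (g, x) = 0"
    using space_m unfolding mE_def by auto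
  have "AE x in M. F0 (act (inv g) (act g x)) = 0"
    using AE_act[OF g(1) g(2)] unfolding k_def by simp
  then show ?thesis
    using AE_space by eventually_elim (simp add: act_inv[OF g(1)] F0_def)
qed

text \<open>If every set of the new sigma-algebra agreed with one of \<open>A\<close> modulo null
  sets, all averages of \<open>H * f\<close> would come from \<open>A\<close>, and by
  \<open>avg_eq_if_smear\<close> so would \<open>H * f\<close>, against \<open>new\<close>.\<close>

theorem compact_extension:
  fixes H :: "'x \<times> 'x \<Rightarrow> real"
  assumes H: "H \<in> borel_measurable (M \<Otimes>\<^sub>M M)" and HC: "\<And>w. \<bar>H w\<bar> \<le> c"
    and inv: "\<And>g. g \<in> carrier G \<Longrightarrow> AE w in joint. H (act g (fst w), act g (snd w)) = H w"
    and f: "f \<in> borel_measurable M" and fb: "\<And>x. \<bar>f x\<bar> \<le> b"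
    and new: "\<not> (AE x in M. avg (kop H f) x = kop H f x)"
  obtains B where "admissible B" "sets A \<subseteq> sets B"
    "\<And>u. u \<in> borel_measurable B \<Longrightarrow> integrable M (\<lambda>x. (u x)\<^sup>2) \<Longrightarrow> ap_limit B u"
    "\<exists>S\<in>sets B. \<forall>a\<in>sets A. (S - a) \<union> (a - S) \<notin> null_sets M"
proof -
  define F where "F x = (if x \<in> space M then kop H f x else 0)" for x
  have F: "F \<in> borel_measurable M"
    unfolding F_def using kop_measurable[OF H f] by measurable
  have FH: "F x = kop H f x" if "x \<in> space M" for x using that by (simp add: F_def)
  have FK: "\<bar>F x\<bar> \<le> \<bar>c * b\<bar>" for x
    using kop_bound[OF H f HC fb, of x] by (auto simp: F_def)
  define \<Phi> where "\<Phi> = {smear C F | C. C \<in> sets m \<and> emeasure m C < \<infinity>}"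
  have \<Phi>: "almost_periodic \<phi>" if "\<phi> \<in> \<Phi>" for \<phi>
    using that smear_almost_periodic[OF _ _ H HC inv f fb F FH FK] unfolding \<Phi>_def by blast
  define B where "B = sigma (space M) (sets A \<union> {{x \<in> space M. c < \<phi> x} | \<phi> c. \<phi> \<in> \<Phi>})"
  note dense = ap_limit_dense[OF B_def \<Phi>]
  have sB: "subalgebra M B" by (rule dense(1))
  have spB: "space B = space M" using sB unfolding subalgebra_def by blast
  have AB: "sets A \<subseteq> sets B" by (rule dense(2))
  have sm_B: "smear C F \<in> borel_measurable B" if "C \<in> sets m" "emeasure m C < \<infinity>" for C
    by (rule dense(3)) (use that in \<open>auto simp: \<Phi>_def\<close>)
  have adm_B: "admissible B"
    unfolding admissible_def
  proof (intro conjI sB)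
    let ?G = "sets A \<union> {{x \<in> space M. c < \<phi> x} | \<phi> c. \<phi> \<in> \<Phi>}"
    have GP: "?G \<subseteq> Pow (space M)" using sets.space_closed[of A] space_A by auto
    have setsB: "sets B = sigma_sets (space M) ?G" unfolding B_def using GP by (simp add: sets_measure_of)
    have spw: "fst w \<in> carrier G" "snd w \<in> space M" if "w \<in> space (BG \<Otimes>\<^sub>M B)" for w
      using that spB space_BG by (auto simp: space_pair_measure)
    show "(\<lambda>w. act (fst w) (snd w)) \<in> measurable (BG \<Otimes>\<^sub>M B) B"
    proof (rule measurable_sigma_sets[OF setsB GP])
      show "(\<lambda>w. act (fst w) (snd w)) \<in> space (BG \<Otimes>\<^sub>M B) \<rightarrow> space M"
        using spw act_space by blast
      fix S assume "S \<in> ?G"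
      then consider "S \<in> sets A" | \<phi> c where "\<phi> \<in> \<Phi>" "S = {x \<in> space M. c < \<phi> x}" by blast
      then show "(\<lambda>w. act (fst w) (snd w)) -` S \<inter> space (BG \<Otimes>\<^sub>M B) \<in> sets (BG \<Otimes>\<^sub>M B)"
      proof cases
        case 1
        have act_A': "(\<lambda>w. act (fst w) (snd w)) \<in> measurable (BG \<Otimes>\<^sub>M A) A"
          using adm unfolding admissible_def by (rule conjunct2)
        have "(\<lambda>x. x) \<in> measurable B A"
        proof (rule measurableI)
          fix a assume a: "a \<in> sets A"
          have "(\<lambda>x. x) -` a \<inter> space B = a"
            using sets.sets_into_space[OF a] unfolding spB space_A by blast
          then show "(\<lambda>x. x) -` a \<inter> space B \<in> sets B" using a AB by auto
        qed (simp add: spB space_A)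
        then have "(\<lambda>w. (fst w, snd w)) \<in> measurable (BG \<Otimes>\<^sub>M B) (BG \<Otimes>\<^sub>M A)"
          by (intro measurable_Pair measurable_fst measurable_compose[OF measurable_snd])
        from measurable_sets[OF measurable_compose[OF this act_A'] 1] show ?thesis by simp
      next
        case 2
        then obtain C where C: "C \<in> sets m" "emeasure m C < \<infinity>" "\<phi> = smear C F" unfolding \<Phi>_def by blast
        have J: "(\<lambda>w. smear C F (act (fst w) (snd w))) \<in> borel_measurable (BG \<Otimes>\<^sub>M B)"
          by (rule smear_joint_measurable[OF F FK spB sm_B C(1,2)])
        have "(\<lambda>w. act (fst w) (snd w)) -` S \<inter> space (BG \<Otimes>\<^sub>M B) =
            {w \<in> space (BG \<Otimes>\<^sub>M B). c < smear C F (act (fst w) (snd w))}"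
          unfolding 2(2) C(3) using spw act_space by auto
        also have "\<dots> \<in> sets (BG \<Otimes>\<^sub>M B)" using J by measurable
        finally show ?thesis .
      qed
    qed
  qed
  have new_B: "\<exists>S\<in>sets B. \<forall>a\<in>sets A. (S - a) \<union> (a - S) \<notin> null_sets M"
  proof (rule ccontr)
    assume "\<not> ?thesis"
    then have no: "\<And>S. S \<in> sets B \<Longrightarrow> \<exists>a\<in>sets A. (S - a) \<union> (a - S) \<in> null_sets M" by blast
    have "AE x in M. avg F x = F x"
    proof (rule avg_eq_if_smear[OF F FK])
      fix C assume C: "C \<in> sets m" "emeasure m C < \<infinity>"
      show "AE x in M. avg (smear C F) x = smear C F x"
      proof (rule avg_eq_if_sets_mod_null[OF smear_measurable[OF C(1) F]])
        fix q
        have "{x \<in> space M. q < smear C F x} \<in> sets B"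
          using sm_B[OF C] unfolding spB[symmetric] by measurable
        then show "\<exists>a\<in>sets A. ({x \<in> space M. q < smear C F x} - a) \<union> (a - {x \<in> space M. q < smear C F x}) \<in> null_sets M"
          by (rule no)
      qed
    qed
    then have "AE x in M. avg (kop H f) x = kop H f x"
      using AE_space
    proof eventually_elim
      case (elim x)
      have "avg (kop H f) x = avg F x"
        unfolding avg_def by (rule Bochner_Integration.integral_cong) (simp_all add: FH space_fibre[OF elim(2)])
      then show ?case using elim FH by simp
    qed
    then show False using new by blast
  qed
  show ?thesis by (rule that[OF adm_B AB dense(4) new_B])
qed

end

section \<open>Transfinite towers of sigma-algebras\<close>

text \<open>The setting of the Zermelo and Bourbaki-Witt argument: the least family closed under
  \<open>S\<close> and under generated sigma-algebras is well ordered by inclusion, so it serves as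
  its own set of ordinals. \<open>S\<close> is inflationary but not assumed monotone, and this is
  what makes comparability of members nontrivial.\<close>

locale sigma_tower =
  fixes \<Omega> :: "'a set" and S :: "'a set set \<Rightarrow> 'a set set" and good :: "'a set set \<Rightarrow> bool"
  assumes good_alg: "good F \<Longrightarrow> sigma_algebra \<Omega> F"
    and good_lub: "(\<And>F. F \<in> N \<Longrightarrow> good F) \<Longrightarrow> good (sigma_sets \<Omega> (\<Union>N))"
    and good_S: "good F \<Longrightarrow> good (S F)"
    and inflationary: "good F \<Longrightarrow> F \<subseteq> S F"
begin

text \<open>The recursion starts from the empty family in \<open>lub\<close>, which yields the
  trivial sigma-algebra.\<close>

inductive_set tower :: "'a set set set" where
  step: "F \<in> tower \<Longrightarrow> S F \<in> tower"
| lub: "(\<forall>F\<in>N. F \<in> tower) \<Longrightarrow> sigma_sets \<Omega> (\<Union>N) \<in> tower"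

lemma tower_good: "F \<in> tower \<Longrightarrow> good F"
  by (induction rule: tower.induct) (blast intro: good_S good_lub)+

lemma lub_least: "F \<in> tower \<Longrightarrow> (\<And>E. E \<in> N \<Longrightarrow> E \<subseteq> F) \<Longrightarrow> sigma_sets \<Omega> (\<Union>N) \<subseteq> F"
  by (intro sigma_algebra.sigma_sets_subset[OF good_alg[OF tower_good]]) blast+

lemma lub_upper: "E \<in> N \<Longrightarrow> E \<subseteq> sigma_sets \<Omega> (\<Union>N)"
  by blast

lemma tower_S: "F \<in> tower \<Longrightarrow> F \<subseteq> S F"
  by (rule inflationary[OF tower_good])

text \<open>Comparison is proved first against a member \<open>F\<close> that no successor of a
  strictly smaller member jumps over. Induction on \<open>E\<close> then needs no monotonicity of
  \<open>S\<close>.\<close>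

lemma tower_compare_extreme:
  assumes F: "F \<in> tower" "\<And>E. E \<in> tower \<Longrightarrow> E \<subset> F \<Longrightarrow> S E \<subseteq> F" and E: "E \<in> tower"
  shows "E \<subseteq> F \<or> S F \<subseteq> E"
  using E
proof (induction rule: tower.induct)
  case (step E)
  then consider "E = F" | "E \<subset> F" | "S F \<subseteq> E" by blast
  then show ?case using F(2)[OF step.hyps] tower_S[OF step.hyps] by cases blast+
next
  case (lub N)
  show ?case
  proof (cases "\<forall>E\<in>N. E \<subseteq> F")
    case True
    then show ?thesis using lub_least[OF F(1), of N] by blast
  next
    case False
    then obtain E where "E \<in> N" "S F \<subseteq> E" using lub by blast
    then show ?thesis using lub_upper[of E N] by blast
  qed
qed

text \<open>Every member is extreme in this sense; the induction compares \<open>E\<close> with the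
  previous members by means of \<open>tower_compare_extreme\<close>.\<close>

lemma tower_extreme:
  assumes "F \<in> tower" "E \<in> tower" "E \<subset> F" shows "S E \<subseteq> F"
  using assms
proof (induction arbitrary: E rule: tower.induct)
  case (step F)
  have "E \<subseteq> F \<or> S F \<subseteq> E" by (rule tower_compare_extreme[OF step.hyps step.IH step.prems(1)])
  then consider "E = F" | "E \<subset> F" using step.prems(2) by blast
  then show ?case using step.IH[OF step.prems(1)] tower_S[OF step.hyps] by cases blast+
next
  case (lub N)
  have ext: "E' \<subseteq> n \<or> S n \<subseteq> E'" if "n \<in> N" "E' \<in> tower" for n E'
    by (rule tower_compare_extreme) (use lub.IH that in blast)+
  have "\<exists>n\<in>N. \<not> S n \<subseteq> E"
  proof (rule ccontr)
    assume "\<not> ?thesis"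
    then have "n \<subseteq> E" if "n \<in> N" for n using that tower_S lub.IH by blast
    then have "sigma_sets \<Omega> (\<Union>N) \<subseteq> E" by (rule lub_least[OF lub.prems(1)])
    then show False using lub.prems(2) by blast
  qed
  then obtain n where n: "n \<in> N" "\<not> S n \<subseteq> E" by blast
  then have "E \<subseteq> n" using ext lub.prems(1) by blast
  show ?case
  proof (cases "E = n")
    case True
    \<comment> \<open>When \<open>E\<close> is \<open>n\<close> itself, extremeness of
      \<open>n\<close> says nothing about \<open>S E\<close>. Comparing the whole join with
      \<open>n\<close> decides: it is not below \<open>n\<close>, since \<open>E\<close> is strictly
      smaller than it.\<close>
    have "sigma_sets \<Omega> (\<Union>N) \<in> tower" using lub.IH by (intro tower.lub) blast
    then show ?thesis using ext[OF n(1)] True lub.prems(2) by blast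
  next
    case False
    then show ?thesis using lub.IH n(1) lub.prems(1) \<open>E \<subseteq> n\<close> lub_upper[OF n(1)] by blast
  qed
qed

lemma tower_compare: "F \<in> tower \<Longrightarrow> E \<in> tower \<Longrightarrow> E \<subseteq> F \<or> S F \<subseteq> E"
  by (rule tower_compare_extreme) (auto intro: tower_extreme[THEN subsetD])

lemma tower_fixpoint_greatest:
  assumes F: "F \<in> tower" "S F = F" and E: "E \<in> tower" shows "E \<subseteq> F"
  using E
proof (induction rule: tower.induct)
  case (step E)
  then show ?case using tower_extreme[OF F(1) step.hyps] F(2) by (cases "E = F") blast+
next
  case (lub N)
  then show ?case by (intro lub_least[OF F(1)]) blast
qed

text \<open>The candidate is the join \<open>l\<close> of all lower bounds. Were it outside
  \<open>N\<close>, its successor would again be a lower bound, so \<open>l\<close> would be fixed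
  by \<open>S\<close> and hence the greatest member, equal to each element of
  \<open>N\<close>.\<close>

lemma tower_least_element:
  assumes N: "N \<subseteq> tower" "N \<noteq> {}" shows "\<exists>l\<in>N. \<forall>n\<in>N. l \<subseteq> n"
proof -
  define L where "L = {E \<in> tower. \<forall>n\<in>N. E \<subseteq> n}"
  define l where "l = sigma_sets \<Omega> (\<Union>L)"
  have lt: "l \<in> tower" unfolding l_def L_def by (rule tower.lub) blast
  have ln: "l \<subseteq> n" if "n \<in> N" for n
    unfolding l_def by (rule lub_least) (use that N in \<open>auto simp: L_def\<close>)
  have "l \<in> N"
  proof (rule ccontr)
    assume "l \<notin> N"
    then have "S l \<subseteq> n" if "n \<in> N" for n
      using that ln[OF that] N lt by (intro tower_extreme) auto
    then have "S l \<in> L" unfolding L_def using tower.step[OF lt] by blast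
    then have "S l \<subseteq> l" unfolding l_def by (rule lub_upper)
    then have "S l = l" using tower_S[OF lt] by blast
    moreover obtain n where "n \<in> N" using N by blast
    ultimately have "n = l" using tower_fixpoint_greatest[OF lt] ln N by blast
    then show False using \<open>n \<in> N\<close> \<open>l \<notin> N\<close> by blast
  qed
  then show ?thesis using ln by blast
qed

definition tower_rel :: "'a set set rel" where
  "tower_rel = {(E, F). E \<in> tower \<and> F \<in> tower \<and> E \<subseteq> F}"

definition tower_top :: "'a set set" where
  "tower_top = sigma_sets \<Omega> (\<Union>tower)"

lemma Field_tower_rel: "Field tower_rel = tower"
  unfolding Field_def tower_rel_def by blast

lemma underS_tower_rel: "F \<in> tower \<Longrightarrow> underS tower_rel F = {E \<in> tower. E \<subset> F}"
  unfolding underS_def tower_rel_def by blast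

lemma Well_order_tower_rel: "Well_order tower_rel"
proof -
  have lin: "Linear_order tower_rel"
    unfolding linear_order_on_def partial_order_on_def preorder_on_def Field_tower_rel
  proof (intro conjI)
    show "refl_on tower tower_rel" "trans tower_rel" "antisym tower_rel"
      unfolding refl_on_def trans_def antisym_def tower_rel_def by blast+
    show "tower_rel \<subseteq> tower \<times> tower" unfolding tower_rel_def by blast
    show "total_on tower tower_rel"
      unfolding total_on_def tower_rel_def using tower_compare tower_S by blast
  qed
  have "wf (tower_rel - Id)"
    unfolding wf_eq_minimal
  proof (intro allI impI)
    fix Q :: "'a set set set" and x assume x: "x \<in> Q"
    show "\<exists>z\<in>Q. \<forall>y. (y, z) \<in> tower_rel - Id \<longrightarrow> y \<notin> Q"
    proof (cases "x \<in> tower")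
      case True
      then obtain l where l: "l \<in> Q \<inter> tower" "\<forall>n\<in>Q \<inter> tower. l \<subseteq> n"
        using tower_least_element[of "Q \<inter> tower"] x by blast
      then show ?thesis unfolding tower_rel_def by blast
    next
      case False
      then show ?thesis using x unfolding tower_rel_def by blast
    qed
  qed
  with lin show ?thesis unfolding well_order_on_def by blast
qed

lemma wo_rel_tower: "wo_rel tower_rel"
  unfolding wo_rel_def by (rule Well_order_tower_rel)

lemma tower_top: "tower_top \<in> tower" "F \<in> tower \<Longrightarrow> F \<subseteq> tower_top"
  unfolding tower_top_def by (rule tower.lub, blast) (rule lub_upper)

lemma S_tower_top: "S tower_top = tower_top"
  using tower_top tower_S tower.step by blast

lemma ordinals_upto_tower: "ordinals_upto tower_rel tower_top"
  unfolding ordinals_upto_def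
proof (intro conjI ballI)
  show "Well_order tower_rel" by (rule Well_order_tower_rel)
  show "tower_top \<in> Field tower_rel" unfolding Field_tower_rel by (rule tower_top)
  fix F assume "F \<in> Field tower_rel"
  then show "(F, tower_top) \<in> tower_rel"
    unfolding Field_tower_rel using tower_top by (auto simp: tower_rel_def)
qed

lemma ord_zero_tower: "ord_zero tower_rel = {{}, \<Omega>}"
  unfolding ord_zero_def Field_tower_rel
proof (rule wo_rel.equals_minim[OF wo_rel_tower, symmetric])
  have eq: "sigma_sets \<Omega> (\<Union>{}) = {{}, \<Omega>}" by (simp add: sigma_sets_empty_eq)
  have "sigma_sets \<Omega> (\<Union>{}) \<in> tower" by (rule tower.lub) blast
  then show z: "{{}, \<Omega>} \<in> tower" unfolding eq .
  fix F assume F: "F \<in> tower"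
  have "sigma_sets \<Omega> (\<Union>{}) \<subseteq> F" by (rule lub_least[OF F]) blast
  then show "({{}, \<Omega>}, F) \<in> tower_rel" unfolding eq tower_rel_def using z F by blast
qed (simp add: Field_tower_rel)

text \<open>A fixed point of \<open>S\<close> is the greatest member, so below the top
  \<open>S\<close> strictly increases; by \<open>tower_extreme\<close> nothing lies strictly
  between.\<close>

lemma ord_succ_tower:
  assumes F: "F \<in> tower" "F \<noteq> tower_top" shows "ord_succ tower_rel F = S F"
  unfolding ord_succ_def
proof (rule wo_rel.equals_suc_AboveS[OF wo_rel_tower, symmetric])
  have "S F \<noteq> F"
  proof
    assume "S F = F"
    then have "tower_top \<subseteq> F" using tower_fixpoint_greatest[OF F(1) _ tower_top(1)] by blast
    then show False using F tower_top(2) by blast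
  qed
  then show "S F \<in> AboveS tower_rel {F}"
    unfolding AboveS_def Field_tower_rel using F(1) tower.step[OF F(1)] tower_S[OF F(1)]
    by (auto simp: tower_rel_def)
  fix E assume "E \<in> AboveS tower_rel {F}"
  then have E: "E \<in> tower" "F \<subset> E" unfolding AboveS_def Field_tower_rel by (auto simp: tower_rel_def)
  then show "(S F, E) \<in> tower_rel"
    unfolding tower_rel_def using tower_extreme[OF E(1) F(1) E(2)] tower.step[OF F(1)] by blast
qed (simp add: Field_tower_rel F)

text \<open>The clause that produced \<open>F\<close> need not show its kind: a step may leave its
  argument fixed, and a join may be attained by a member of \<open>N\<close>. In both situations the
  induction hypothesis for the earlier member applies.\<close>

lemma tower_cases:
  assumes "F \<in> tower"
  shows "(\<exists>E\<in>tower. E \<subset> F \<and> F = S E) \<or> F = sigma_sets \<Omega> (\<Union>{E \<in> tower. E \<subset> F})"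
  using assms
proof (induction rule: tower.induct)
  case (step F)
  show ?case
  proof (cases "S F = F")
    case True
    then show ?thesis using step.IH by simp
  next
    case False
    then show ?thesis using step.hyps tower_S[OF step.hyps] by blast
  qed
next
  case (lub N)
  let ?F = "sigma_sets \<Omega> (\<Union>N)"
  have Ft: "?F \<in> tower" using lub.IH by (intro tower.lub) blast
  show ?case
  proof (cases "?F \<in> N")
    case True
    then show ?thesis using lub.IH by blast
  next
    case False
    then have "N \<subseteq> {E \<in> tower. E \<subset> ?F}" using lub.IH lub_upper[of _ N] by blast
    then have "?F \<subseteq> sigma_sets \<Omega> (\<Union>{E \<in> tower. E \<subset> ?F})"
      by (intro sigma_sets_mono') blast
    moreover have "sigma_sets \<Omega> (\<Union>{E \<in> tower. E \<subset> ?F}) \<subseteq> ?F"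
      by (rule lub_least[OF Ft]) blast
    ultimately show ?thesis by blast
  qed
qed

lemma ord_limit_tower:
  assumes "ord_limit tower_rel F"
  shows "F \<in> tower" "F = sigma_sets \<Omega> (\<Union>(underS tower_rel F))"
proof -
  show F: "F \<in> tower" using assms unfolding ord_limit_def Field_tower_rel by blast
  have "\<not> (\<exists>E\<in>tower. E \<subset> F \<and> F = S E)"
  proof
    assume "\<exists>E\<in>tower. E \<subset> F \<and> F = S E"
    then obtain E where E: "E \<in> tower" "E \<subset> F" "F = S E" by blast
    then have "E \<noteq> tower_top" using tower_top(2)[OF F] by blast
    then have "ord_succ tower_rel E = F" using ord_succ_tower E by blast
    then show False using assms E underS_tower_rel[OF F] unfolding ord_limit_def by blast
  qed
  then show "F = sigma_sets \<Omega> (\<Union>(underS tower_rel F))"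
    unfolding underS_tower_rel[OF F] using tower_cases[OF F] by (elim disjE) (simp, assumption)
qed

end

section \<open>The structure theorem\<close>

context haar_action
begin

text \<open>All factors keep the points and the action of \<open>X\<close> and differ only in the
  sigma-algebra, so every factor map is the identity and the sigma-algebra itself can be the ordinal
  index.\<close>

definition factor_space :: "'x set set \<Rightarrow> ('g, 'x) gspace" where
  "factor_space F = \<lparr>gmeas = restr_to_subalg M (sigma (space M) F), gact = act\<rparr>"

text \<open>\<open>admissible\<close> for bare set systems, which are what the tower consists
  of.\<close>

definition good :: "'x set set \<Rightarrow> bool" where
  "good F \<longleftrightarrow> sigma_algebra (space M) F \<and> F \<subseteq> sets M \<and>
     (\<lambda>w. act (fst w) (snd w)) \<in> measurable (BG \<Otimes>\<^sub>M sigma (space M) F) (sigma (space M) F)"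

lemma gact_factor_space[simp]: "gact (factor_space F) = act"
  unfolding factor_space_def by simp

lemma goodD:
  assumes "good F"
  shows good_sets: "sets (sigma (space M) F) = F" and good_subalgebra: "subalgebra M (sigma (space M) F)"
proof -
  have alg: "sigma_algebra (space M) F" and FM: "F \<subseteq> sets M" using assms unfolding good_def by auto
  have FP: "F \<subseteq> Pow (space M)" using FM sets.space_closed by blast
  show s: "sets (sigma (space M) F) = F"
    using FP sigma_algebra.sigma_sets_eq[OF alg] by (simp add: sets_measure_of)
  show "subalgebra M (sigma (space M) F)"
    unfolding subalgebra_def s using FM FP by (simp add: space_measure_of)
qed

lemma space_factor_space[simp]: "space (gmeas (factor_space F)) = space M"
  unfolding factor_space_def by (simp add: space_restr_to_subalg)

lemma sets_factor_space: "good F \<Longrightarrow> sets (gmeas (factor_space F)) = F"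
  unfolding factor_space_def by (simp add: sets_restr_to_subalg good_subalgebra good_sets)

lemma emeasure_factor_space: "good F \<Longrightarrow> a \<in> F \<Longrightarrow> emeasure (gmeas (factor_space F)) a = emeasure M a"
  unfolding factor_space_def by (simp add: emeasure_restr_to_subalg good_subalgebra good_sets)

lemma sets_pullback:
  assumes "good F" "space (gmeas S) = space M"
  shows "sets (pullback S (\<lambda>x. x) (factor_space F)) = F"
proof -
  have "(\<lambda>a. (\<lambda>x. x) -` a \<inter> space M) ` F = F"
  proof -
    have "(\<lambda>x. x) -` a \<inter> space M = a" if "a \<in> F" for a
      using that assms(1) sets.sets_into_space unfolding good_def by blast
    then show ?thesis by (auto simp: image_iff)
  qed
  moreover have "sets (pullback S (\<lambda>x. x) (factor_space F)) = {(\<lambda>x. x) -` a \<inter> space M |a. a \<in> F}"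
    unfolding pullback_def assms(2)
    by (subst sets_vimage_algebra2) (use assms(1) sets_factor_space in auto)
  ultimately show ?thesis by (simp add: image_def Setcompr_eq_image)
qed

lemma space_pullback: "space (pullback S \<pi> Y) = space (gmeas S)"
  unfolding pullback_def by simp

lemma good_admissible:
  assumes F: "good F" and B: "space B = space M" "sets B = F"
  shows "admissible B"
proof -
  have BF: "sets B = sets (sigma (space M) F)" using B good_sets[OF F] by simp
  have "subalgebra M B" using F B unfolding subalgebra_def good_def by simp
  moreover have "measurable (BG \<Otimes>\<^sub>M B) B = measurable (BG \<Otimes>\<^sub>M sigma (space M) F) (sigma (space M) F)"
    by (rule measurable_cong_sets[OF sets_pair_measure_cong[OF refl BF] BF])
  ultimately show ?thesis using F unfolding admissible_def good_def by simp
qed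

lemma admissible_good:
  assumes "admissible B" shows "good (sets B)"
proof -
  have spB: "space B = space M" and sB: "sets B \<subseteq> sets M"
    using assms unfolding admissible_def subalgebra_def by auto
  have BF: "sets (sigma (space M) (sets B)) = sets B"
    unfolding spB[symmetric] by simp
  have "measurable (BG \<Otimes>\<^sub>M B) B = measurable (BG \<Otimes>\<^sub>M sigma (space M) (sets B)) (sigma (space M) (sets B))"
    by (rule measurable_cong_sets[OF sets_pair_measure_cong[OF refl BF[symmetric]] BF[symmetric]])
  moreover have "sigma_algebra (space M) (sets B)"
    unfolding spB[symmetric] by (rule sets.sigma_algebra_axioms)
  ultimately show ?thesis using assms sB unfolding good_def admissible_def by simp
qed

text \<open>Measurability of the action has to be checked only on generators, and each generator
  already belongs to a single member for which the action is jointly measurable.\<close>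

lemma good_lub:
  assumes N: "\<And>F. F \<in> N \<Longrightarrow> good F"
  shows "good (sigma_sets (space M) (\<Union>N))"
proof -
  let ?L = "sigma_sets (space M) (\<Union>N)"
  have NM: "\<Union>N \<subseteq> sets M" using N unfolding good_def by blast
  then have NP: "\<Union>N \<subseteq> Pow (space M)" using sets.space_closed by blast
  have alg: "sigma_algebra (space M) ?L" by (rule sigma_algebra_sigma_sets[OF NP])
  have LM: "?L \<subseteq> sets M" by (rule sets.sigma_sets_subset[OF NM])
  have LP: "?L \<subseteq> Pow (space M)" using LM sets.space_closed by blast
  have setsL: "sets (sigma (space M) ?L) = ?L"
    using LP sigma_algebra.sigma_sets_eq[OF alg] by (simp add: sets_measure_of)
  have spL: "space (sigma (space M) ?L) = space M" using LP by (simp add: space_measure_of)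
  have "(\<lambda>w. act (fst w) (snd w)) \<in> measurable (BG \<Otimes>\<^sub>M sigma (space M) ?L) (sigma (space M) ?L)"
  proof (rule measurable_sigma_sets[OF setsL NP])
    show "(\<lambda>w. act (fst w) (snd w)) \<in> space (BG \<Otimes>\<^sub>M sigma (space M) ?L) \<rightarrow> space M"
      using act_space spL space_BG by (auto simp: space_pair_measure)
    fix a assume "a \<in> \<Union>N"
    then obtain F where F: "F \<in> N" "a \<in> F" by blast
    note g = N[OF F(1)]
    have sF: "sets (sigma (space M) F) = F" "space (sigma (space M) F) = space M"
      using good_sets[OF g] good_subalgebra[OF g] unfolding subalgebra_def by auto
    have act: "(\<lambda>w. act (fst w) (snd w)) \<in> measurable (BG \<Otimes>\<^sub>M sigma (space M) F) (sigma (space M) F)"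
      using g unfolding good_def by blast
    have "(\<lambda>x. x) \<in> measurable (sigma (space M) ?L) (sigma (space M) F)"
    proof (rule measurableI)
      fix b assume "b \<in> sets (sigma (space M) F)"
      then have b: "b \<in> F" using sF by simp
      then have "(\<lambda>x. x) -` b \<inter> space (sigma (space M) ?L) = b"
        using g sets.sets_into_space unfolding spL good_def by blast
      then show "(\<lambda>x. x) -` b \<inter> space (sigma (space M) ?L) \<in> sets (sigma (space M) ?L)"
        using b F(1) setsL by auto
    qed (simp add: sF spL)
    then have "(\<lambda>w. (fst w, snd w)) \<in> measurable (BG \<Otimes>\<^sub>M sigma (space M) ?L) (BG \<Otimes>\<^sub>M sigma (space M) F)"
      by (intro measurable_Pair measurable_fst measurable_compose[OF measurable_snd])
    from measurable_sets[OF measurable_compose[OF this act], of a]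
    show "(\<lambda>w. act (fst w) (snd w)) -` a \<inter> space (BG \<Otimes>\<^sub>M sigma (space M) ?L) \<in> sets (BG \<Otimes>\<^sub>M sigma (space M) ?L)"
      using F(2) sF by simp
  qed
  then show ?thesis unfolding good_def using alg LM by blast
qed

lemma good_act:
  assumes "good F" "g \<in> carrier G" "a \<in> F" shows "act g -` a \<inter> space M \<in> F"
proof -
  have sF: "sets (sigma (space M) F) = F" "space (sigma (space M) F) = space M"
    using good_sets[OF assms(1)] good_subalgebra[OF assms(1)] unfolding subalgebra_def by auto
  have "admissible (sigma (space M) F)" by (rule good_admissible[OF assms(1) sF(2,1)])
  from measurable_sets[OF admissible_act[OF this assms(2)], of a] show ?thesis
    using assms(3) sF by simp
qed

lemma borel_gspace_factor:
  assumes F: "good F" shows "borel_gspace G T (factor_space F)"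
  unfolding borel_gspace_def gact_factor_space space_factor_space
proof (intro conjI ballI)
  let ?Y = "gmeas (factor_space F)"
  show "prob_space ?Y"
    unfolding factor_space_def using prob_space_restr_to_subalg[OF good_subalgebra[OF F] X.prob_space_axioms] by simp
  show "group_action G (space M) act" by (rule group_action_axioms)
  fix g assume g: "g \<in> carrier G"
  have m: "act g \<in> measurable ?Y ?Y"
  proof (rule measurableI)
    show "act g x \<in> space ?Y" if "x \<in> space ?Y" for x using that act_space[OF g] by simp
    show "act g -` a \<inter> space ?Y \<in> sets ?Y" if "a \<in> sets ?Y" for a
      using that good_act[OF F g] sets_factor_space[OF F] by simp
  qed
  show "mpres (act g) ?Y ?Y"
    unfolding mpres_def
  proof (intro conjI m measure_eqI)
    fix a assume "a \<in> sets (distr ?Y ?Y (act g))"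
    then have a: "a \<in> F" using sets_factor_space[OF F] by simp
    then have aM: "a \<in> sets M" using F unfolding good_def by blast
    have "emeasure (distr ?Y ?Y (act g)) a = emeasure ?Y (act g -` a \<inter> space M)"
      using a sets_factor_space[OF F] by (subst emeasure_distr[OF m]) auto
    also have "\<dots> = emeasure M (act g -` a \<inter> space M)"
      by (rule emeasure_factor_space[OF F good_act[OF F g a]])
    also have "\<dots> = emeasure (distr M M (act g)) a"
      by (rule emeasure_distr[OF act_mpres(1)[OF g] aM, symmetric])
    also have "\<dots> = emeasure ?Y a" using act_mpres(2)[OF g] emeasure_factor_space[OF F a] by simp
    finally show "emeasure (distr ?Y ?Y (act g)) a = emeasure ?Y a" .
  qed simp
next
  have YF: "sets (gmeas (factor_space F)) = sets (sigma (space M) F)"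
    using sets_factor_space[OF F] good_sets[OF F] by simp
  have "measurable (BG \<Otimes>\<^sub>M gmeas (factor_space F)) (gmeas (factor_space F)) =
      measurable (BG \<Otimes>\<^sub>M sigma (space M) F) (sigma (space M) F)"
    by (rule measurable_cong_sets[OF sets_pair_measure_cong[OF refl YF] YF])
  then show "(\<lambda>(g, x). act g x) \<in> measurable (BG \<Otimes>\<^sub>M gmeas (factor_space F)) (gmeas (factor_space F))"
    using F unfolding good_def by (simp add: split_beta')
qed

lemma factor_map_id:
  assumes S: "borel_gspace G T S" "space (gmeas S) = space M" "gact S = act"
    and F: "good F" and sub: "F \<subseteq> sets (gmeas S)"
    and em: "\<And>a. a \<in> F \<Longrightarrow> emeasure (gmeas S) a = emeasure M a"
  shows "factor_map G T S (\<lambda>x. x) (factor_space F)"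
  unfolding factor_map_def
proof (intro conjI ballI S(1) borel_gspace_factor[OF F])
  let ?Y = "gmeas (factor_space F)"
  have int: "(\<lambda>x. x) -` a \<inter> space (gmeas S) = a" if "a \<in> F" for a
    using that F sets.sets_into_space S(2) unfolding good_def by blast
  have m: "(\<lambda>x. x) \<in> measurable (gmeas S) ?Y"
  proof (rule measurableI)
    fix a assume "a \<in> sets ?Y"
    then have "a \<in> F" using sets_factor_space[OF F] by simp
    then show "(\<lambda>x. x) -` a \<inter> space (gmeas S) \<in> sets (gmeas S)" using int sub by auto
  qed (simp add: S(2))
  show "mpres (\<lambda>x. x) (gmeas S) ?Y"
    unfolding mpres_def
  proof (intro conjI m measure_eqI)
    fix a assume "a \<in> sets (distr (gmeas S) ?Y (\<lambda>x. x))"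
    then have a: "a \<in> F" using sets_factor_space[OF F] by simp
    have "emeasure (distr (gmeas S) ?Y (\<lambda>x. x)) a = emeasure (gmeas S) ((\<lambda>x. x) -` a \<inter> space (gmeas S))"
      using a sets_factor_space[OF F] by (intro emeasure_distr[OF m]) simp
    then show "emeasure (distr (gmeas S) ?Y (\<lambda>x. x)) a = emeasure ?Y a"
      using int[OF a] em[OF a] emeasure_factor_space[OF F a] by simp
  qed simp
qed (simp add: S(3))

lemma factor_map_X:
  assumes F: "good F" shows "factor_map G T X (\<lambda>x. x) (factor_space F)"
  by (rule factor_map_id[OF _ refl refl F])
    (use sys F in \<open>auto simp: standard_borel_gspace_def good_def\<close>)

lemma factor_map_factor:
  assumes F: "good F" and E: "good E" "E \<subseteq> F"
  shows "factor_map G T (factor_space F) (\<lambda>x. x) (factor_space E)"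
  by (rule factor_map_id[OF borel_gspace_factor[OF F] _ _ E(1)])
    (use E sets_factor_space[OF F] emeasure_factor_space[OF F] in auto)

lemma short_factors_series_factor:
  assumes F: "good F" and B: "space B = space M" "sets B = F'" "F \<subseteq> F'" "F' \<subseteq> sets M"
    and inv: "\<And>g a. g \<in> carrier G \<Longrightarrow> a \<in> F' \<Longrightarrow> act g -` a \<inter> space M \<in> F'"
  shows "short_factors_series G T X B (\<lambda>x. x) (factor_space F)"
  unfolding short_factors_series_def
  using sys factor_map_X[OF F] B inv sets_pullback[OF F refl] by (auto simp: subalgebra_def)

lemma restr_to_subalg_cong: "sets B = sets B' \<Longrightarrow> restr_to_subalg M B = restr_to_subalg M B'"
  unfolding restr_to_subalg_def by simp

lemma gmeas_factor_space:
  assumes "good F"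
  shows "gmeas (factor_space F) = restr_to_subalg M (pullback X (\<lambda>x. x) (factor_space F))"
proof -
  have "gmeas (factor_space F) = restr_to_subalg M (sigma (space M) F)" by (simp add: factor_space_def)
  also have "\<dots> = restr_to_subalg M (pullback X (\<lambda>x. x) (factor_space F))"
    by (rule restr_to_subalg_cong) (simp add: good_sets[OF assms] sets_pullback[OF assms refl])
  finally show ?thesis .
qed

text \<open>Links the kernels over a sub-sigma-algebra with the disintegration and the relative
  square of the definitions. The pulled-back sigma-algebra is used as \<open>A\<close> because
  \<open>disintegration\<close> conditions on it.\<close>

lemma factor_disintegration:
  assumes F: "good F"
  obtains \<kappa> where "haar_factor G T X m (pullback X (\<lambda>x. x) (factor_space F)) \<kappa>"
    "disintegration X (\<lambda>x. x) (factor_space F) \<kappa>"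
    "fibre_square (factor_space F) \<kappa> = disintegrated.joint M \<kappa>"
proof -
  let ?A = "pullback X (\<lambda>x. x) (factor_space F)"
  have A: "space ?A = space M" "sets ?A = F" using sets_pullback[OF F refl] by (simp_all add: space_pullback)
  have adm: "admissible ?A" by (rule good_admissible[OF F A])
  then have sub: "subalgebra M ?A" unfolding admissible_def by blast
  obtain \<kappa> where \<kappa>: "\<kappa> \<in> measurable ?A (prob_algebra M)"
    "\<And>a B. a \<in> sets ?A \<Longrightarrow> B \<in> sets M \<Longrightarrow>
       (\<integral>\<^sup>+x. emeasure (\<kappa> x) B * indicator a x \<partial>M) = emeasure M (a \<inter> B)"
    using X.disintegration_kernel_exists[OF sb sub] by blast
  have hf: "haar_factor G T X m ?A \<kappa>"
    by unfold_locales (use sub \<kappa> adm in auto)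
  then interpret H: haar_factor G T X m ?A \<kappa> .
  have Y: "gmeas (factor_space F) = restr_to_subalg M ?A" by (rule gmeas_factor_space[OF F])
  have "\<kappa> \<in> measurable (gmeas (factor_space F)) (prob_algebra M)"
    unfolding Y by (rule measurable_in_subalg[OF sub \<kappa>(1)])
  then have "disintegration X (\<lambda>x. x) (factor_space F) \<kappa>"
    unfolding disintegration_def using H.cond_exp_fibre by blast
  moreover have "fibre_square (factor_space F) \<kappa> = H.joint"
    unfolding fibre_square_def Y by (rule H.joint_eq_bind_pair[symmetric])
  ultimately show ?thesis using that hf by blast
qed

end

section \<open>Passage to complex FK almost periodic functions and complex invariant kernels\<close>

context haar_factor
begin

text \<open>A null set of the factor must be covered by a null set of its own sigma-algebra; this is
  where measurability of \<open>P\<close> for \<open>A\<close> enters.\<close>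

lemma AE_restr:
  assumes P: "Measurable.pred A P" and AE: "AE y in M. P y"
  shows "AE y in restr_to_subalg M A. P y"
proof -
  have "{y \<in> space A. \<not> P y} \<in> sets A" using P by measurable
  then have N: "{y \<in> space M. \<not> P y} \<in> sets A" unfolding space_A .
  then have "{y \<in> space M. \<not> P y} \<in> null_sets M"
    using AE AE_iff_null[OF sets_A[OF N]] by blast
  then have "{y \<in> space M. \<not> P y} \<in> null_sets (restr_to_subalg M A)"
    unfolding null_sets_restr_to_subalg[OF sub] using N by simp
  then show ?thesis by (rule AE_I') (auto simp: space_restr_to_subalg)
qed

lemma FK_almost_periodic_complex:
  assumes Y: "gmeas Y = restr_to_subalg M A"
    and \<phi>: "almost_periodic \<phi>1" "almost_periodic \<phi>2"
  shows "FK_almost_periodic G X Y \<kappa> (\<lambda>x. Complex (\<phi>1 x) (\<phi>2 x))"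
  unfolding FK_almost_periodic_def
proof (intro allI impI)
  fix \<epsilon> :: real assume \<epsilon>: "\<epsilon> > 0"
  then have e2: "\<epsilon>\<^sup>2 / 2 > 0" by simp
  obtain \<Psi>1 where \<Psi>1: "finite \<Psi>1" "\<And>\<psi>. \<psi> \<in> \<Psi>1 \<Longrightarrow> \<psi> \<in> borel_measurable M \<and> bounded_fun \<psi>"
    "\<And>g. g \<in> carrier G \<Longrightarrow> AE y in M. \<exists>\<psi>\<in>\<Psi>1. sqdist (\<lambda>x. \<phi>1 (act g x)) \<psi> y < \<epsilon>\<^sup>2 / 2"
    using almost_periodicD(3)[OF \<phi>(1) e2] by blast
  obtain \<Psi>2 where \<Psi>2: "finite \<Psi>2" "\<And>\<psi>. \<psi> \<in> \<Psi>2 \<Longrightarrow> \<psi> \<in> borel_measurable M \<and> bounded_fun \<psi>"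
    "\<And>g. g \<in> carrier G \<Longrightarrow> AE y in M. \<exists>\<psi>\<in>\<Psi>2. sqdist (\<lambda>x. \<phi>2 (act g x)) \<psi> y < \<epsilon>\<^sup>2 / 2"
    using almost_periodicD(3)[OF \<phi>(2) e2] by blast
  \<comment> \<open>The zero function guarantees the nonempty set that \<open>Min\<close> needs.
    Real and imaginary parts contribute \<open>\<epsilon>\<^sup>2 / 2\<close> each to the squared
    norm.\<close>
  define \<Psi> where "\<Psi> = insert (\<lambda>_. 0) ((\<lambda>(\<psi>1, \<psi>2) x. Complex (\<psi>1 x) (\<psi>2 x)) ` (\<Psi>1 \<times> \<Psi>2))"
  have fin: "finite \<Psi>" "\<Psi> \<noteq> {}" unfolding \<Psi>_def using \<Psi>1(1) \<Psi>2(1) by auto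
  have "(\<lambda>x. Complex (\<psi>1 x) (\<psi>2 x)) \<in> L2 M" if "\<psi>1 \<in> \<Psi>1" "\<psi>2 \<in> \<Psi>2" for \<psi>1 \<psi>2
  proof -
    have [measurable]: "\<psi>1 \<in> borel_measurable M" "\<psi>2 \<in> borel_measurable M" using that \<Psi>1(2) \<Psi>2(2) by auto
    have "(\<lambda>x. Complex (\<psi>1 x) (\<psi>2 x)) \<in> borel_measurable M"
      unfolding Complex_eq by measurable
    moreover have "integrable M (\<lambda>x. (\<psi>1 x)\<^sup>2 + (\<psi>2 x)\<^sup>2)"
      using that \<Psi>1(2) \<Psi>2(2) by (intro Bochner_Integration.integrable_add integrable_sq_bounded) auto
    ultimately show ?thesis unfolding L2_def by (simp add: cmod_power2)
  qed
  moreover have "(\<lambda>_. 0) \<in> L2 M" unfolding L2_def by simp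
  ultimately have L2: "\<Psi> \<subseteq> L2 M" unfolding \<Psi>_def by auto
  have "AE y in gmeas Y. (MIN \<psi>\<in>\<Psi>. fibre_norm \<kappa> y (\<lambda>x. Complex (\<phi>1 (act g x)) (\<phi>2 (act g x)) - \<psi> x)) < \<epsilon>"
    if g: "g \<in> carrier G" for g
  proof -
    note [measurable] = measurable_act[OF g almost_periodicD(1)[OF \<phi>(1)]] measurable_act[OF g almost_periodicD(1)[OF \<phi>(2)]]
    have p: "Measurable.pred A (\<lambda>y. \<exists>\<psi>\<in>\<Psi>. sqdist u \<psi> y < c)"
      if "finite \<Psi>" "\<And>\<psi>. \<psi> \<in> \<Psi> \<Longrightarrow> \<psi> \<in> borel_measurable M" "u \<in> borel_measurable M" for \<Psi> u c
    proof (rule pred_intros_finite(4)[OF that(1)])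
      fix \<psi> assume "\<psi> \<in> \<Psi>"
      then show "Measurable.pred A (\<lambda>y. sqdist u \<psi> y < c)"
        using sqdist_measurable[OF that(3) that(2)] by measurable
    qed
    have a1: "AE y in gmeas Y. \<exists>\<psi>\<in>\<Psi>1. sqdist (\<lambda>x. \<phi>1 (act g x)) \<psi> y < \<epsilon>\<^sup>2 / 2"
      unfolding Y by (rule AE_restr[OF p \<Psi>1(3)[OF g]]) (use \<Psi>1 measurable_act[OF g almost_periodicD(1)[OF \<phi>(1)]] in auto)
    have a2: "AE y in gmeas Y. \<exists>\<psi>\<in>\<Psi>2. sqdist (\<lambda>x. \<phi>2 (act g x)) \<psi> y < \<epsilon>\<^sup>2 / 2"
      unfolding Y by (rule AE_restr[OF p \<Psi>2(3)[OF g]]) (use \<Psi>2 measurable_act[OF g almost_periodicD(1)[OF \<phi>(2)]] in auto)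
    show ?thesis
      using a1 a2 AE_space
    proof eventually_elim
      case (elim y)
      then obtain \<psi>1 \<psi>2 where \<psi>: "\<psi>1 \<in> \<Psi>1" "\<psi>2 \<in> \<Psi>2" "sqdist (\<lambda>x. \<phi>1 (act g x)) \<psi>1 y < \<epsilon>\<^sup>2 / 2"
        "sqdist (\<lambda>x. \<phi>2 (act g x)) \<psi>2 y < \<epsilon>\<^sup>2 / 2" by blast
      have y: "y \<in> space M" using elim(3) unfolding Y by (simp add: space_restr_to_subalg)
      interpret p: prob_space "\<kappa> y" by (rule prob_fibre[OF y])
      have b: "bounded_fun (\<lambda>x. \<phi>1 (act g x))" "bounded_fun (\<lambda>x. \<phi>2 (act g x))"
        using almost_periodicD(2)[OF \<phi>(1)] almost_periodicD(2)[OF \<phi>(2)] unfolding bounded_fun_def by blast+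
      have i: "integrable (\<kappa> y) (\<lambda>x. (\<phi>1 (act g x) - \<psi>1 x)\<^sup>2)" "integrable (\<kappa> y) (\<lambda>x. (\<phi>2 (act g x) - \<psi>2 x)\<^sup>2)"
        by (intro p.integrable_square_diff measurable_fibre[OF y] measurable_act[OF g]
            almost_periodicD(1)[OF \<phi>(1)] almost_periodicD(1)[OF \<phi>(2)] b;
          use \<psi> \<Psi>1(2) \<Psi>2(2) in blast)+
      have "(\<integral>x. (cmod (Complex (\<phi>1 (act g x)) (\<phi>2 (act g x)) - Complex (\<psi>1 x) (\<psi>2 x)))\<^sup>2 \<partial>\<kappa> y) =
          (\<integral>x. (\<phi>1 (act g x) - \<psi>1 x)\<^sup>2 + (\<phi>2 (act g x) - \<psi>2 x)\<^sup>2 \<partial>\<kappa> y)"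
        by (simp add: cmod_power2)
      also have "\<dots> = sqdist (\<lambda>x. \<phi>1 (act g x)) \<psi>1 y + sqdist (\<lambda>x. \<phi>2 (act g x)) \<psi>2 y"
        unfolding sqdist_def by (rule Bochner_Integration.integral_add[OF i])
      also have "\<dots> < \<epsilon>\<^sup>2" using \<psi>(3,4) by simp
      finally have "sqrt (\<integral>x. (cmod (Complex (\<phi>1 (act g x)) (\<phi>2 (act g x)) - Complex (\<psi>1 x) (\<psi>2 x)))\<^sup>2 \<partial>\<kappa> y) < sqrt (\<epsilon>\<^sup>2)"
        by (rule real_sqrt_less_mono)
      then have "fibre_norm \<kappa> y (\<lambda>x. Complex (\<phi>1 (act g x)) (\<phi>2 (act g x)) - Complex (\<psi>1 x) (\<psi>2 x)) < \<epsilon>"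
        unfolding fibre_norm_def using \<epsilon> by simp
      moreover have "(\<lambda>x. Complex (\<psi>1 x) (\<psi>2 x)) \<in> \<Psi>" unfolding \<Psi>_def using \<psi> by auto
      ultimately show ?case using fin by (subst Min_less_iff) auto
    qed
  qed
  then show "\<exists>\<Psi>. finite \<Psi> \<and> \<Psi> \<noteq> {} \<and> \<Psi> \<subseteq> L2 (gmeas X) \<and>
      (\<forall>g\<in>carrier G. AE y in gmeas Y. (MIN \<psi>\<in>\<Psi>. fibre_norm \<kappa> y (\<lambda>x. Complex (\<phi>1 (act g x)) (\<phi>2 (act g x)) - \<psi> x)) < \<epsilon>)"
    using fin L2 by blast
qed

lemma FK_dense:
  assumes Y: "gmeas Y = restr_to_subalg M A" and sB: "subalgebra M B"
    and dense: "\<And>u. u \<in> borel_measurable B \<Longrightarrow> integrable M (\<lambda>x. (u x)\<^sup>2) \<Longrightarrow> ap_limit B u"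
    and \<phi>: "\<phi> \<in> L2 (restr_to_subalg M B)" and \<epsilon>: "\<epsilon> > 0"
  shows "\<exists>\<psi>\<in>L2 (restr_to_subalg M B). FK_almost_periodic G X Y \<kappa> \<psi> \<and>
    sqrt (\<integral>x. (cmod (\<phi> x - \<psi> x))\<^sup>2 \<partial>M) < \<epsilon>"
proof -
  have mB: "measurable (restr_to_subalg M B) N = measurable B N" for N :: "'c measure"
    by (rule measurable_cong_sets[OF sets_restr_to_subalg[OF sB] refl])
  have \<phi>B[measurable]: "\<phi> \<in> borel_measurable B" and i0: "integrable (restr_to_subalg M B) (\<lambda>x. (cmod (\<phi> x))\<^sup>2)"
    using \<phi> unfolding L2_def by (auto simp: mB)
  have \<phi>M[measurable]: "\<phi> \<in> borel_measurable M" by (rule measurable_from_subalg[OF sB \<phi>B])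
  have i: "integrable M (\<lambda>x. (cmod (\<phi> x))\<^sup>2)" by (rule integrable_from_subalg[OF sB i0])
  have iR: "integrable M (\<lambda>x. (Re (\<phi> x))\<^sup>2)" "integrable M (\<lambda>x. (Im (\<phi> x))\<^sup>2)"
    by (rule Bochner_Integration.integrable_bound[OF i], measurable, simp add: cmod_power2)+
  have e2: "\<epsilon>\<^sup>2 / 2 > 0" using \<epsilon> by simp
  have "ap_limit B (\<lambda>x. Re (\<phi> x))" "ap_limit B (\<lambda>x. Im (\<phi> x))"
    by (intro dense iR; measurable)+
  then obtain \<phi>1 \<phi>2 where \<phi>1: "\<phi>1 \<in> borel_measurable B" "almost_periodic \<phi>1" "(\<integral>x. (Re (\<phi> x) - \<phi>1 x)\<^sup>2 \<partial>M) < \<epsilon>\<^sup>2 / 2"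
    and \<phi>2: "\<phi>2 \<in> borel_measurable B" "almost_periodic \<phi>2" "(\<integral>x. (Im (\<phi> x) - \<phi>2 x)\<^sup>2 \<partial>M) < \<epsilon>\<^sup>2 / 2"
    using e2 unfolding ap_limit_def by blast
  define \<psi> where "\<psi> x = Complex (\<phi>1 x) (\<phi>2 x)" for x
  note [measurable] = \<phi>1(1) \<phi>2(1)
  have \<psi>B: "\<psi> \<in> borel_measurable B" unfolding \<psi>_def Complex_eq by measurable
  have i\<phi>: "integrable M (\<lambda>x. (\<phi>1 x)\<^sup>2)" "integrable M (\<lambda>x. (\<phi>2 x)\<^sup>2)"
    using almost_periodicD(1,2)[OF \<phi>1(2)] almost_periodicD(1,2)[OF \<phi>2(2)] by (auto intro: integrable_sq_bounded)
  have "\<psi> \<in> L2 (restr_to_subalg M B)"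
  proof -
    have "integrable (restr_to_subalg M B) (\<lambda>x. (\<phi>1 x)\<^sup>2 + (\<phi>2 x)\<^sup>2)"
      by (rule integrable_in_subalg[OF sB]) (measurable, use i\<phi> in simp)
    then show ?thesis unfolding L2_def using \<psi>B by (simp add: mB \<psi>_def cmod_power2)
  qed
  moreover have "FK_almost_periodic G X Y \<kappa> \<psi>"
    unfolding \<psi>_def by (rule FK_almost_periodic_complex[OF Y \<phi>1(2) \<phi>2(2)])
  moreover have "sqrt (\<integral>x. (cmod (\<phi> x - \<psi> x))\<^sup>2 \<partial>M) < \<epsilon>"
  proof -
    have id: "integrable M (\<lambda>x. (Re (\<phi> x) - \<phi>1 x)\<^sup>2)" "integrable M (\<lambda>x. (Im (\<phi> x) - \<phi>2 x)\<^sup>2)"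
      by (intro integrable_sq_diff iR i\<phi>; use almost_periodicD(1)[OF \<phi>1(2)] almost_periodicD(1)[OF \<phi>2(2)] in measurable)+
    have "(\<integral>x. (cmod (\<phi> x - \<psi> x))\<^sup>2 \<partial>M) = (\<integral>x. (Re (\<phi> x) - \<phi>1 x)\<^sup>2 + (Im (\<phi> x) - \<phi>2 x)\<^sup>2 \<partial>M)"
      unfolding \<psi>_def by (simp add: cmod_power2)
    also have "\<dots> < \<epsilon>\<^sup>2" using \<phi>1(3) \<phi>2(3) id by simp
    finally have "sqrt (\<integral>x. (cmod (\<phi> x - \<psi> x))\<^sup>2 \<partial>M) < sqrt (\<epsilon>\<^sup>2)" by (rule real_sqrt_less_mono)
    then show ?thesis using \<epsilon> by simp
  qed
  ultimately show ?thesis by blast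
qed

text \<open>The invariant function is made real and bounded by applying \<open>arctan\<close> to its real and imaginary parts.\<close>

lemma invariant_on_factor:
  fixes H :: "'x \<times> 'x \<Rightarrow> complex"
  assumes H[measurable]: "H \<in> borel_measurable (M \<Otimes>\<^sub>M M)"
    and inv: "\<And>g. g \<in> carrier G \<Longrightarrow> AE w in joint. H (act g (fst w), act g (snd w)) = H w"
    and old: "\<And>K c f b. K \<in> borel_measurable (M \<Otimes>\<^sub>M M) \<Longrightarrow> (\<And>w. \<bar>K w\<bar> \<le> c) \<Longrightarrow>
      (\<And>g. g \<in> carrier G \<Longrightarrow> AE w in joint. K (act g (fst w), act g (snd w)) = K w) \<Longrightarrow>
      f \<in> borel_measurable M \<Longrightarrow> (\<And>x. \<bar>f x\<bar> \<le> b) \<Longrightarrow> AE x in M. avg (kop K f) x = kop K f x"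
  shows "\<exists>h\<in>borel_measurable A. AE w in joint. H w = h (fst w)"
proof -
  have real: "\<exists>h\<in>borel_measurable A. AE w in joint. K w = h (fst w)"
    if K[measurable]: "K \<in> borel_measurable (M \<Otimes>\<^sub>M M)" and Kc: "\<And>w. \<bar>K w\<bar> \<le> c"
      and Kinv: "\<And>g. g \<in> carrier G \<Longrightarrow> AE w in joint. K (act g (fst w), act g (snd w)) = K w"
    for K :: "'x \<times> 'x \<Rightarrow> real" and c
  proof -
    \<comment> \<open>\<open>kernel_on_factor\<close> also wants a marginal of the transposed
      kernel, which is invariant because the relative square is symmetric.\<close>
    let ?Kt = "\<lambda>w. K (snd w, fst w)"
    have Kt[measurable]: "?Kt \<in> borel_measurable (M \<Otimes>\<^sub>M M)" by measurable
    have Ktinv: "AE w in joint. ?Kt (act g (fst w), act g (snd w)) = ?Kt w" if g: "g \<in> carrier G" for g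
    proof -
      have [measurable]: "act g \<in> measurable M M" by (rule act_mpres(1)[OF g])
      have "Measurable.pred (M \<Otimes>\<^sub>M M) (\<lambda>w. K (act g (fst w), act g (snd w)) = K w)" by measurable
      from AE_joint_swap[OF this] Kinv[OF g] show ?thesis by simp
    qed
    have one: "\<bar>indicator D x :: real\<bar> \<le> 1" for D and x :: 'x by (auto split: split_indicator)
    have "AE w in joint. K w = avg (kop ?Kt (\<lambda>_. 1)) (fst w)"
    proof (rule kernel_on_factor[OF K Kc])
      show "AE x in M. avg (kop K (indicator D)) x = kop K (indicator D) x" if "D \<in> sets M" for D
        by (rule old[OF K Kc Kinv _ one]) (use that in simp_all)
      show "AE x in M. avg (kop ?Kt (\<lambda>_. 1)) x = kop ?Kt (\<lambda>_. 1) x"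
        by (rule old[OF Kt Kc Ktinv, of "\<lambda>_. 1" 1]) simp_all
    qed
    moreover have "avg (kop ?Kt (\<lambda>_. 1)) \<in> borel_measurable A" by measurable
    ultimately show ?thesis by blast
  qed
  have at: "\<bar>arctan t\<bar> \<le> 2" for t
    using arctan_bounded[of t] pi_less_4 by linarith
  have [measurable]: "(\<lambda>t. arctan t) \<in> borel_measurable borel"
    by (intro borel_measurable_continuous_onI continuous_intros)
  obtain h1 where h1[measurable]: "h1 \<in> borel_measurable A" and e1: "AE w in joint. arctan (Re (H w)) = h1 (fst w)"
    using real[of "\<lambda>w. arctan (Re (H w))" 2] at inv by (force elim: eventually_mono)
  obtain h2 where h2[measurable]: "h2 \<in> borel_measurable A" and e2: "AE w in joint. arctan (Im (H w)) = h2 (fst w)"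
    using real[of "\<lambda>w. arctan (Im (H w))" 2] at inv by (force elim: eventually_mono)
  define h where "h x = Complex (tan (h1 x)) (tan (h2 x))" for x
  have "h \<in> borel_measurable A" unfolding h_def Complex_eq tan_def by measurable
  moreover have "AE w in joint. H w = h (fst w)"
    using e1 e2
  proof eventually_elim
    case (elim w)
    then show ?case unfolding h_def by (metis complex_surj tan_arctan)
  qed
  ultimately show ?thesis by blast
qed

end

section \<open>Compact steps and the tower of factors\<close>

context haar_action
begin

definition compact_step :: "'x set set \<Rightarrow> 'x set set \<Rightarrow> bool" where
  "compact_step F F' \<longleftrightarrow> good F' \<and> F \<subseteq> F' \<and>
     nontrivial_extension (factor_space F') (\<lambda>x. x) (factor_space F) \<and>
     relatively_compact G T X (pullback X (\<lambda>x. x) (factor_space F')) (\<lambda>x. x) (factor_space F)"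

lemma compact_step_exists:
  assumes F: "good F"
    and not_mixing: "\<not> jointly_relatively_weak_mixing G T X M (\<lambda>x. x) (factor_space F)"
  shows "\<exists>F'. compact_step F F'"
proof -
  let ?A = "pullback X (\<lambda>x. x) (factor_space F)"
  have A: "space ?A = space M" "sets ?A = F" using sets_pullback[OF F refl] by (simp_all add: space_pullback)
  obtain \<kappa> where hf: "haar_factor G T X m ?A \<kappa>"
    and dis: "disintegration X (\<lambda>x. x) (factor_space F) \<kappa>"
    and fs: "fibre_square (factor_space F) \<kappa> = disintegrated.joint M \<kappa>"
    using factor_disintegration[OF F] .
  interpret H: haar_factor G T X m ?A \<kappa> by (rule hf)
  have Y: "gmeas (factor_space F) = restr_to_subalg M ?A" by (rule gmeas_factor_space[OF F])
  have mY: "measurable (gmeas (factor_space F)) N = measurable ?A N" for N :: "'c measure"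
    by (rule measurable_cong_sets) (simp_all add: sets_factor_space[OF F] A)
  have sfs: "short_factors_series G T X M (\<lambda>x. x) (factor_space F)"
    by (rule short_factors_series_factor[OF F refl refl])
      (use F act_mpres(1) in \<open>auto simp: good_def intro: measurable_sets\<close>)
  have mJ: "measurable (restr_to_subalg H.joint (M \<Otimes>\<^sub>M M)) N = measurable (M \<Otimes>\<^sub>M M) N" for N :: "'c measure"
  proof (rule measurable_cong_sets[OF sets_restr_to_subalg refl])
    show "subalgebra H.joint (M \<Otimes>\<^sub>M M)"
      unfolding subalgebra_def using H.sets_joint H.space_joint by (simp add: space_pair_measure)
  qed
  \<comment> \<open>Mixing asks for one suitable disintegration, so its failure may be exploited
    with the disintegration already at hand.\<close>
  obtain Hk where Hk: "Hk \<in> L2 (restr_to_subalg H.joint (M \<Otimes>\<^sub>M M))"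
    "\<And>g. g \<in> carrier G \<Longrightarrow> AE (x, x') in H.joint. Hk (act g x, act g x') = Hk (x, x')"
    "\<And>h. h \<in> borel_measurable (gmeas (factor_space F)) \<Longrightarrow> \<not> (AE (x, x') in H.joint. Hk (x, x') = h x)"
    using not_mixing sfs dis unfolding jointly_relatively_weak_mixing_def fs[symmetric] by blast
  have Hm: "Hk \<in> borel_measurable (M \<Otimes>\<^sub>M M)" using Hk(1) unfolding L2_def by (simp add: mJ)
  have Hinv: "AE w in H.joint. Hk (act g (fst w), act g (snd w)) = Hk w" if "g \<in> carrier G" for g
    using Hk(2)[OF that] by (simp add: split_beta')
  have "\<not> (\<exists>h\<in>borel_measurable ?A. AE w in H.joint. Hk w = h (fst w))"
    using Hk(3) by (auto simp: mY split_beta')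
  \<comment> \<open>Contrapositive of \<open>invariant_on_factor\<close>: as \<open>Hk\<close> does
    not come from the factor, some bounded invariant kernel maps some bounded function outside
    it.\<close>
  then obtain K c f b where K: "K \<in> borel_measurable (M \<Otimes>\<^sub>M M)" "\<And>w. \<bar>K w\<bar> \<le> c"
      "\<And>g. g \<in> carrier G \<Longrightarrow> AE w in H.joint. K (act g (fst w), act g (snd w)) = K w"
      "f \<in> borel_measurable M" "\<And>x. \<bar>f x\<bar> \<le> b" "\<not> (AE x in M. H.avg (H.kop K f) x = H.kop K f x)"
    using H.invariant_on_factor[OF Hm Hinv] by blast
  obtain B where B: "admissible B" "sets ?A \<subseteq> sets B"
    "\<And>u. u \<in> borel_measurable B \<Longrightarrow> integrable M (\<lambda>x. (u x)\<^sup>2) \<Longrightarrow> H.ap_limit B u"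
    "\<exists>S\<in>sets B. \<forall>a\<in>sets ?A. (S - a) \<union> (a - S) \<notin> null_sets M"
    using H.compact_extension[OF K] by blast
  define F' where "F' = sets B"
  have F': "good F'" unfolding F'_def by (rule admissible_good[OF B(1)])
  have FF': "F \<subseteq> F'" using B(2) unfolding A F'_def .
  let ?B = "pullback X (\<lambda>x. x) (factor_space F')"
  have PB: "space ?B = space M" "sets ?B = F'" using sets_pullback[OF F' refl] by (simp_all add: space_pullback)
  have rB: "restr_to_subalg M ?B = restr_to_subalg M B"
    by (rule restr_to_subalg_cong) (simp only: PB F'_def[symmetric])
  have sB: "subalgebra M B" using B(1) unfolding admissible_def by blast
  have "nontrivial_extension (factor_space F') (\<lambda>x. x) (factor_space F)"
    unfolding nontrivial_extension_def eq_mod0_def sets_pullback[OF F space_factor_space] sets_factor_space[OF F']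
  proof
    assume "(\<forall>a\<in>F. \<exists>S\<in>F'. (a - S) \<union> (S - a) \<in> null_sets (gmeas (factor_space F'))) \<and>
      (\<forall>S\<in>F'. \<exists>a\<in>F. (a - S) \<union> (S - a) \<in> null_sets (gmeas (factor_space F')))"
    moreover have "null_sets (gmeas (factor_space F')) \<subseteq> null_sets M"
      unfolding factor_space_def using null_sets_restr_to_subalg[OF good_subalgebra[OF F']] by simp
    ultimately show False using B(4) unfolding A F'_def by (metis Un_commute subsetD)
  qed
  moreover have "relatively_compact G T X ?B (\<lambda>x. x) (factor_space F)"
    unfolding relatively_compact_def
  proof (intro conjI exI[of _ \<kappa>] ballI allI impI dis)
    show "short_factors_series G T X ?B (\<lambda>x. x) (factor_space F)"
      by (rule short_factors_series_factor[OF F PB FF']) (use F' good_act[OF F'] in \<open>auto simp: good_def\<close>)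
    fix \<phi> and \<epsilon> :: real assume "\<phi> \<in> L2 (restr_to_subalg M ?B)" "\<epsilon> > 0"
    then show "\<exists>\<psi>\<in>L2 (restr_to_subalg M ?B). FK_almost_periodic G X (factor_space F) \<kappa> \<psi> \<and>
        sqrt (\<integral>x. (cmod (\<phi> x - \<psi> x))\<^sup>2 \<partial>M) < \<epsilon>"
      unfolding rB by (intro H.FK_dense[OF Y sB B(3)])
  qed
  ultimately show ?thesis using F' FF' unfolding compact_step_def by blast
qed

text \<open>The factor stays put when no step exists, so for good \<open>F\<close> the fixed points
  are exactly the factors without a nontrivial relatively compact extension of this kind.\<close>

definition next_factor :: "'x set set \<Rightarrow> 'x set set" where
  "next_factor F = (if \<exists>F'. compact_step F F' then SOME F'. compact_step F F' else F)"

lemma next_factor: "\<exists>F'. compact_step F F' \<Longrightarrow> compact_step F (next_factor F)"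
  unfolding next_factor_def using someI_ex[of "compact_step F"] by simp

lemma compact_step_proper:
  assumes "good F" "compact_step F F'" shows "F' \<noteq> F"
proof
  assume "F' = F"
  then have "nontrivial_extension (factor_space F) (\<lambda>x. x) (factor_space F)" using assms(2) unfolding compact_step_def by simp
  then show False
    unfolding nontrivial_extension_def eq_mod0_def sets_pullback[OF assms(1) space_factor_space] sets_factor_space[OF assms(1)]
    by (metis Diff_cancel Un_absorb null_sets.empty_sets)
qed

sublocale tower: sigma_tower "space M" next_factor good
proof (rule sigma_tower.intro)
  show "sigma_algebra (space M) F" if "good F" for F using that unfolding good_def by blast
  fix N assume "\<And>F. F \<in> N \<Longrightarrow> good F"
  then show "good (sigma_sets (space M) (\<Union>N))" by (rule good_lub)
next
  fix F assume F: "good F"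
  consider "compact_step F (next_factor F)" | "next_factor F = F"
    using next_factor[of F] unfolding next_factor_def[of F] by (cases "\<exists>F'. compact_step F F'") auto
  then show "good (next_factor F)" "F \<subseteq> next_factor F"
    using F by (cases; simp add: compact_step_def)+
qed

lemma gspace_iso_zero: "gspace_iso G T (factor_space (ord_zero tower.tower_rel)) (trivial_factor X)"
proof -
  have eq: "trivial_factor X = factor_space (ord_zero tower.tower_rel)"
    unfolding tower.ord_zero_tower trivial_factor_def factor_space_def ..
  have "ord_zero tower.tower_rel \<in> tower.tower"
    using wo_rel.minim_in[OF tower.wo_rel_tower, of "tower.tower"] tower.tower_top(1)
    unfolding ord_zero_def tower.Field_tower_rel by blast
  then have g: "good (ord_zero tower.tower_rel)" by (rule tower.tower_good)
  show ?thesis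
    unfolding eq gspace_iso_def using factor_map_factor[OF g g] by blast
qed

text \<open>At a limit the sigma-algebra equals the one generated by its predecessors exactly, not
  only modulo null sets.\<close>

lemma inverse_limit_tower:
  assumes "ord_limit tower.tower_rel \<xi>"
  shows "inverse_limit G T (factor_space \<xi>) (underS tower.tower_rel \<xi>) (\<lambda>_ x. x) factor_space"
proof -
  note \<xi> = tower.ord_limit_tower[OF assms]
  note g = tower.tower_good[OF \<xi>(1)]
  have u: "\<theta> \<in> tower.tower" "\<theta> \<subseteq> \<xi>" if "\<theta> \<in> underS tower.tower_rel \<xi>" for \<theta>
    using that tower.underS_tower_rel[OF \<xi>(1)] by auto
  have sp: "sets (pullback (factor_space \<xi>) (\<lambda>x. x) (factor_space \<theta>)) = \<theta>"
    if "\<theta> \<in> underS tower.tower_rel \<xi>" for \<theta>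
    by (rule sets_pullback[OF tower.tower_good[OF u(1)[OF that]]]) simp
  have "(\<Union>\<theta>\<in>underS tower.tower_rel \<xi>. sets (pullback (factor_space \<xi>) (\<lambda>x. x) (factor_space \<theta>))) =
      \<Union>(underS tower.tower_rel \<xi>)"
    using sp by auto
  then have eq: "sigma_sets (space (gmeas (factor_space \<xi>)))
      (\<Union>\<theta>\<in>underS tower.tower_rel \<xi>. sets (pullback (factor_space \<xi>) (\<lambda>x. x) (factor_space \<theta>))) = sets (gmeas (factor_space \<xi>))"
    using \<xi>(2) sets_factor_space[OF g] by simp
  show ?thesis
    unfolding inverse_limit_def eq
  proof (intro conjI ballI)
    show "factor_map G T (factor_space \<xi>) (\<lambda>x. x) (factor_space \<theta>)" if "\<theta> \<in> underS tower.tower_rel \<xi>" for \<theta>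
      by (rule factor_map_factor[OF g tower.tower_good[OF u(1)[OF that]] u(2)[OF that]])
    show "eq_mod0 (gmeas (factor_space \<xi>)) (sets (gmeas (factor_space \<xi>))) (sets (gmeas (factor_space \<xi>)))"
      unfolding eq_mod0_def by (metis Diff_cancel Un_absorb null_sets.empty_sets)
  qed
qed

end

theorem theorem4p7:
  fixes G :: "('g, 'm) monoid_scheme" and T :: "'g topology" and X :: "('g, 'x) gspace"
  assumes "lcsc_group G T" and "amenable G T"
    and "standard_borel_gspace G T X" and "nontrivial_gspace X"
  shows "\<exists>(r :: 'x set set rel) \<eta> (Xs :: 'x set set \<Rightarrow> ('g, 'x) gspace)
            (\<pi> :: 'x set set \<Rightarrow> 'x \<Rightarrow> 'x) (\<rho> :: 'x set set \<Rightarrow> 'x set set \<Rightarrow> 'x \<Rightarrow> 'x).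
      ordinals_upto r \<eta> \<and>
      (\<forall>\<xi>\<in>Field r. factor_map G T X (\<pi> \<xi>) (Xs \<xi>)) \<and>
      (jointly_relatively_weak_mixing G T X (gmeas X) (\<pi> \<eta>) (Xs \<eta>) \<or>
       eq_mod0 (gmeas X) (sets (pullback X (\<pi> \<eta>) (Xs \<eta>))) (sets (gmeas X))) \<and>
      gspace_iso G T (Xs (ord_zero r)) (trivial_factor X) \<and>
      (\<forall>\<xi>\<in>Field r. \<forall>\<theta>\<in>underS r \<xi>.
         factor_map G T (Xs \<xi>) (\<rho> \<xi> \<theta>) (Xs \<theta>) \<and>
         (\<forall>x\<in>space (gmeas X). \<pi> \<theta> x = \<rho> \<xi> \<theta> (\<pi> \<xi> x))) \<and>
      (\<forall>\<xi>\<in>underS r \<eta>.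
         nontrivial_extension (Xs (ord_succ r \<xi>)) (\<rho> (ord_succ r \<xi>) \<xi>) (Xs \<xi>) \<and>
         relatively_compact G T X (pullback X (\<pi> (ord_succ r \<xi>)) (Xs (ord_succ r \<xi>))) (\<pi> \<xi>) (Xs \<xi>)) \<and>
      (\<forall>\<xi>. ord_limit r \<xi> \<longrightarrow> inverse_limit G T (Xs \<xi>) (underS r \<xi>) (\<rho> \<xi>) Xs)"
proof -
  obtain m where "left_haar_measure G T m" using assms(2) unfolding amenable_def by blast
  then interpret haar_action G T X m by unfold_locales (use assms in auto)
  let ?r = "tower.tower_rel" and ?\<eta> = "tower.tower_top"
  have good: "good \<xi>" if "\<xi> \<in> Field ?r" for \<xi>
    using that tower.tower_good unfolding tower.Field_tower_rel by blast
  have top: "good ?\<eta>" by (rule tower.tower_good[OF tower.tower_top(1)])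
  \<comment> \<open>At the top \<open>next_factor\<close> changes nothing, whereas a compact step is
    proper; failure of mixing would supply such a step.\<close>
  have mixing: "jointly_relatively_weak_mixing G T X (gmeas X) (\<lambda>x. x) (factor_space ?\<eta>)"
  proof (rule ccontr)
    assume "\<not> ?thesis"
    from next_factor[OF compact_step_exists[OF top this]] show False
      using compact_step_proper[OF top] tower.S_tower_top by blast
  qed
  have under: "\<theta> \<in> tower.tower \<and> \<theta> \<subseteq> \<xi>" if "\<xi> \<in> Field ?r" "\<theta> \<in> underS ?r \<xi>" for \<xi> \<theta>
    using that tower.underS_tower_rel unfolding tower.Field_tower_rel by blast
  have step: "compact_step \<xi> (ord_succ ?r \<xi>)" if "\<xi> \<in> underS ?r ?\<eta>" for \<xi>
  proof -
    have \<xi>: "\<xi> \<in> tower.tower" "\<xi> \<noteq> ?\<eta>"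
      using that tower.underS_tower_rel[OF tower.tower_top(1)] by auto
    \<comment> \<open>Without a step \<xi> would be fixed by \<open>next_factor\<close>, hence the
      greatest member of the tower, contrary to lying strictly below the top.\<close>
    have "\<exists>F'. compact_step \<xi> F'"
    proof (rule ccontr)
      assume "\<not> ?thesis"
      then have "next_factor \<xi> = \<xi>" unfolding next_factor_def by (rule if_not_P)
      then have "?\<eta> \<subseteq> \<xi>" by (rule tower.tower_fixpoint_greatest[OF \<xi>(1) _ tower.tower_top(1)])
      then show False using \<xi> tower.tower_top(2)[OF \<xi>(1)] by blast
    qed
    then show ?thesis using next_factor tower.ord_succ_tower[OF \<xi>] by simp
  qed
  show ?thesis
  proof (intro exI[of _ ?r] exI[of _ ?\<eta>] exI[of _ factor_space] exI[of _ "\<lambda>_ x. x"] exI[of _ "\<lambda>_ _ x. x"] conjI ballI allI impI)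
    show "ordinals_upto ?r ?\<eta>" by (rule tower.ordinals_upto_tower)
    show "factor_map G T X (\<lambda>x. x) (factor_space \<xi>)" if "\<xi> \<in> Field ?r" for \<xi>
      by (rule factor_map_X[OF good[OF that]])
    show "jointly_relatively_weak_mixing G T X (gmeas X) (\<lambda>x. x) (factor_space ?\<eta>) \<or>
       eq_mod0 (gmeas X) (sets (pullback X (\<lambda>x. x) (factor_space ?\<eta>))) (sets (gmeas X))"
      using mixing ..
    show "gspace_iso G T (factor_space (ord_zero ?r)) (trivial_factor X)" by (rule gspace_iso_zero)
    show "factor_map G T (factor_space \<xi>) (\<lambda>x. x) (factor_space \<theta>)" if "\<xi> \<in> Field ?r" "\<theta> \<in> underS ?r \<xi>" for \<xi> \<theta>
      using factor_map_factor[OF good[OF that(1)] tower.tower_good] under[OF that] by blast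
    show "nontrivial_extension (factor_space (ord_succ ?r \<xi>)) (\<lambda>x. x) (factor_space \<xi>)"
      "relatively_compact G T X (pullback X (\<lambda>x. x) (factor_space (ord_succ ?r \<xi>))) (\<lambda>x. x) (factor_space \<xi>)"
      if "\<xi> \<in> underS ?r ?\<eta>" for \<xi>
      using step[OF that] unfolding compact_step_def by blast+
    show "inverse_limit G T (factor_space \<xi>) (underS ?r \<xi>) (\<lambda>_ x. x) factor_space" if "ord_limit ?r \<xi>" for \<xi>
      by (rule inverse_limit_tower[OF that])
  qed simp
qed

end
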